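(* Let $n\ge 2$. Let $F(Y,\mathbf{X})\in\mathbb{Z}[Y,X_1,\ldots,X_n]$ be a strongly $n$-genuine polynomial (over $\mathbb{Q}$) of total degree $D$. Then for all $B\ge 1$, $$\#\{\mathbf{x}'\in\mathbb{Z}^{n-1}\cap[-B,B]^{n-1}:\ F(Y,X_1,\mathbf{x}')\text{ is reducible over }\overline{\mathbb{Q}}\}\ll_{n,D}B^{n-2}.$$ Also, there exists a finite set $\mathcal{E}$ of exceptional primes, with $|\mathcal{E}|\ll_{n,D}\log\|F\|/\log\log\|F\|$, such that for all primes $p\notin\mathcal{E}$, $$\#\{\mathbf{x}'\in\mathbb{F}_p^{n-1}:\ F(Y,X_1,\mathbf{x}')\text{ is reducible over }\overline{\mathbb{F}}_p\}\ll_{n,D}p^{n-2}.$$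
   Context: Let $K$ be a number field and $\mathbf{X}=(X_1,\ldots,X_n)$. A finite (nontrivial) extension $M$ of $K(\mathbf{X})$ is an $n$-genuine extension if for every $G(Y,\mathbf{X})\in K[Y,X_1,\ldots,X_n]$ such that $M=K(\mathbf{X})[Y]/(G(Y,\mathbf{X}))$, the polynomial $G$ has nonzero degree in each of $X_1,\ldots,X_n$. Such an $M$ is a strongly $n$-genuine extension of $K(\mathbf{X})$ if every subextension $M'$ with $K(\mathbf{X})\subsetneq M'\subset M$ is an $n$-genuine extension of $K(\mathbf{X})$. A polynomial $G(Y,\mathbf{X})\in K[Y,X_1,\ldots,X_n]$ that is monic in $Y$ and irreducible over $K(\mathbf{X})$ is a strongly $n$-genuine polynomial if $K(\mathbf{X})[Y]/(G(Y,\mathbf{X}))$ is a strongly $n$-genuine extension of $K(\mathbf{X})$. Here $K=\mathbb{Q}$. For a field $\mathcal{K}$, a polynomial $f(Y,Z)\in\mathcal{K}[Y,Z]$ monic in $Y$ is reducible over $\overline{\mathcal{K}}$ if $f=f_1f_2$ with $f_1,f_2\in\overline{\mathcal{K}}[Y,Z]$ and $1\le\deg f_1<\deg f$. Write $\mathbf{x}'=(x_2,\ldots,x_n)$ for values substituted for $(X_2,\ldots,X_n)$; over $\mathbb{F}_p$ the coefficients of $F$ are reduced modulo $p$. $\|F\|$ is the maximum absolute value of the coefficients of $F$. In the quantity $\log\|F\|/\log\log\|F\|$, $\|F\|$ is read as $\max(\|F\|,3)$. *)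

theory Defs
  imports
    Complex_Main
    "HOL-Library.Poly_Mapping"
    "HOL-Library.FuncSet"
    "HOL-Computational_Algebra.Polynomial"
    "HOL-Computational_Algebra.Fraction_Field"
    "HOL-Algebra.Algebraic_Closure_Type"
    "HOL-Algebra.UnivPoly"
    "HOL-Number_Theory.Residues"
begin

text \<open>
  Polynomials in variables \<open>X\<^sub>0, X\<^sub>1, X\<^sub>2, \<dots>\<close>; the exponent vector \<open>m\<close> stands for the
  monomial \<open>\<Prod>i. X\<^sub>i ^ lookup m i\<close>. A polynomial \<open>G(Y, X)\<close> is an element of
  \<open>'k mpoly poly\<close>, whose outer variable is \<open>Y\<close>.
\<close>

type_synonym 'k mpoly = "(nat \<Rightarrow>\<^sub>0 nat) \<Rightarrow>\<^sub>0 'k"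

definition in_vars :: "nat \<Rightarrow> 'k::zero mpoly \<Rightarrow> bool" where
  "in_vars n a \<longleftrightarrow> (\<forall>m\<in>Poly_Mapping.keys a. Poly_Mapping.keys m \<subseteq> {1..n})"

definition polys_YX :: "nat \<Rightarrow> 'k::zero mpoly poly set" where
  "polys_YX n = {G. \<forall>j. in_vars n (Polynomial.coeff G j)}"

text \<open>A pair \<open>(j, m)\<close> encodes the monomial \<open>Y^j X^m\<close>.\<close>

definition monomials :: "'k::zero mpoly poly \<Rightarrow> (nat \<times> (nat \<Rightarrow>\<^sub>0 nat)) set" where
  "monomials G = {(j, m). m \<in> Poly_Mapping.keys (Polynomial.coeff G j)}"

definition total_deg :: "'k::zero mpoly poly \<Rightarrow> nat" where
  "total_deg G = Max (insert 0
     ((\<lambda>(j, m). j + (\<Sum>i\<in>Poly_Mapping.keys m. Poly_Mapping.lookup m i)) ` monomials G))"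

definition deg_X :: "nat \<Rightarrow> 'k::zero mpoly poly \<Rightarrow> nat" where
  "deg_X i G = Max (insert 0 ((\<lambda>(j, m). Poly_Mapping.lookup m i) ` monomials G))"

definition coeff_norm :: "int mpoly poly \<Rightarrow> int" where
  "coeff_norm F = Max (insert 0
     ((\<lambda>(j, m). \<bar>Poly_Mapping.lookup (Polynomial.coeff F j) m\<bar>) ` monomials F))"

definition to_rat_poly :: "int mpoly poly \<Rightarrow> rat mpoly poly" where
  "to_rat_poly F = map_poly (Poly_Mapping.map rat_of_int) F"


text \<open>
  The field \<open>K(X\<^sub>1, \<dots>, X\<^sub>n)\<close> and the ring \<open>K(X\<^sub>1, \<dots>, X\<^sub>n)[Y]\<close>, cut out of the corresponding
  types with infinitely many variables.
\<close>

definition KX :: "nat \<Rightarrow> 'k::field mpoly fract ring" where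
  "KX n = ring_of_type_algebra
     \<lparr>carrier := {Fract a b |a b. in_vars n a \<and> in_vars n b \<and> b \<noteq> 0}\<rparr>"

definition KX_Y :: "nat \<Rightarrow> 'k::field mpoly fract poly ring" where
  "KX_Y n = ring_of_type_algebra
     \<lparr>carrier := {p. \<forall>j. Polynomial.coeff p j \<in> carrier (KX n)}\<rparr>"

definition to_KX_Y :: "'k::field mpoly poly \<Rightarrow> 'k mpoly fract poly" where
  "to_KX_Y G = map_poly (\<lambda>a. Fract a 1) G"

text \<open>The \<open>K(X)\<close>-algebra \<open>K(X)[Y]/(G)\<close> and its structure map.\<close>

definition quot_alg :: "nat \<Rightarrow> 'k::field mpoly poly \<Rightarrow> 'k mpoly fract poly set ring" where
  "quot_alg n G = KX_Y n Quot (PIdl\<^bsub>KX_Y n\<^esub> (to_KX_Y G))"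

definition quot_emb :: "nat \<Rightarrow> 'k::field mpoly poly \<Rightarrow> 'k mpoly fract \<Rightarrow> 'k mpoly fract poly set" where
  "quot_emb n G c = (PIdl\<^bsub>KX_Y n\<^esub> (to_KX_Y G)) +>\<^bsub>KX_Y n\<^esub> [:c:]"

text \<open>An extension of \<open>K(X)\<close> is a field \<open>M\<close> together with its embedding \<open>\<iota>\<close>.\<close>

definition finite_nontrivial_ext :: "nat \<Rightarrow> 'b ring \<Rightarrow> ('k::field mpoly fract \<Rightarrow> 'b) \<Rightarrow> bool" where
  "finite_nontrivial_ext n M \<iota> \<longleftrightarrow>
     field M \<and> \<iota> \<in> ring_hom (KX n) M \<and>
     ring.finite_dimension M (\<iota> ` carrier (KX n)) (carrier M) \<and>
     \<iota> ` carrier (KX n) \<noteq> carrier M"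

text \<open>\<open>M = K(X)[Y]/(G)\<close> is read as an isomorphism of extensions of \<open>K(X)\<close>.\<close>

definition presented_by :: "nat \<Rightarrow> 'b ring \<Rightarrow> ('k::field mpoly fract \<Rightarrow> 'b) \<Rightarrow> 'k mpoly poly \<Rightarrow> bool" where
  "presented_by n M \<iota> G \<longleftrightarrow>
     (\<exists>h \<in> ring_iso (quot_alg n G) M. \<forall>c \<in> carrier (KX n). h (quot_emb n G c) = \<iota> c)"

definition genuine_ext :: "nat \<Rightarrow> 'b ring \<Rightarrow> ('k::field mpoly fract \<Rightarrow> 'b) \<Rightarrow> bool" where
  "genuine_ext n M \<iota> \<longleftrightarrow>
     finite_nontrivial_ext n M \<iota> \<and>
     (\<forall>G \<in> polys_YX n. presented_by n M \<iota> G \<longrightarrow> (\<forall>i\<in>{1..n}. deg_X i G \<noteq> 0))"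

definition strongly_genuine_ext :: "nat \<Rightarrow> 'b ring \<Rightarrow> ('k::field mpoly fract \<Rightarrow> 'b) \<Rightarrow> bool" where
  "strongly_genuine_ext n M \<iota> \<longleftrightarrow>
     finite_nontrivial_ext n M \<iota> \<and>
     (\<forall>M'. subfield M' M \<and> \<iota> ` carrier (KX n) \<subset> M' \<longrightarrow> genuine_ext n (M\<lparr>carrier := M'\<rparr>) \<iota>)"

definition strongly_genuine_poly :: "nat \<Rightarrow> 'k::field mpoly poly \<Rightarrow> bool" where
  "strongly_genuine_poly n G \<longleftrightarrow>
     G \<in> polys_YX n \<and> lead_coeff G = 1 \<and>
     ring_irreducible\<^bsub>KX_Y n\<^esub> (to_KX_Y G) \<and>
     strongly_genuine_ext n (quot_alg n G) (quot_emb n G)"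


text \<open>
  An element \<open>f\<close> of \<open>carrier (UP (UP R))\<close> is the polynomial in \<open>R[Y, Z]\<close> whose coefficient at
  \<open>Y^i Z^j\<close> is \<open>f i j\<close>; \<open>total_deg2\<close> is its total degree.
\<close>

definition total_deg2 :: "'a ring \<Rightarrow> (nat \<Rightarrow> nat \<Rightarrow> 'a) \<Rightarrow> nat" where
  "total_deg2 R f = Max (insert 0 {i + j |i j. f i j \<noteq> \<zero>\<^bsub>R\<^esub>})"

text \<open>\<open>ring.indexed_const R\<close> is the embedding of \<open>R\<close> into \<open>field.alg_closure R\<close>.\<close>

definition reducible_over_closure :: "'a ring \<Rightarrow> (nat \<Rightarrow> nat \<Rightarrow> 'a) \<Rightarrow> bool" where
  "reducible_over_closure R f \<longleftrightarrow>
     (let L = field.alg_closure R;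
          f' = (\<lambda>i j. ring.indexed_const R (f i j))
      in \<exists>f1 \<in> carrier (UP (UP L)). \<exists>f2 \<in> carrier (UP (UP L)).
           f' = f1 \<otimes>\<^bsub>UP (UP L)\<^esub> f2 \<and> 1 \<le> total_deg2 L f1 \<and> total_deg2 L f1 < total_deg2 L f')"

text \<open>
  \<open>F(Y, X\<^sub>1, x\<^sub>2, \<dots>, x\<^sub>n)\<close> in \<open>R[Y, X\<^sub>1]\<close>, the coefficients of \<open>F\<close> being mapped to \<open>R\<close> by \<open>\<phi>\<close>.
\<close>

definition specialize ::
  "'a ring \<Rightarrow> (int \<Rightarrow> 'a) \<Rightarrow> nat \<Rightarrow> int mpoly poly \<Rightarrow> (nat \<Rightarrow> 'a) \<Rightarrow> nat \<Rightarrow> nat \<Rightarrow> 'a" where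
  "specialize R \<phi> n F x i j =
     (\<Oplus>\<^bsub>R\<^esub>m \<in> {m \<in> Poly_Mapping.keys (Polynomial.coeff F i). Poly_Mapping.lookup m 1 = j}.
        \<phi> (Poly_Mapping.lookup (Polynomial.coeff F i) m)
        \<otimes>\<^bsub>R\<^esub> (\<Otimes>\<^bsub>R\<^esub>k \<in> {2..n}. x k [^]\<^bsub>R\<^esub> Poly_Mapping.lookup m k))"

definition reducible_at_int :: "nat \<Rightarrow> int mpoly poly \<Rightarrow> (nat \<Rightarrow> int) \<Rightarrow> bool" where
  "reducible_at_int n F x \<longleftrightarrow>
     reducible_over_closure (ring_of_type_algebra :: rat ring)
       (specialize ring_of_type_algebra rat_of_int n F (\<lambda>k. rat_of_int (x k)))"

definition reducible_at_mod :: "nat \<Rightarrow> nat \<Rightarrow> int mpoly poly \<Rightarrow> (nat \<Rightarrow> int) \<Rightarrow> bool" where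
  "reducible_at_mod p n F x \<longleftrightarrow>
     reducible_over_closure (residue_ring (int p))
       (specialize (residue_ring (int p)) (\<lambda>c. c mod int p) n F x)"

end

theory Submission
  imports Defs "HOL-Library.Nat_Bijection"
begin

text \<open>
  Write \<open>X = X\<^sub>1\<close> and \<open>k = \<rat>(X\<^sub>2, \<dots>, X\<^sub>n)\<close>, and regard \<open>F\<close> as a polynomial of degree \<open>e\<close> in \<open>Y\<close> over
  \<open>k[X]\<close>. Reducibility is detected by linear algebra, through closed differential forms
  \<open>(g dY + h dX) / F\<close> in the style of Ruppert and Gao, combined with a test for repeated factors.

  Suppose that a specialisation \<open>f\<close> of \<open>F\<close> factors as \<open>f = f\<^sub>1 f\<^sub>2\<close> over a field, with degrees
  \<open>e\<^sub>1, e\<^sub>2 > 0\<close> in \<open>Y\<close>. The form \<open>e\<^sub>2 df\<^sub>1 / f\<^sub>1 - e\<^sub>1 df\<^sub>2 / f\<^sub>2\<close> is closed, and the weights make the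
  coefficient of \<open>Y^(e - 1)\<close> in the numerator \<open>g\<close> cancel. If this form vanishes, then
  \<open>(e \<partial>\<^sub>Y f\<^sub>2) f = (e\<^sub>2 f\<^sub>2) \<partial>\<^sub>Y f\<close>, a relation \<open>s f = t \<partial>\<^sub>Y f\<close> with \<open>t \<noteq> 0\<close> of degree less than \<open>e\<close>.
  In either case a homogeneous linear system in the coefficients of \<open>g, h, s, t\<close>, whose matrix has
  entries in the \<open>\<int>\<close>-span of the coefficients of \<open>f\<close>, has a nonzero solution
  (\<open>factorisation_gives_kernel_vector\<close>), provided that the characteristic does not divide \<open>e\<^sub>2\<close>.

  For \<open>F\<close> itself, over \<open>k\<close>, the system has only the zero solution
  (\<open>strongly_genuine_imp_no_kernel\<close>). Put \<open>K = \<rat>(X\<^sub>1, \<dots>, X\<^sub>n)\<close> and \<open>M = K[Y]/(F)\<close>. A closed form gives an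
  element \<open>a = g / \<partial>\<^sub>Y F\<close> of \<open>M\<close> whose derivative along \<open>X\<^sub>1\<close> is zero. Differentiating its minimal
  polynomial over \<open>K\<close> shows that this polynomial has coefficients in \<open>k\<close>; so if \<open>a\<close> were not in \<open>K\<close>, the
  subextension \<open>K(a)\<close> would be presented by a polynomial without \<open>X\<^sub>1\<close>, against strong genuineness
  (\<open>constant_imp_base\<close>). Hence \<open>g = a \<partial>\<^sub>Y F\<close> with \<open>a \<in> K\<close>, and the degree of \<open>g\<close> forces \<open>g = 0\<close>, then
  \<open>h = 0\<close> (\<open>closed_form_trivial\<close>). The relation \<open>s F = t \<partial>\<^sub>Y F\<close> is trivial because \<open>F\<close> is prime to
  \<open>\<partial>\<^sub>Y F\<close>.

  Fraction-free elimination (\<open>elimination\<close>) turns the absence of solutions into one nonzero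
  \<open>\<Delta> \<in> \<int>[X\<^sub>2, \<dots>, X\<^sub>n]\<close>, of degree bounded in terms of \<open>n, D\<close> and with coefficients bounded by a
  polynomial in \<open>\<parallel>F\<parallel>\<close>, which vanishes at every specialisation where the system becomes solvable,
  in particular at every reducible one, over \<open>\<rat>\<close> or modulo a prime \<open>p > D\<close>. Counting the zeros of
  \<open>\<Delta>\<close> gives both bounds. The exceptional primes are the divisors of one nonzero coefficient \<open>c\<close> of
  \<open>\<Delta>\<close>, and their number is \<open>O(log \<bar>c\<bar> / log log \<bar>c\<bar>)\<close>. Primes \<open>p \<le> D\<close> satisfy the bound trivially.
\<close>

declare One_nat_def [simp del]

abbreviation "lookup \<equiv> Poly_Mapping.lookup"
abbreviation "keys \<equiv> Poly_Mapping.keys"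
abbreviation "single \<equiv> Poly_Mapping.single"
abbreviation "pcoeff \<equiv> Polynomial.coeff"
abbreviation "pdeg \<equiv> Polynomial.degree"
abbreviation "coeff2 p i j \<equiv> pcoeff (pcoeff p i) j"


section \<open>Ring homomorphisms and linear extension\<close>

locale rhom =
  fixes h :: "'a::comm_ring_1 \<Rightarrow> 'b::comm_ring_1"
  assumes hom_add: "h (x + y) = h x + h y"
    and hom_mult: "h (x * y) = h x * h y"
    and hom_one: "h 1 = 1"
begin

lemma hom_zero: "h 0 = 0"
  using hom_add[of 0 0] by simp

lemma hom_uminus: "h (- x) = - h x"
  using hom_add[of x "- x"] hom_zero by (simp add: eq_neg_iff_add_eq_0 add.commute)

lemma hom_minus: "h (x - y) = h x - h y"
  using hom_add[of x "- y"] hom_uminus by simp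

lemma hom_sum: "h (sum f A) = (\<Sum>i\<in>A. h (f i))"
  by (induction A rule: infinite_finite_induct) (auto simp: hom_zero hom_add)

lemma hom_of_nat: "h (of_nat k) = of_nat k"
  by (induction k) (auto simp: hom_zero hom_one hom_add)

lemma coeff_map: "pcoeff (map_poly h p) i = h (pcoeff p i)"
  by (simp add: coeff_map_poly hom_zero)

lemma hom_map_poly: "rhom (map_poly h)"
proof
  show "map_poly h (p + q) = map_poly h p + map_poly h q" for p q
    by (rule poly_eqI) (simp add: coeff_map hom_add)
  show "map_poly h (p * q) = map_poly h p * map_poly h q" for p q
    by (rule poly_eqI) (simp add: coeff_map coeff_mult hom_sum hom_mult)
  show "map_poly h 1 = 1"
    by (rule poly_eqI) (simp add: coeff_map hom_zero hom_one)
qed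

lemma hom_poly: "h (poly p x) = poly (map_poly h p) (h x)"
  by (induction p) (auto simp: hom_zero hom_add hom_mult map_poly_pCons)

end

lemma map_poly_pderiv:
  fixes h :: "'a::idom \<Rightarrow> 'b::idom"
  assumes "rhom h"
  shows "map_poly h (pderiv p) = pderiv (map_poly h p)"
proof -
  interpret rhom h by fact
  show ?thesis
    by (rule poly_eqI) (simp add: coeff_map coeff_pderiv hom_mult hom_add hom_one hom_of_nat)
qed

lemma rhom_comp: "rhom f \<Longrightarrow> rhom g \<Longrightarrow> rhom (\<lambda>x. g (f x))"
  by (auto simp: rhom_def)

lemma rhom_poly: "rhom (\<lambda>p. poly p x)"
  by (auto simp: rhom_def)

lemma rhom_of_int: "rhom of_int"
  by (auto simp: rhom_def)

text \<open>
  The additive map whose value on the monomial \<open>c X^m\<close> is \<open>\<phi> m c\<close>. Evaluation, isolation of one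
  variable and change of coefficients all have this form, and such a map is a ring homomorphism as
  soon as it is multiplicative on monomials.
\<close>

definition lin_ext :: "('m \<Rightarrow> 'k \<Rightarrow> 'r) \<Rightarrow> ('m \<Rightarrow>\<^sub>0 'k::zero) \<Rightarrow> 'r::comm_monoid_add" where
  "lin_ext \<phi> a = (\<Sum>m\<in>keys a. \<phi> m (lookup a m))"

lemma lin_ext_superset:
  assumes "finite K" "keys a \<subseteq> K" "\<And>m. \<phi> m 0 = 0"
  shows "lin_ext \<phi> a = (\<Sum>m\<in>K. \<phi> m (lookup a m))"
  unfolding lin_ext_def
  by (rule sum.mono_neutral_left) (use assms in \<open>auto simp: in_keys_iff\<close>)

lemma lin_ext_zero: "lin_ext \<phi> 0 = 0"
  by (simp add: lin_ext_def)

lemma lin_ext_add: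
  assumes "\<And>m. \<phi> m 0 = 0" "\<And>m c d. \<phi> m (c + d) = \<phi> m c + \<phi> m d"
  shows "lin_ext \<phi> (a + b) = lin_ext \<phi> a + lin_ext \<phi> (b :: 'm \<Rightarrow>\<^sub>0 'k::comm_monoid_add)"
proof -
  let ?K = "keys a \<union> keys b"
  have "lin_ext \<phi> (a + b) = (\<Sum>m\<in>?K. \<phi> m (lookup (a + b) m))"
    by (rule lin_ext_superset) (use assms keys_add[of a b] in auto)
  also have "\<dots> = lin_ext \<phi> a + lin_ext \<phi> b"
    by (simp add: lookup_add assms sum.distrib lin_ext_superset[of ?K _ \<phi>])
  finally show ?thesis .
qed

lemma lin_ext_sum:
  assumes "\<And>m. \<phi> m 0 = 0" "\<And>m c d. \<phi> m (c + d) = \<phi> m c + \<phi> m d"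
  shows "lin_ext \<phi> (sum f I) = (\<Sum>i\<in>I. lin_ext \<phi> (f i :: 'm \<Rightarrow>\<^sub>0 'k::comm_monoid_add))"
  by (induction I rule: infinite_finite_induct) (auto simp: lin_ext_zero lin_ext_add assms)

lemma lin_ext_single: "\<phi> m 0 = 0 \<Longrightarrow> lin_ext \<phi> (single m c) = \<phi> m c"
  by (cases "c = 0") (auto simp: lin_ext_def)

lemma sum_single: "(\<Sum>m\<in>keys a. single m (lookup a m)) = a"
  (is "?s = a")
proof (rule poly_mapping_eqI)
  fix k
  show "lookup ?s k = lookup a k"
    by (simp add: lookup_sum lookup_single when_def in_keys_iff)
qed

lemma mult_eq_sum_single:
  "a * b = (\<Sum>m\<in>keys a. \<Sum>m'\<in>keys b.
      single (m + m') (lookup a m * lookup b m'))"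
  for a b :: "'m::monoid_add \<Rightarrow>\<^sub>0 'k::semiring_0"
proof -
  have "a * b = (\<Sum>m\<in>keys a. single m (lookup a m)) *
     (\<Sum>m\<in>keys b. single m (lookup b m))"
    by (simp add: sum_single)
  also have "\<dots> = (\<Sum>m\<in>keys a. \<Sum>m'\<in>keys b.
      single (m + m') (lookup a m * lookup b m'))"
    by (simp add: sum_product mult_single)
  finally show ?thesis .
qed

lemma lin_ext_mult:
  fixes \<phi> :: "'m::monoid_add \<Rightarrow> 'k::semiring_0 \<Rightarrow> 'r::semiring_0"
  assumes z: "\<And>m. \<phi> m 0 = 0" and a: "\<And>m c d. \<phi> m (c + d) = \<phi> m c + \<phi> m d"
    and m: "\<And>m m' c d. \<phi> (m + m') (c * d) = \<phi> m c * \<phi> m' d"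
  shows "lin_ext \<phi> (a * b) = lin_ext \<phi> a * lin_ext \<phi> b"
proof -
  have "lin_ext \<phi> (a * b) = (\<Sum>m\<in>keys a. \<Sum>m'\<in>keys b.
      \<phi> (m + m') (lookup a m * lookup b m'))"
    by (subst mult_eq_sum_single) (simp add: lin_ext_sum z a lin_ext_single)
  thus ?thesis by (simp add: m sum_product lin_ext_def)
qed

lemma rhom_lin_ext:
  fixes \<phi> :: "'m::comm_monoid_add \<Rightarrow> 'k::comm_ring_1 \<Rightarrow> 'r::comm_ring_1"
  assumes "\<And>m. \<phi> m 0 = 0" "\<And>m c d. \<phi> m (c + d) = \<phi> m c + \<phi> m d"
    and "\<And>m m' c d. \<phi> (m + m') (c * d) = \<phi> m c * \<phi> m' d" "\<phi> 0 1 = 1"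
  shows "rhom (lin_ext \<phi>)"
proof
  show "lin_ext \<phi> 1 = 1"
    by (simp add: lin_ext_def assms)
qed (use assms in \<open>auto intro!: lin_ext_add lin_ext_mult\<close>)

section \<open>Evaluation, isolation of a variable, and size\<close>

definition monom_val :: "('v \<Rightarrow> 'r) \<Rightarrow> ('v \<Rightarrow>\<^sub>0 nat) \<Rightarrow> 'r::comm_ring_1" where
  "monom_val x m = (\<Prod>k\<in>keys m. x k ^ lookup m k)"

lemma monom_val_superset:
  assumes "finite K" "keys m \<subseteq> K"
  shows "monom_val x m = (\<Prod>k\<in>K. x k ^ lookup m k)"
  unfolding monom_val_def
  by (rule prod.mono_neutral_left) (use assms in \<open>auto simp: in_keys_iff\<close>)

lemma monom_val_add: "monom_val x (m + m') = monom_val x m * monom_val x m'"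
proof -
  let ?K = "keys m \<union> keys m'"
  have "monom_val x (m + m') = (\<Prod>k\<in>?K. x k ^ lookup (m + m') k)"
    by (rule monom_val_superset) (use keys_add[of m m'] in auto)
  thus ?thesis
    by (simp add: monom_val_superset[of ?K] lookup_add power_add prod.distrib)
qed

definition eval_at :: "(nat \<Rightarrow> int) \<Rightarrow> int mpoly \<Rightarrow> int" where
  "eval_at x = lin_ext (\<lambda>m c. c * monom_val x m)"

lemma rhom_eval_at: "rhom (eval_at x)"
  unfolding eval_at_def
  by (rule rhom_lin_ext) (auto simp: algebra_simps monom_val_add, simp add: monom_val_def)

text \<open>Unlike \<^const>\<open>in_vars\<close>, this can express that a polynomial is free of \<open>X\<^sub>1\<close>.\<close>

definition vars_in :: "nat set \<Rightarrow> 'k::zero mpoly \<Rightarrow> bool" where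
  "vars_in V a \<longleftrightarrow> (\<forall>m\<in>keys a. keys m \<subseteq> V)"

lemma in_vars_eq: "in_vars n = vars_in {1..n}"
  by (rule ext) (simp add: in_vars_def vars_in_def)

lemma vars_in_mono: "V \<subseteq> W \<Longrightarrow> vars_in V a \<Longrightarrow> vars_in W a"
  unfolding vars_in_def by blast

lemma vars_in_zero [simp]: "vars_in V 0"
  and vars_in_one [simp]: "vars_in V 1"
  by (auto simp: vars_in_def)

lemma vars_in_single: "keys m \<subseteq> V \<Longrightarrow> vars_in V (single m c)"
  by (cases "c = 0") (auto simp: vars_in_def)

lemma vars_in_add: "vars_in V a \<Longrightarrow> vars_in V b \<Longrightarrow> vars_in V (a + b)"
  using keys_add[of a b] unfolding vars_in_def by blast

lemma vars_in_uminus: "vars_in V a \<Longrightarrow> vars_in V (- a)"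
  for a :: "'k::ab_group_add mpoly"
  by (auto simp: vars_in_def in_keys_iff)

lemma vars_in_minus: "vars_in V a \<Longrightarrow> vars_in V b \<Longrightarrow> vars_in V (a - b)"
  for a :: "'k::ab_group_add mpoly"
  using vars_in_add[OF _ vars_in_uminus[of V b]] by simp

lemma vars_in_mult: "vars_in V a \<Longrightarrow> vars_in V b \<Longrightarrow> vars_in V (a * b)"
  for a :: "'k::semiring_0 mpoly"
proof -
  assume a: "vars_in V a" "vars_in V b"
  have "keys (u + v) \<subseteq> V" if "u \<in> keys a" "v \<in> keys b" for u v
    using a that keys_add[of u v] unfolding vars_in_def by blast
  thus ?thesis using keys_mult[of a b] unfolding vars_in_def by blast
qed

lemma vars_in_sum: "(\<And>i. i \<in> I \<Longrightarrow> vars_in V (f i)) \<Longrightarrow> vars_in V (sum f I)"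
  by (induction I rule: infinite_finite_induct) (auto intro: vars_in_add)

lemma vars_in_power: "vars_in V a \<Longrightarrow> vars_in V (a ^ j)"
  for a :: "'k::comm_semiring_1 mpoly"
  by (induction j) (auto intro: vars_in_mult)

lemma vars_in_of_nat: "vars_in V (of_nat j)"
  for j :: nat
  by (induction j) (auto intro: vars_in_add)

definition drop1 :: "(nat \<Rightarrow>\<^sub>0 nat) \<Rightarrow> (nat \<Rightarrow>\<^sub>0 nat)" where
  "drop1 m = Poly_Mapping.update 1 0 m"

lemma lookup_drop1: "lookup (drop1 m) k = (if k = 1 then 0 else lookup m k)"
  by (simp add: drop1_def lookup_update)

lemma drop1_add: "drop1 (m + m') = drop1 m + drop1 m'"
  by (rule poly_mapping_eqI) (simp add: lookup_drop1 lookup_add)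

lemma drop1_zero: "drop1 0 = 0"
  by (rule poly_mapping_eqI) (simp add: lookup_drop1)

lemma keys_drop1: "keys (drop1 m) = keys m - {1}"
  by (auto simp: in_keys_iff lookup_drop1 split: if_splits)

lemma drop1_split: "drop1 m + single 1 (lookup m 1) = m"
  by (rule poly_mapping_eqI) (simp add: lookup_drop1 lookup_add lookup_single when_def)

text \<open>
  Rewriting a polynomial as a polynomial in \<open>X\<^sub>1\<close> whose coefficients are free of \<open>X\<^sub>1\<close>. The inverse
  is the substitution of \<open>X\<^sub>1\<close> for the outer variable.
\<close>

definition isolate1 :: "'k::comm_ring_1 mpoly \<Rightarrow> 'k mpoly poly" where
  "isolate1 = lin_ext (\<lambda>m c. Polynomial.monom (single (drop1 m) c) (lookup m 1))"

definition X1 :: "'k::comm_ring_1 mpoly" where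
  "X1 = single (single 1 1) 1"

lemma rhom_isolate1: "rhom isolate1"
  unfolding isolate1_def
  by (rule rhom_lin_ext)
    (auto simp: single_add add_monom mult_monom mult_single drop1_add lookup_add,
      simp add: drop1_zero monom_0)

lemma X1_power: "(X1 :: 'a::comm_ring_1 mpoly) ^ j = single (single 1 j) 1"
proof (induction j)
  case (Suc j)
  have "X1 ^ Suc j = single (single 1 1 + single 1 j) (1::'a)"
    unfolding power_Suc Suc by (simp add: X1_def mult_single)
  also have "single (1::nat) 1 + single 1 j = single 1 (Suc j)"
    by (simp flip: single_add plus_1_eq_Suc)
  finally show ?case .
qed auto

lemma poly_isolate1: "poly (isolate1 a) X1 = a"
proof -
  have "poly (isolate1 a) X1 = (\<Sum>m\<in>keys a. single m (lookup a m))"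
    by (simp add: isolate1_def lin_ext_def poly_sum poly_monom X1_power mult_single drop1_split)
  thus ?thesis by (simp add: sum_single)
qed

lemma coeff_isolate1: "pcoeff (isolate1 a) j =
   (\<Sum>m \<in> {m \<in> keys a. lookup m 1 = j}.
      single (drop1 m) (lookup a m))"
  by (simp add: isolate1_def lin_ext_def coeff_sum sum.inter_filter)

lemma vars_in_isolate1: "vars_in V a \<Longrightarrow> vars_in (V - {1}) (pcoeff (isolate1 a) j)"
  unfolding coeff_isolate1
  by (intro vars_in_sum vars_in_single) (auto simp: vars_in_def keys_drop1)

lemma isolate1_const: 
  assumes "vars_in V a" "1 \<notin> V"
  shows "isolate1 a = [:a:]"
proof -
  have "lookup m 1 = 0" "drop1 m = m" if "m \<in> keys a" for m
  proof -
    show *: "lookup m 1 = 0"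
      using that assms unfolding vars_in_def by (meson in_keys_iff subsetD)
    show "drop1 m = m" using drop1_split[of m] * by simp
  qed
  hence "isolate1 a = (\<Sum>m\<in>keys a. [:single m (lookup a m):])"
    by (simp add: isolate1_def lin_ext_def monom_0)
  also have "\<dots> = [:\<Sum>m\<in>keys a. single m (lookup a m):]"
    by (rule poly_eqI) (simp add: coeff_sum coeff_pCons split: nat.split)
  finally show ?thesis by (simp add: sum_single)
qed

lemma isolate1_X1: "isolate1 X1 = [:0, 1:]"
proof -
  have "drop1 (single 1 1) = 0"
    by (rule poly_mapping_eqI) (simp add: lookup_drop1 lookup_single)
  thus ?thesis
    by (simp add: isolate1_def X1_def lin_ext_single monom_altdef)
qed

lemma isolate1_poly:
  assumes "\<And>j. vars_in V (pcoeff P j)" "1 \<notin> V"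
  shows "isolate1 (poly P X1) = P"
proof -
  interpret rhom isolate1 by (rule rhom_isolate1)
  have *: "map_poly isolate1 P = map_poly (\<lambda>c. [:c:]) P"
    by (rule poly_eqI) (simp add: coeff_map_poly hom_zero isolate1_const[OF assms])
  have "poly (map_poly (\<lambda>c. [:c:]) P) [:0, 1:] = P"
    by (induction P) (auto simp: map_poly_pCons)
  thus ?thesis by (simp add: hom_poly isolate1_X1 *)
qed

text \<open>The sum of absolute values is submultiplicative, unlike the maximum.\<close>

definition norm1 :: "int mpoly \<Rightarrow> int" where
  "norm1 a = (\<Sum>m\<in>keys a. \<bar>lookup a m\<bar>)"

lemma norm1_superset: "finite K \<Longrightarrow> keys a \<subseteq> K \<Longrightarrow>
   norm1 a = (\<Sum>m\<in>K. \<bar>lookup a m\<bar>)"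
  unfolding norm1_def by (rule sum.mono_neutral_left) (auto simp: in_keys_iff)

lemma norm1_nonneg: "norm1 a \<ge> 0"
  by (simp add: norm1_def sum_nonneg)

lemma norm1_add: "norm1 (a + b) \<le> norm1 a + norm1 b"
proof -
  let ?K = "keys a \<union> keys b"
  have "norm1 (a + b) = (\<Sum>m\<in>?K. \<bar>lookup (a + b) m\<bar>)"
    by (rule norm1_superset) (use keys_add[of a b] in auto)
  also have "\<dots> \<le> (\<Sum>m\<in>?K. \<bar>lookup a m\<bar> + \<bar>lookup b m\<bar>)"
    by (rule sum_mono) (simp add: lookup_add)
  also have "\<dots> = norm1 a + norm1 b"
    by (simp add: sum.distrib norm1_superset[of ?K])
  finally show ?thesis .
qed

lemma norm1_zero [simp]: "norm1 0 = 0"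
  and norm1_one [simp]: "norm1 1 = 1"
  by (auto simp: norm1_def)

lemma norm1_sum: "norm1 (sum f I) \<le> (\<Sum>i\<in>I. norm1 (f i))"
  by (induction I rule: infinite_finite_induct) (auto intro: order_trans[OF norm1_add])

lemma norm1_single [simp]: "norm1 (single m c) = \<bar>c\<bar>"
  by (cases "c = 0") (auto simp: norm1_def)

lemma norm1_uminus [simp]: "norm1 (- a) = norm1 a"
  by (simp add: norm1_def)

lemma norm1_mult: "norm1 (a * b) \<le> norm1 a * norm1 b"
proof -
  have "norm1 (a * b) \<le> (\<Sum>m\<in>keys a. norm1 (\<Sum>m'\<in>keys b.
      single (m + m') (lookup a m * lookup b m')))"
    unfolding mult_eq_sum_single by (rule norm1_sum)
  also have "\<dots> \<le> (\<Sum>m\<in>keys a. \<Sum>m'\<in>keys b. norm1 (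
      single (m + m') (lookup a m * lookup b m')))"
    by (intro sum_mono norm1_sum)
  also have "\<dots> = norm1 a * norm1 b"
    by (simp add: abs_mult sum_product) (simp add: norm1_def sum_product)
  finally show ?thesis .
qed

lemma abs_lookup_le_norm1: "\<bar>lookup a m\<bar> \<le> norm1 a"
proof (cases "m \<in> keys a")
  case True
  thus ?thesis unfolding norm1_def by (intro member_le_sum) auto
qed (simp add: in_keys_iff norm1_nonneg)

definition deg_le :: "nat \<Rightarrow> int mpoly \<Rightarrow> bool" where
  "deg_le \<delta> a \<longleftrightarrow> (\<forall>m\<in>keys a. \<forall>k. lookup m k \<le> \<delta>)"

lemma deg_le_add: "deg_le \<delta> a \<Longrightarrow> deg_le \<delta> b \<Longrightarrow> deg_le \<delta> (a + b)"
  using keys_add[of a b] unfolding deg_le_def by blast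

lemma deg_le_mono: "deg_le \<delta> a \<Longrightarrow> \<delta> \<le> \<epsilon> \<Longrightarrow> deg_le \<epsilon> a"
  unfolding deg_le_def using order_trans by blast

lemma deg_le_zero [simp]: "deg_le \<delta> 0" and deg_le_one [simp]: "deg_le \<delta> 1"
  by (auto simp: deg_le_def)

lemma deg_le_sum: "(\<And>i. i \<in> I \<Longrightarrow> deg_le \<delta> (f i)) \<Longrightarrow> deg_le \<delta> (sum f I)"
  by (induction I rule: infinite_finite_induct) (auto intro: deg_le_add)

lemma deg_le_uminus: "deg_le \<delta> a \<Longrightarrow> deg_le \<delta> (- a)"
  by (simp add: deg_le_def)

lemma deg_le_mult: "deg_le \<delta> a \<Longrightarrow> deg_le \<epsilon> b \<Longrightarrow> deg_le (\<delta> + \<epsilon>) (a * b)"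
proof -
  assume a: "deg_le \<delta> a" "deg_le \<epsilon> b"
  have "\<forall>k. lookup (u + v) k \<le> \<delta> + \<epsilon>"
    if "u \<in> keys a" "v \<in> keys b" for u v
    using a that unfolding deg_le_def lookup_add by (auto intro!: add_mono)
  thus ?thesis using keys_mult[of a b] unfolding deg_le_def by blast
qed

definition size_le :: "nat set \<Rightarrow> nat \<Rightarrow> int \<Rightarrow> int mpoly \<Rightarrow> bool" where
  "size_le V \<delta> H a \<longleftrightarrow> vars_in V a \<and> deg_le \<delta> a \<and> norm1 a \<le> H"

lemma size_le_mono: "size_le V \<delta> H a \<Longrightarrow> \<delta> \<le> \<epsilon> \<Longrightarrow> H \<le> J \<Longrightarrow> size_le V \<epsilon> J a"
  unfolding size_le_def by (auto intro: deg_le_mono)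

lemma size_le_nonneg: "size_le V \<delta> H a \<Longrightarrow> 0 \<le> H"
  unfolding size_le_def using norm1_nonneg[of a] by linarith

lemma size_le_mult: "size_le V \<delta> H a \<Longrightarrow> size_le V \<epsilon> J b \<Longrightarrow> size_le V (\<delta> + \<epsilon>) (H * J) (a * b)"
  using norm1_mult[of a b] mult_mono[of "norm1 a" H "norm1 b" J] norm1_nonneg[of a] norm1_nonneg[of b]
  unfolding size_le_def by (auto intro: deg_le_mult vars_in_mult)

lemma size_le_minus: "size_le V \<delta> H a \<Longrightarrow> size_le V \<delta> J b \<Longrightarrow> size_le V \<delta> (H + J) (a - b)"
  using norm1_add[of a "- b"] deg_le_add[OF _ deg_le_uminus, of \<delta> a b]
  unfolding size_le_def by (auto intro: vars_in_minus)

lemma size_le_one: "1 \<le> H \<Longrightarrow> size_le V \<delta> H 1"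
  unfolding size_le_def by auto

section \<open>Fraction-free elimination\<close>

text \<open>
  A field \<open>L\<close> given as a record is replaced by the kernel of an evaluation map from
  \<^typ>\<open>int mpoly\<close> to \<open>L\<close>. Computations in \<open>L\<close> then become computations modulo a prime ideal of
  a type, where type classes apply.
\<close>

definition prime_ideal :: "'a::comm_ring_1 set \<Rightarrow> bool" where
  "prime_ideal Z \<longleftrightarrow> 0 \<in> Z \<and> (\<forall>a\<in>Z. \<forall>b\<in>Z. a + b \<in> Z) \<and> (\<forall>a\<in>Z. \<forall>r. r * a \<in> Z) \<and>
     (\<forall>a b. a * b \<in> Z \<longrightarrow> a \<in> Z \<or> b \<in> Z)"

context
  fixes Z :: "'a::comm_ring_1 set"
  assumes Z: "prime_ideal Z"
begin

lemma pi_zero: "0 \<in> Z"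
  using Z by (simp add: prime_ideal_def)

lemma pi_add: "a \<in> Z \<Longrightarrow> b \<in> Z \<Longrightarrow> a + b \<in> Z"
  using Z by (simp add: prime_ideal_def)

lemma pi_multl: "a \<in> Z \<Longrightarrow> r * a \<in> Z"
  using Z by (simp add: prime_ideal_def)

lemma pi_multr: "a \<in> Z \<Longrightarrow> a * r \<in> Z"
  using pi_multl[of a r] by (simp add: mult.commute)

lemma pi_prime: "a * b \<in> Z \<Longrightarrow> a \<in> Z \<or> b \<in> Z"
  using Z by (simp add: prime_ideal_def)

lemma pi_uminus: "a \<in> Z \<Longrightarrow> - a \<in> Z"
  using pi_multl[of a "-1"] by simp

lemma pi_minus: "a \<in> Z \<Longrightarrow> b \<in> Z \<Longrightarrow> a - b \<in> Z"
  using pi_add[of a "- b"] pi_uminus by simp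

lemma pi_sum: "(\<And>i. i \<in> I \<Longrightarrow> f i \<in> Z) \<Longrightarrow> sum f I \<in> Z"
  by (induction I rule: infinite_finite_induct) (auto intro: pi_zero pi_add)

end

text \<open>
  Clearing column \<open>c0\<close> with the pivot \<open>N r0 c0\<close> by cross-multiplication: on a vector, the reduced
  matrix computes a combination of the values of rows \<open>i\<close> and \<open>r0\<close>.
\<close>

lemma elimination_step:
  fixes N :: "'r \<Rightarrow> 'c \<Rightarrow> 'a::comm_ring_1" and r0 :: 'r
  assumes "finite C" "c0 \<in> C"
  defines "N' \<equiv> \<lambda>i j. N r0 c0 * N i j - N i c0 * N r0 j"
  shows "(\<Sum>j\<in>C - {c0}. N' i j * w j) =
     N r0 c0 * (\<Sum>j\<in>C. N i j * w j) - N i c0 * (\<Sum>j\<in>C. N r0 j * w j)"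
proof -
  have "(\<Sum>j\<in>C - {c0}. N' i j * w j) = 
      N r0 c0 * (\<Sum>j\<in>C - {c0}. N i j * w j) - N i c0 * (\<Sum>j\<in>C - {c0}. N r0 j * w j)"
    by (simp add: N'_def sum_distrib_left sum_subtractf algebra_simps)
  thus ?thesis
    using assms by (simp add: sum.remove[of C c0] algebra_simps)
qed

definition kernel_vector :: "nat set \<Rightarrow> 'c set \<Rightarrow> 'r set \<Rightarrow> ('r \<Rightarrow> 'c \<Rightarrow> int mpoly) \<Rightarrow> ('c \<Rightarrow> int mpoly) \<Rightarrow> bool" where
  "kernel_vector V C R N w \<longleftrightarrow> (\<forall>j. vars_in V (w j)) \<and> (\<exists>j\<in>C. w j \<noteq> 0) \<and>
     (\<forall>i\<in>R. (\<Sum>j\<in>C. N i j * w j) = 0)"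

text \<open>
  \<open>\<Delta>\<close> does the work of a nonzero maximal minor: wherever the specialised matrix acquires a nonzero
  kernel vector, \<open>\<Delta>\<close> vanishes.
\<close>

definition detects_kernel :: "'c set \<Rightarrow> 'r set \<Rightarrow> ('r \<Rightarrow> 'c \<Rightarrow> int mpoly) \<Rightarrow> int mpoly \<Rightarrow> bool" where
  "detects_kernel C R N \<Delta> \<longleftrightarrow> (\<forall>\<theta> (Z :: int mpoly set) w. rhom \<theta> \<longrightarrow> prime_ideal Z \<longrightarrow>
     (\<forall>i\<in>R. (\<Sum>j\<in>C. \<theta> (N i j) * w j) \<in> Z) \<longrightarrow> (\<exists>j\<in>C. w j \<notin> Z) \<longrightarrow> \<theta> \<Delta> \<in> Z)"

text \<open>
  Gaussian elimination without division. Each step clears one column and at worst doubles the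
  degree and squares the norm of the entries, up to a factor 2, so for a bounded number of columns
  the size of \<open>\<Delta>\<close>, the product of the pivots, is polynomial in the size of the entries. A column of
  zeros at any stage yields a kernel vector in the same variables, by back substitution. Otherwise a
  kernel vector of a specialisation restricts to the smaller matrix, and either the restriction is
  nonzero, or the pivot vanishes.
\<close>

lemma elimination:
  fixes V :: "nat set" and r :: nat
  shows "\<exists>(k::int) (e::nat). k \<ge> 1 \<and> (\<forall>(C::'c set) (R::'r set) N \<delta> H.
     finite C \<longrightarrow> card C \<le> r \<longrightarrow> 1 \<le> H \<longrightarrow> (\<forall>i\<in>R. \<forall>j\<in>C. size_le V \<delta> H (N i j)) \<longrightarrow>
       (\<exists>w. kernel_vector V C R N w) \<or>
       (\<exists>\<Delta>. \<Delta> \<noteq> 0 \<and> size_le V (e * \<delta>) (k * H ^ e) \<Delta> \<and> detects_kernel C R N \<Delta>))"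
proof (induction r)
  case 0
  have "detects_kernel C R N 1" if "finite C" "card C \<le> 0" for C :: "'c set" and R :: "'r set" and N
    using that by (simp add: detects_kernel_def)
  thus ?case
    by (intro exI[of _ 1] exI[of _ 0]) (auto intro!: exI[of _ 1] simp: size_le_one)
next
  case (Suc r)
  then obtain k :: int and e where k: "k \<ge> 1"
    and IH: "\<And>(C::'c set) (R::'r set) N \<delta> H. finite C \<Longrightarrow> card C \<le> r \<Longrightarrow> 1 \<le> H \<Longrightarrow>
       (\<forall>i\<in>R. \<forall>j\<in>C. size_le V \<delta> H (N i j)) \<Longrightarrow>
       (\<exists>w. kernel_vector V C R N w) \<or>
       (\<exists>\<Delta>. \<Delta> \<noteq> 0 \<and> size_le V (e * \<delta>) (k * H ^ e) \<Delta> \<and> detects_kernel C R N \<Delta>)"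
    by (elim exE conjE) (erule_tac x = k in meta_allE, erule_tac x = e in meta_allE, simp)
  let ?k = "k * 2 ^ e" and ?e = "1 + 2 * e"
  have "(\<exists>w. kernel_vector V C R N w) \<or>
       (\<exists>\<Delta>. \<Delta> \<noteq> 0 \<and> size_le V (?e * \<delta>) (?k * H ^ ?e) \<Delta> \<and> detects_kernel C R N \<Delta>)"
    (is "?A C R N \<or> ?B C R N \<delta> H")
    if H: "finite C" "card C \<le> Suc r" "1 \<le> H" "\<forall>i\<in>R. \<forall>j\<in>C. size_le V \<delta> H (N i j)"
    for C :: "'c set" and R :: "'r set" and N \<delta> H
  proof (cases "C = {}")
    case True
    have "1 \<le> k * 2 ^ e * H ^ ?e"
      using mult_mono[of 1 "k * 2 ^ e" 1 "H ^ ?e"] mult_mono[of 1 k 1 "2 ^ e"] k H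
      by simp
    hence "?B C R N \<delta> H"
      using True by (intro exI[of _ 1]) (simp add: size_le_one detects_kernel_def)
    thus ?thesis by blast
  next
    case False
    then obtain c0 where c0: "c0 \<in> C" by blast
    have fin: "finite C" and card: "card (C - {c0}) \<le> r" using H c0 by auto
    show ?thesis
    proof (cases "\<forall>i\<in>R. N i c0 = 0")
      case True
      have "(\<Sum>j\<in>C. N i j * (if j = c0 then 1 else 0)) = 0" if "i \<in> R" for i
        using True that by (intro sum.neutral) auto
      hence "?A C R N"
        using c0 by (intro exI[of _ "\<lambda>j. if j = c0 then 1 else 0"]) (auto simp: kernel_vector_def)
      thus ?thesis by blast
    next
      case False
      then obtain r0 where r0: "r0 \<in> R" "N r0 c0 \<noteq> 0" by blast
      define N' where "N' = (\<lambda>i j. N r0 c0 * N i j - N i c0 * N r0 j)"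
      have "size_le V (2 * \<delta>) (2 * H ^ 2) (N' i j)" if "i \<in> R" "j \<in> C" for i j
        using size_le_minus[OF size_le_mult[of V \<delta> H "N r0 c0" \<delta> H "N i j"]
              size_le_mult[of V \<delta> H "N i c0" \<delta> H "N r0 j"]]
          H r0 c0 that by (simp add: N'_def power2_eq_square flip: mult_2)
      moreover have "1 \<le> 2 * H ^ 2" using H one_le_power[of H 2] by linarith
      ultimately consider w where "kernel_vector V (C - {c0}) R N' w"
        | \<Delta> where "\<Delta> \<noteq> 0" "size_le V (e * (2 * \<delta>)) (k * (2 * H\<^sup>2) ^ e) \<Delta>" "detects_kernel (C - {c0}) R N' \<Delta>"
        using IH[of "C - {c0}" "2 * H\<^sup>2" R "2 * \<delta>" N'] fin card by auto
      thus ?thesis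
      proof cases
        case (1 w)
        hence w: "\<And>j. vars_in V (w j)" "\<exists>j\<in>C - {c0}. w j \<noteq> 0"
          "\<And>i. i \<in> R \<Longrightarrow> (\<Sum>j\<in>C - {c0}. N' i j * w j) = 0"
          unfolding kernel_vector_def by blast+
        \<comment> \<open>back substitution: the pivot row determines the missing coordinate\<close>
        let ?s = "\<lambda>i. \<Sum>j\<in>C - {c0}. N i j * w j"
        define v where "v = (\<lambda>j. if j = c0 then - (\<Sum>j\<in>C - {c0}. N r0 j * w j)
           else N r0 c0 * w j)"
        have v: "(\<Sum>j\<in>C. N i j * v j) = N r0 c0 * ?s i - N i c0 * ?s r0" for i
        proof -
          have "(\<Sum>j\<in>C. N i j * v j) = N i c0 * v c0 + (\<Sum>j\<in>C - {c0}. N i j * v j)"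
            by (rule sum.remove) (use fin c0 in auto)
          also have "(\<Sum>j\<in>C - {c0}. N i j * v j) = (\<Sum>j\<in>C - {c0}. N r0 c0 * (N i j * w j))"
            by (intro sum.cong) (auto simp: v_def)
          also have "v c0 = - ?s r0" by (simp add: v_def)
          finally show ?thesis by (simp add: sum_distrib_left)
        qed
        have "(\<Sum>j\<in>C. N i j * v j) = 0" if "i \<in> R" for i
          using w(3)[OF that] unfolding v
          by (simp add: N'_def sum_distrib_left sum_subtractf algebra_simps)
        moreover have "vars_in V (v j)" for j
          using H r0 c0 w(1)
          by (auto simp: v_def size_le_def intro!: vars_in_uminus vars_in_sum vars_in_mult)
        moreover have "\<exists>j\<in>C. v j \<noteq> 0" using w(2) r0 by (auto simp: v_def)
        ultimately have "kernel_vector V C R N v" unfolding kernel_vector_def by blast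
        thus ?thesis by blast
      next
        case D: (2 \<Delta>)
        have 1: "N r0 c0 * \<Delta> \<noteq> 0" using r0 D(1) by simp
        have 2: "size_le V (?e * \<delta>) (?k * H ^ ?e) (N r0 c0 * \<Delta>)"
        proof -
          have eq: "H * (k * (2 * H\<^sup>2) ^ e) = ?k * H ^ ?e"
            by (simp add: power_mult_distrib power_add flip: power_mult)
          have "size_le V (\<delta> + e * (2 * \<delta>)) (H * (k * (2 * H\<^sup>2) ^ e)) (N r0 c0 * \<Delta>)"
            by (rule size_le_mult[OF _ D(2)]) (use H r0 c0 in blast)
          thus ?thesis unfolding eq by (simp add: algebra_simps)
        qed
        have 3: "\<theta> (N r0 c0 * \<Delta>) \<in> Z"
          if \<theta>: "rhom \<theta>" and Z: "prime_ideal Z"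
            and w: "\<forall>i\<in>R. (\<Sum>j\<in>C. \<theta> (N i j) * w j) \<in> Z" "\<exists>j\<in>C. w j \<notin> Z" for \<theta> and Z :: "int mpoly set" and w
        proof -
          interpret rhom \<theta> by fact
          show ?thesis
          proof (cases "\<exists>j\<in>C - {c0}. w j \<notin> Z")
            case True
            have "(\<Sum>j\<in>C - {c0}. \<theta> (N' i j) * w j) \<in> Z" if "i \<in> R" for i
              using elimination_step[OF fin c0, of "\<lambda>i j. \<theta> (N i j)" r0 i w] w(1) that r0
              by (auto simp: N'_def hom_minus hom_mult intro!: pi_minus[OF Z] pi_multl[OF Z])
            with D(3) \<theta> Z True have "\<theta> \<Delta> \<in> Z" unfolding detects_kernel_def by blast
            thus ?thesis by (simp add: hom_mult pi_multl[OF Z])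
          next
            case False
            with w have c: "w c0 \<notin> Z" by blast
            have "\<theta> (N r0 c0) * w c0 = (\<Sum>j\<in>C. \<theta> (N r0 j) * w j) - (\<Sum>j\<in>C - {c0}. \<theta> (N r0 j) * w j)"
              using fin c0 by (simp add: sum.remove[of C c0])
            also have "\<dots> \<in> Z"
            proof (rule pi_minus[OF Z])
              show "(\<Sum>j\<in>C. \<theta> (N r0 j) * w j) \<in> Z" using w(1) r0 by blast
              show "(\<Sum>j\<in>C - {c0}. \<theta> (N r0 j) * w j) \<in> Z"
                using False by (intro pi_sum[OF Z] pi_multl[OF Z]) blast
            qed
            finally have "\<theta> (N r0 c0) \<in> Z" using pi_prime[OF Z] c by blast
            thus ?thesis by (simp add: hom_mult pi_multr[OF Z])
          qed
        qed
        have "detects_kernel C R N (N r0 c0 * \<Delta>)" using 3 unfolding detects_kernel_def by blast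
        with 1 2 show ?thesis by blast
      qed
    qed
  qed
  moreover have "?k \<ge> 1" using mult_mono[of 1 k 1 "2 ^ e"] k by simp
  ultimately show ?case by (intro exI[of _ ?k] exI[of _ ?e]) blast
qed

section \<open>Counting zeros\<close>

text \<open>
  With \<open>q = 0\<close> this counts integer zeros, with \<open>q\<close> prime it counts zeros modulo \<open>q\<close>; the usual
  argument by splitting off linear factors covers both.
\<close>

lemma card_roots_univariate:
  fixes p :: "int poly" and q :: int
  assumes q: "\<And>a b. q dvd a * b \<Longrightarrow> q dvd a \<or> q dvd b"
    and T: "finite T" "\<And>s t. s \<in> T \<Longrightarrow> t \<in> T \<Longrightarrow> q dvd s - t \<Longrightarrow> s = t"
    and p: "\<not> q dvd pcoeff p i" "pdeg p \<le> \<delta>"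
  shows "card {t \<in> T. q dvd poly p t} \<le> \<delta>"
  using p
proof (induction \<delta> arbitrary: p i)
  case 0
  then obtain c where c: "p = [:c:]" by (meson degree_0_id degree_eq_zeroE le_zero_eq)
  with 0 have "\<not> q dvd c" by (cases i) auto
  thus ?case by (simp add: c)
next
  case (Suc \<delta>)
  show ?case
  proof (cases "\<exists>a\<in>T. q dvd poly p a")
    case True
    then obtain a where a: "a \<in> T" "q dvd poly p a" by blast
    define s where "s = synthetic_div p a"
    have p: "p = [:-a, 1:] * s + [:poly p a:]" unfolding s_def by (rule synthetic_div_correct'[symmetric])
    have "\<exists>j. \<not> q dvd pcoeff s j"
    proof (rule ccontr)
      assume "\<not> ?thesis"
      hence "q dvd pcoeff ([:-a, 1:] * s + [:poly p a:]) i"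
        using a(2) by (auto simp: coeff_pCons split: nat.splits)
      with p Suc.prems show False by simp
    qed
    then obtain j where j: "\<not> q dvd pcoeff s j" by blast
    have "pdeg s \<le> \<delta>" using Suc.prems by (simp add: s_def degree_synthetic_div)
    from Suc.IH[OF j this] have IH: "card {t \<in> T. q dvd poly s t} \<le> \<delta>" .
    have "t = a \<or> q dvd poly s t" if t: "t \<in> T" "q dvd poly p t" for t
    proof -
      have "poly p t = (t - a) * poly s t + poly p a"
        using arg_cong[OF p, of "\<lambda>p. poly p t"] by (simp add: algebra_simps)
      hence "q dvd (t - a) * poly s t" using t a by (simp add: dvd_add_left_iff)
      thus ?thesis using q T t a by blast
    qed
    hence "{t \<in> T. q dvd poly p t} \<subseteq> insert a {t \<in> T. q dvd poly s t}" by blast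
    hence "card {t \<in> T. q dvd poly p t} \<le> card (insert a {t \<in> T. q dvd poly s t})"
      by (rule card_mono[rotated]) (use T in auto)
    also have "\<dots> \<le> Suc (card {t \<in> T. q dvd poly s t})" using T(1) by (simp add: card_insert_if)
    also have "\<dots> \<le> Suc \<delta>" using IH by simp
    finally show ?thesis .
  next
    case False
    hence "{t \<in> T. q dvd poly p t} = {}" by blast
    thus ?thesis by (simp only: card.empty)
  qed
qed

text \<open>
  The argument of Schwartz and Zippel. Among the coefficients with respect to the last variable
  \<open>v\<close>, fix one that is nonzero modulo \<open>q\<close>. It vanishes at few points by induction; at all other
  points, a nonzero polynomial in \<open>v\<close> of degree at most \<open>\<delta>\<close> remains.
\<close>

lemma card_zeros_multivariate:
  fixes q :: int and a :: "(nat \<Rightarrow>\<^sub>0 nat) \<Rightarrow> int"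
  assumes q: "\<And>a b. q dvd a * b \<Longrightarrow> q dvd a \<or> q dvd b"
    and T: "finite T" "\<And>s t. s \<in> T \<Longrightarrow> t \<in> T \<Longrightarrow> q dvd s - t \<Longrightarrow> s = t"
    and V: "finite V" and M: "finite M"
    and inj: "\<And>m m'. m \<in> M \<Longrightarrow> m' \<in> M \<Longrightarrow> (\<And>k. k \<in> V \<Longrightarrow> lookup m k = lookup m' k) \<Longrightarrow> m = m'"
    and deg: "\<And>m k. m \<in> M \<Longrightarrow> k \<in> V \<Longrightarrow> lookup m k \<le> \<delta>"
    and m0: "m0 \<in> M" "\<not> q dvd a m0"
  shows "card {x \<in> V \<rightarrow>\<^sub>E T. q dvd (\<Sum>m\<in>M. a m * (\<Prod>k\<in>V. x k ^ lookup m k))}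
     \<le> card V * \<delta> * card T ^ (card V - 1)"
  using V M inj deg m0
proof (induction V arbitrary: M m0 rule: finite_induct)
  case empty
  hence "M = {m0}" by blast
  thus ?case using empty by simp
next
  case (insert v V)
  define J where "J = lookup m0 v"
  define MJ where "MJ = {m\<in>M. lookup m v = J}"
  define f where "f = (\<lambda>m x. a m * (\<Prod>k\<in>V. x k ^ lookup m k))"
  define P where "P = (\<lambda>g. \<Sum>m\<in>M. Polynomial.monom (f m g) (lookup m v))"
  let ?bad = "{g \<in> V \<rightarrow>\<^sub>E T. q dvd (\<Sum>m\<in>MJ. f m g)}"
  let ?S = "{x \<in> insert v V \<rightarrow>\<^sub>E T. q dvd (\<Sum>m\<in>M. a m * (\<Prod>k\<in>insert v V. x k ^ lookup m k))}"
  have fin: "finite (V \<rightarrow>\<^sub>E T)" using insert T by (intro finite_PiE) auto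
  have bad: "card ?bad \<le> card V * \<delta> * card T ^ (card V - 1)"
    unfolding f_def
  proof (rule insert.IH)
    show "m = m'" if "m \<in> MJ" "m' \<in> MJ" "\<And>k. k \<in> V \<Longrightarrow> lookup m k = lookup m' k" for m m'
      by (rule insert.prems(2)) (use that in \<open>auto simp: MJ_def\<close>)
  qed (use insert in \<open>auto simp: MJ_def J_def\<close>)
  have poly: "poly (P g) y = (\<Sum>m\<in>M. a m * (\<Prod>k\<in>insert v V. (g(v := y)) k ^ lookup m k))" for g y
  proof -
    have "(\<Prod>k\<in>V. (g(v := y)) k ^ lookup m k) = (\<Prod>k\<in>V. g k ^ lookup m k)" for m
      using insert.hyps by (intro prod.cong) auto
    thus ?thesis
      using insert.hyps by (simp add: P_def poly_sum poly_monom f_def algebra_simps)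
  qed
  have roots: "card {y \<in> T. q dvd poly (P g) y} \<le> \<delta>" if "g \<in> (V \<rightarrow>\<^sub>E T) - ?bad" for g
  proof (rule card_roots_univariate[OF q T])
    have "pcoeff (P g) J = (\<Sum>m\<in>MJ. f m g)"
      using insert.prems(1) by (simp add: P_def coeff_sum MJ_def sum.inter_filter)
    thus "\<not> q dvd pcoeff (P g) J" using that by auto
    show "pdeg (P g) \<le> \<delta>"
      unfolding P_def by (intro degree_sum_le) (use insert.prems in \<open>auto intro!: order_trans[OF degree_monom_le]\<close>)
  qed
  let ?U = "(\<lambda>(y, g). g(v := y)) ` (T \<times> ?bad) \<union>
     (\<lambda>(g, y). g(v := y)) ` (SIGMA g:(V \<rightarrow>\<^sub>E T) - ?bad. {y \<in> T. q dvd poly (P g) y})"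
  have "?S \<subseteq> ?U"
  proof
    fix x assume x: "x \<in> ?S"
    define g where "g = restrict x V"
    have g: "g \<in> V \<rightarrow>\<^sub>E T" and y: "x v \<in> T" and xg: "x = g(v := x v)"
      using x insert.hyps by (auto simp: g_def PiE_def extensional_def fun_eq_iff)
    have "q dvd poly (P g) (x v)" using x poly[of g "x v"] xg by auto
    show "x \<in> ?U"
    proof (cases "g \<in> ?bad")
      case True
      thus ?thesis using y xg by (intro UnI1 image_eqI[of _ _ "(x v, g)"]) auto
    next
      case False
      thus ?thesis using y xg g \<open>q dvd poly (P g) (x v)\<close>
        by (intro UnI2 image_eqI[of _ _ "(g, x v)"]) auto
    qed
  qed
  moreover have "finite ?U" using fin T(1) by (intro finite_UnI finite_imageI) auto
  ultimately have "card ?S \<le> card ?U" by (rule card_mono[rotated])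
  also have "\<dots> \<le> card (T \<times> ?bad) + card (SIGMA g:(V \<rightarrow>\<^sub>E T) - ?bad. {y \<in> T. q dvd poly (P g) y})"
    by (intro order_trans[OF card_Un_le] add_mono card_image_le) (use fin T(1) in auto)
  also have "card (T \<times> ?bad) \<le> card V * \<delta> * card T ^ card V"
    using mult_le_mono2[OF bad, of "card T"] insert.hyps
    by (cases "card V") (auto simp: card_cartesian_product algebra_simps)
  also have "card (SIGMA g:(V \<rightarrow>\<^sub>E T) - ?bad. {y \<in> T. q dvd poly (P g) y}) \<le> (\<Sum>g\<in>(V \<rightarrow>\<^sub>E T) - ?bad. \<delta>)"
    using fin T(1) by (subst card_SigmaI) (auto simp del: sum_constant intro!: sum_mono roots)
  also have "\<dots> \<le> card (V \<rightarrow>\<^sub>E T) * \<delta>"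
    using fin by (simp add: card_mono)
  also have "card (V \<rightarrow>\<^sub>E T) = card T ^ card V"
    using insert.hyps by (simp add: card_PiE)
  finally show ?case using insert.hyps by (simp add: algebra_simps)
qed

lemma card_zeros_eval_at:
  fixes q :: int
  assumes q: "\<And>a b. q dvd a * b \<Longrightarrow> q dvd a \<or> q dvd b"
    and T: "finite T" "\<And>s t. s \<in> T \<Longrightarrow> t \<in> T \<Longrightarrow> q dvd s - t \<Longrightarrow> s = t"
    and V: "finite V" and \<Delta>: "vars_in V \<Delta>" "deg_le \<delta> \<Delta>" "\<not> q dvd lookup \<Delta> m0"
  shows "card {x \<in> V \<rightarrow>\<^sub>E T. q dvd eval_at x \<Delta>} \<le> card V * \<delta> * card T ^ (card V - 1)"
proof -
  have "eval_at x \<Delta> = (\<Sum>m\<in>keys \<Delta>. lookup \<Delta> m * (\<Prod>k\<in>V. x k ^ lookup m k))" for x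
    unfolding eval_at_def lin_ext_def
    by (intro sum.cong) (use \<Delta>(1) V in \<open>auto simp: vars_in_def monom_val_superset\<close>)
  moreover have "m = m'" if "m \<in> keys \<Delta>" "m' \<in> keys \<Delta>"
    "\<And>k. k \<in> V \<Longrightarrow> lookup m k = lookup m' k" for m m'
  proof (rule poly_mapping_eqI)
    fix k show "lookup m k = lookup m' k"
      using that(3) in_keys_iff[of k m] in_keys_iff[of k m'] that(1,2) \<Delta>(1) unfolding vars_in_def
      by (metis subsetD)
  qed
  moreover have "m0 \<in> keys \<Delta>" using \<Delta>(3) by (auto simp: in_keys_iff)
  ultimately show ?thesis
    using \<Delta>(2,3) by (simp only:) (rule card_zeros_multivariate[OF q T V, where ?m0.0 = m0], auto simp: deg_le_def)
qed

section \<open>The number of prime divisors\<close>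

text \<open>The \<open>i\<close>-th smallest element of a set of positive integers is at least \<open>i\<close>.\<close>

lemma fact_card_le_prod:
  fixes A :: "nat set"
  assumes "finite A" "0 \<notin> A"
  shows "fact (card A) \<le> \<Prod>A"
  using assms
proof (induction A rule: finite_linorder_max_induct)
  case (insert b A)
  have "card A \<le> card {1..<b}"
    by (rule card_mono) (use insert in \<open>auto simp: Suc_le_eq One_nat_def intro!: gr0I\<close>)
  hence "Suc (card A) \<le> b" using insert.prems by (cases b) auto
  moreover have "b \<notin> A" using insert by blast
  ultimately show ?case using insert mult_le_mono[of "Suc (card A)" b "fact (card A)" "\<Prod>A"] by auto
qed auto

lemma prod_primes_dvd:
  fixes m :: nat
  assumes "finite A" "\<And>p. p \<in> A \<Longrightarrow> prime p \<and> p dvd m"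
  shows "\<Prod>A dvd m"
  using assms
proof (induction A rule: finite_induct)
  case (insert p A)
  have "coprime p (\<Prod>A)"
    by (rule prod_coprime_right) (use insert in \<open>auto intro: primes_coprime\<close>)
  thus ?case using insert by (auto intro: divides_mult)
qed auto

lemma power_div_fact_le_exp:
  fixes x :: real
  assumes "x \<ge> 0"
  shows "x ^ j / fact j \<le> exp x"
proof -
  have s: "(\<lambda>i. x ^ i / fact i) sums exp x"
    using exp_converges[of x] by (simp add: scaleR_conv_of_real field_simps)
  have "(\<Sum>i\<in>{j}. x ^ i / fact i) \<le> suminf (\<lambda>i. x ^ i / fact i)"
    by (rule sum_le_suminf) (use s assms in \<open>auto simp: sums_iff\<close>)
  thus ?thesis using s by (simp add: sums_iff)
qed

lemma exp_1_less_3: "exp 1 < (3::real)"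
proof -
  \<comment> \<open>the bound \<open>1 + x + x\<^sup>2\<close> for \<open>exp x\<close> is too weak at \<open>x = 1\<close>, but sufficient at \<open>x = 1/4\<close>\<close>
  have e4: "exp (1/4) \<le> (21/16::real)"
    using exp_bound[of "1/4"] by (simp add: power2_eq_square)
  have "exp 1 = exp (1/4::real) ^ 4" by (simp flip: exp_of_nat_mult)
  also have "\<dots> \<le> (21/16) ^ 4" using e4 by (intro power_mono) auto
  also have "\<dots> < (3::real)" by (simp add: power4_eq_xxxx)
  finally show ?thesis .
qed

text \<open>
  Put \<open>l = ln N\<close>. If \<open>w \<le> 8 sqrt l\<close>, the claim follows from \<open>sqrt l \<le> 2 l / ln l\<close>. Otherwise
  \<open>ln w \<ge> ln l / 2\<close>, and the lower bound \<open>ln (w!) \<ge> w (ln w - 1) \<ge> w ln w / 2\<close> applies.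
\<close>

lemma fact_le_imp_le_log_ratio:
  fixes k N :: real
  assumes "fact w \<le> k * N ^ e" "k \<ge> 1" "N \<ge> 3"
  shows "real w \<le> (16 + 4 * (ln k + real e)) * (ln N / ln (ln N))"
proof -
  define l where "l = ln N"
  have e3: "exp 1 < (3::real)" by (rule exp_1_less_3)
  have "exp 2 = exp 1 * exp (1::real)" by (simp flip: exp_add)
  also have "\<dots> \<le> 3 * 3" using e3 by (intro mult_mono) auto
  finally have e9: "exp 2 \<le> (9::real)" by simp
  have l1: "l > 1" unfolding l_def using e3 assms(3) by (smt (verit) exp_less_cancel_iff exp_ln)
  hence ll: "ln l > 0" by simp
  have lnk: "ln k \<ge> 0" using assms by simp
  have ratio: "sqrt l \<le> 2 * (l / ln l)"
  proof -
    have "ln (sqrt l) \<le> sqrt l - 1" using l1 by (intro ln_le_minus_one) auto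
    hence 1: "ln l \<le> 2 * sqrt l" using l1 by (simp add: ln_sqrt)
    have "sqrt l * ln l \<le> sqrt l * (2 * sqrt l)"
      using 1 l1 by (intro mult_left_mono) auto
    also have "\<dots> = 2 * l" using l1 by simp
    finally show ?thesis using ll by (simp add: field_simps)
  qed
  show ?thesis
  proof (cases "real w \<le> 8 * sqrt l")
    case True
    also have "8 * sqrt l \<le> 16 * (l / ln l)" using ratio by simp
    also have "\<dots> \<le> (16 + 4 * (ln k + real e)) * (l / ln l)"
      using lnk l1 ll by (intro mult_right_mono) auto
    finally show ?thesis by (simp add: l_def)
  next
    case False
    have s1: "sqrt l > 1" using l1 by simp
    with False have "w \<ge> 9" by linarith
    hence w9: "real w \<ge> 9" by simp
    have "ln w \<ge> ln (exp 2)" using w9 e9 by (subst ln_le_cancel_iff) auto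
    hence w2: "ln w \<ge> 2" by simp
    have "ln w \<ge> ln (sqrt l)" using False s1 w9 by (subst ln_le_cancel_iff) auto
    hence wl: "ln w \<ge> ln l / 2" using l1 by (simp add: ln_sqrt)
    have "w * (ln l / 4) \<le> w * (ln w - 1)" using w2 wl by (intro mult_left_mono) auto
    also have "\<dots> = ln (real w ^ w) - w" using w9 by (simp add: ln_realpow algebra_simps)
    also have "\<dots> \<le> ln (fact w)"
    proof -
      have "real w ^ w / fact w \<le> exp (real w)" by (rule power_div_fact_le_exp) simp
      hence "real w ^ w \<le> exp (real w) * fact w" by (simp add: field_simps)
      hence "ln (real w ^ w) \<le> ln (exp (real w) * fact w)"
        using w9 by (subst ln_le_cancel_iff) auto
      thus ?thesis by (simp add: ln_mult)
    qed
    also have "\<dots> \<le> ln (k * N ^ e)"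
      using assms by (subst ln_le_cancel_iff) auto
    also have "\<dots> = ln k + e * l"
      using assms by (simp add: ln_mult ln_realpow l_def)
    also have "\<dots> \<le> (ln k + e) * l"
      using lnk l1 mult_left_mono[of 1 l "ln k"] by (simp add: algebra_simps)
    finally have "w * ln l \<le> 4 * ((ln k + e) * l)" by simp
    hence "w \<le> 4 * ((ln k + e) * l) / ln l" using ll by (simp add: field_simps)
    also have "\<dots> = 4 * (ln k + e) * (l / ln l)" by simp
    also have "\<dots> \<le> (16 + 4 * (ln k + e)) * (l / ln l)"
      using l1 ll by (intro mult_right_mono) auto
    finally show ?thesis by (simp add: l_def)
  qed
qed

section \<open>Closed forms as a linear system\<close>

text \<open>
  In \<open>A[X][Y]\<close>, represented by polynomials over polynomials, the derivative with respect to the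
  outer variable \<open>Y\<close> is \<^const>\<open>pderiv\<close>.
\<close>

definition dX :: "'a::idom poly poly \<Rightarrow> 'a poly poly" where
  "dX p = map_poly pderiv p"

lemma coeff_dX: "pcoeff (dX p) i = pderiv (pcoeff p i)"
  by (simp add: dX_def coeff_map_poly)

lemma dX_add: "dX (p + q) = dX p + dX q"
  by (rule poly_eqI) (simp add: coeff_dX pderiv_add)

lemma dX_diff: "dX (p - q) = dX p - dX q"
  by (rule poly_eqI) (simp add: coeff_dX pderiv_diff)

lemma pderiv_sum: "pderiv (sum f I) = (\<Sum>i\<in>I. pderiv (f i))"
  by (induction I rule: infinite_finite_induct) (auto simp: pderiv_add)

lemma dX_mult: "dX (p * q) = p * dX q + dX p * q"
  by (rule poly_eqI)
    (simp add: coeff_dX coeff_mult pderiv_sum pderiv_mult sum.distrib, simp add: mult.commute)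

lemma dX_pderiv: "dX (pderiv p) = pderiv (dX p)"
  by (rule poly_eqI) (simp add: coeff_dX coeff_pderiv pderiv_mult pderiv_add pderiv_of_nat)

text \<open>
  The unknown polynomials \<open>g, h, s, t\<close> occupy the slots 0, 1, 2, 3. Since
  \<open>F\<^sup>2 (\<partial>\<^sub>X (g/F) - \<partial>\<^sub>Y (h/F)) = F \<partial>\<^sub>X g - g \<partial>\<^sub>X F + h \<partial>\<^sub>Y F - F \<partial>\<^sub>Y h\<close>, the contributions of the
  first two slots to the equation \<open>False\<close> add up to zero iff the form \<open>(g dY + h dX)/F\<close> is closed.
  The equation \<open>True\<close> is \<open>s F = t \<partial>\<^sub>Y F\<close>.
\<close>

fun contrib :: "'a::idom poly poly \<Rightarrow> bool \<Rightarrow> nat \<Rightarrow> 'a poly poly \<Rightarrow> 'a poly poly" where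
  "contrib F False 0 p = F * dX p - p * dX F"
| "contrib F False (Suc 0) p = p * pderiv F - F * pderiv p"
| "contrib F True (Suc (Suc 0)) p = p * F"
| "contrib F True (Suc (Suc (Suc 0))) p = - p * pderiv F"
| "contrib F _ _ p = 0"

lemma slot_cases: 
  assumes "\<kappa> < (4::nat)"
  obtains "\<kappa> = 0" | "\<kappa> = Suc 0" | "\<kappa> = Suc (Suc 0)" | "\<kappa> = Suc (Suc (Suc 0))"
  using assms by (auto simp: less_Suc_eq numeral_eq_Suc)

lemma sum_slots: "(\<Sum>\<kappa><4. f \<kappa>) = f 0 + f (Suc 0) + f (Suc (Suc 0)) + f (Suc (Suc (Suc 0)))"
  by (simp add: numeral_eq_Suc)

lemma contrib_add: "\<kappa> < 4 \<Longrightarrow> contrib F k \<kappa> (p + q) = contrib F k \<kappa> p + contrib F k \<kappa> q"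
  by (cases k; elim slot_cases) (simp_all add: dX_add pderiv_add algebra_simps)

lemma contrib_zero: "\<kappa> < 4 \<Longrightarrow> contrib F k \<kappa> 0 = 0"
  using contrib_add[of \<kappa> F k 0 0] by (metis add.right_neutral add_left_cancel)

lemma contrib_sum: "\<kappa> < 4 \<Longrightarrow> contrib F k \<kappa> (sum f I) = (\<Sum>i\<in>I. contrib F k \<kappa> (f i))"
  by (induction I rule: infinite_finite_induct) (auto simp: contrib_zero contrib_add)

lemma contrib_diff_left: "\<kappa> < 4 \<Longrightarrow> contrib (F - G) k \<kappa> p = contrib F k \<kappa> p - contrib G k \<kappa> p"
  by (cases k; elim slot_cases) (simp_all add: dX_diff pderiv_diff algebra_simps)

lemma contrib_smult:
  assumes "\<kappa> < 4"
  shows "contrib F k \<kappa> (Polynomial.smult [:c:] p) = Polynomial.smult [:c:] (contrib F k \<kappa> p)"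
proof -
  have "dX (Polynomial.smult [:c:] p) = Polynomial.smult [:c:] (dX p)"
    by (rule poly_eqI) (simp add: coeff_dX pderiv_smult)
  thus ?thesis using assms
    by (cases k; elim slot_cases) (simp_all add: pderiv_smult smult_diff_right)
qed

text \<open>
  Row \<open>(k, u, v)\<close> compares coefficients at \<open>Y^u X^v\<close> in equation \<open>k\<close>; column \<open>(\<kappa>, a, b)\<close> belongs to
  the coefficient of the unknown polynomial in slot \<open>\<kappa>\<close> at \<open>Y^a X^b\<close>.
\<close>

definition entry :: "'a::idom poly poly \<Rightarrow> bool \<times> nat \<times> nat \<Rightarrow> nat \<times> nat \<times> nat \<Rightarrow> 'a" where
  "entry F = (\<lambda>(k, u, v) (\<kappa>, a, b). pcoeff (pcoeff
      (contrib F k \<kappa> (Polynomial.monom (Polynomial.monom 1 b) a)) u) v)"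

text \<open>
  The stricter bound on \<open>g\<close> excludes the trivial closed form \<open>dF/F\<close>, where \<open>g = \<partial>\<^sub>Y F\<close>; the one on
  \<open>s\<close> follows from \<open>s F = t \<partial>\<^sub>Y F\<close> and the bound on \<open>t\<close>.
\<close>

definition slot_deg :: "nat \<Rightarrow> nat \<Rightarrow> nat" where
  "slot_deg d \<kappa> = (if even \<kappa> then d - 1 else d)"

definition unknowns :: "nat \<Rightarrow> nat \<Rightarrow> (nat \<times> nat \<times> nat) set" where
  "unknowns d D = (SIGMA \<kappa>:{..<4}. {..<slot_deg d \<kappa>} \<times> {..D})"

definition slot_poly :: "nat \<Rightarrow> nat \<Rightarrow> (nat \<times> nat \<times> nat \<Rightarrow> 'a::idom) \<Rightarrow> nat \<Rightarrow> 'a poly poly" where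
  "slot_poly d D w \<kappa> = (\<Sum>a<slot_deg d \<kappa>. \<Sum>b\<le>D.
      Polynomial.smult [:w (\<kappa>, a, b):] (Polynomial.monom (Polynomial.monom 1 b) a))"

lemma finite_unknowns: "finite (unknowns d D)"
  by (simp add: unknowns_def)

lemma card_unknowns: "d \<le> D \<Longrightarrow> card (unknowns d D) \<le> 4 * (D * (D + 1))"
proof -
  assume "d \<le> D"
  hence "unknowns d D \<subseteq> {..<4} \<times> ({..<D} \<times> {..D})"
    by (auto simp: unknowns_def slot_deg_def split: if_splits)
  hence "card (unknowns d D) \<le> card ({..<4::nat} \<times> ({..<D} \<times> {..D}))"
    by (rule card_mono[rotated]) auto
  thus ?thesis by (simp add: card_cartesian_product algebra_simps)
qed

lemma coeff_slot_poly:
  "coeff2 (slot_poly d D w \<kappa>) a b =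
     (if a < slot_deg d \<kappa> \<and> b \<le> D then w (\<kappa>, a, b) else 0)"
proof -
  have "coeff2 (slot_poly d D w \<kappa>) a b =
     (\<Sum>a'<slot_deg d \<kappa>. \<Sum>b'\<le>D. if a' = a then if b' = b then w (\<kappa>, a', b') else 0 else 0)"
    unfolding slot_poly_def coeff_sum
    by (intro sum.cong refl) (auto simp: coeff_sum)
  also have "\<dots> = (\<Sum>a'<slot_deg d \<kappa>. if a' = a then (\<Sum>b'\<le>D. if b' = b then w (\<kappa>, a, b') else 0) else 0)"
    by (intro sum.cong) auto
  finally show ?thesis by simp
qed

lemma system_eq:
  "(\<Sum>c\<in>unknowns d D. entry F (k, u, v) c * w c) =
     coeff2 (\<Sum>\<kappa><4. contrib F k \<kappa> (slot_poly d D w \<kappa>)) u v"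
proof -
  have "coeff2 (\<Sum>\<kappa><4. contrib F k \<kappa> (slot_poly d D w \<kappa>)) u v =
     (\<Sum>\<kappa><4. \<Sum>a<slot_deg d \<kappa>. \<Sum>b\<le>D. entry F (k, u, v) (\<kappa>, a, b) * w (\<kappa>, a, b))"
    unfolding coeff_sum
  proof (intro sum.cong refl)
    fix \<kappa> :: nat assume "\<kappa> \<in> {..<4}"
    hence "\<kappa> < 4" by simp
    thus "coeff2 (contrib F k \<kappa> (slot_poly d D w \<kappa>)) u v =
      (\<Sum>a<slot_deg d \<kappa>. \<Sum>b\<le>D. entry F (k, u, v) (\<kappa>, a, b) * w (\<kappa>, a, b))"
      unfolding slot_poly_def
      by (simp add: contrib_sum contrib_smult coeff_sum entry_def mult.commute)
  qed
  also have "\<dots> = (\<Sum>c\<in>unknowns d D. entry F (k, u, v) c * w c)"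
    by (simp add: unknowns_def sum.cartesian_product sum.Sigma split_def)
  finally show ?thesis by simp
qed

lemma slot_poly_coeffs:
  assumes "\<And>a. a \<ge> slot_deg d \<kappa> \<Longrightarrow> pcoeff (P \<kappa>) a = 0"
    and "\<And>a. pdeg (pcoeff (P \<kappa>) a) \<le> D"
  shows "slot_poly d D (\<lambda>(\<kappa>, a, b). coeff2 (P \<kappa>) a b) \<kappa> = P \<kappa>"
proof (intro poly_eqI)
  fix a b
  have "coeff2 (P \<kappa>) a b = 0" if "\<not> b \<le> D"
    using assms(2)[of a] that by (intro coeff_eq_0) auto
  thus "coeff2 (slot_poly d D (\<lambda>(\<kappa>, a, b). pcoeff (pcoeff (P \<kappa>) a) b) \<kappa>) a b
      = coeff2 (P \<kappa>) a b"
    using assms(1)[of a] unfolding coeff_slot_poly by (cases "a < slot_deg d \<kappa>") auto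
qed

lemma hom_contrib:
  fixes h :: "'a::idom \<Rightarrow> 'b::idom"
  assumes "rhom h" "\<kappa> < 4"
  shows "map_poly (map_poly h) (contrib F k \<kappa> p) =
     contrib (map_poly (map_poly h) F) k \<kappa> (map_poly (map_poly h) p)"
proof -
  interpret h: rhom h by fact
  interpret h1: rhom "map_poly h" by (rule h.hom_map_poly)
  interpret h2: rhom "map_poly (map_poly h)" by (rule h1.hom_map_poly)
  have "map_poly (map_poly h) (dX q) = dX (map_poly (map_poly h) q)" for q
    by (rule poly_eqI) (simp add: coeff_dX h1.coeff_map map_poly_pderiv[OF \<open>rhom h\<close>])
  thus ?thesis using assms(2)
    by (cases k; elim slot_cases)
      (simp_all add: h2.hom_minus h2.hom_mult h2.hom_zero h2.hom_uminus map_poly_pderiv[OF h1.rhom_axioms])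
qed

lemma hom_entry:
  fixes h :: "'a::idom \<Rightarrow> 'b::idom"
  assumes "rhom h" "c \<in> unknowns d D"
  shows "h (entry F r c) = entry (map_poly (map_poly h) F) r c"
proof -
  interpret h: rhom h by fact
  interpret h1: rhom "map_poly h" by (rule h.hom_map_poly)
  obtain k u v \<kappa> a b where [simp]: "r = (k, u, v)" "c = (\<kappa>, a, b)" by (cases r; cases c)
  have "\<kappa> < 4" using assms(2) by (simp add: unknowns_def)
  moreover have "map_poly (map_poly h) (Polynomial.monom (Polynomial.monom 1 b) a) = Polynomial.monom (Polynomial.monom 1 b) a"
    by (simp add: map_poly_monom h.hom_zero h1.hom_zero h.hom_one)
  ultimately have "contrib (map_poly (map_poly h) F) k \<kappa> (Polynomial.monom (Polynomial.monom 1 b) a) =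
      map_poly (map_poly h) (contrib F k \<kappa> (Polynomial.monom (Polynomial.monom 1 b) a))"
    using hom_contrib[OF assms(1)] by metis
  thus ?thesis
    by (simp add: entry_def h.coeff_map h1.coeff_map)
qed

text \<open>The entries are integral combinations of coefficients of \<open>F\<close>, with multipliers at most \<open>D\<close>.\<close>

definition coeffs_size_le :: "nat set \<Rightarrow> nat \<Rightarrow> int \<Rightarrow> int mpoly poly poly \<Rightarrow> bool" where
  "coeffs_size_le V \<delta> H P \<longleftrightarrow> (\<forall>i j. size_le V \<delta> H (coeff2 P i j))"

lemma size_le_of_nat_mult: "size_le V \<delta> H a \<Longrightarrow> i \<le> D \<Longrightarrow> size_le V \<delta> (int D * H) (of_nat i * a)"
proof -
  assume a: "size_le V \<delta> H a" and i: "i \<le> D"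
  have "norm1 (of_nat i :: int mpoly) \<le> int i" "deg_le 0 (of_nat i)"
    by (induction i) (auto intro: order_trans[OF norm1_add] deg_le_add)
  hence "size_le V 0 (int D) (of_nat i)"
    using i by (auto simp: size_le_def vars_in_of_nat)
  from size_le_mult[OF this a] show ?thesis by simp
qed

lemma size_le_zero: "0 \<le> H \<Longrightarrow> size_le V \<delta> H 0"
  by (simp add: size_le_def)

lemma coeffs_size_le_pderiv:
  assumes "coeffs_size_le V \<delta> H P" "pdeg P \<le> D"
  shows "coeffs_size_le V \<delta> (int D * H) (pderiv P)"
  unfolding coeffs_size_le_def
proof (intro allI)
  fix i j
  have H: "0 \<le> H" using assms(1) size_le_nonneg unfolding coeffs_size_le_def by blast
  have "coeff2 (pderiv P) i j = of_nat (Suc i) * coeff2 P (Suc i) j"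
    by (simp add: coeff_pderiv of_nat_poly del: of_nat_Suc)
  moreover have "pcoeff P (Suc i) = 0" if "\<not> Suc i \<le> D"
    using assms(2) that by (intro coeff_eq_0) auto
  ultimately show "size_le V \<delta> (int D * H) (coeff2 (pderiv P) i j)"
    using assms(1) H by (cases "Suc i \<le> D")
      (auto simp: coeffs_size_le_def size_le_zero simp del: of_nat_Suc intro!: size_le_of_nat_mult)
qed

lemma coeffs_size_le_dX:
  assumes "coeffs_size_le V \<delta> H P" "\<And>i. pdeg (pcoeff P i) \<le> D"
  shows "coeffs_size_le V \<delta> (int D * H) (dX P)"
  unfolding coeffs_size_le_def
proof (intro allI)
  fix i j
  have H: "0 \<le> H" using assms(1) size_le_nonneg unfolding coeffs_size_le_def by blast
  have "coeff2 (dX P) i j = of_nat (Suc j) * coeff2 P i (Suc j)"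
    by (simp add: coeff_pderiv coeff_dX del: of_nat_Suc)
  moreover have "coeff2 P i (Suc j) = 0" if "\<not> Suc j \<le> D"
    using assms(2)[of i] that by (intro coeff_eq_0) auto
  ultimately show "size_le V \<delta> (int D * H) (coeff2 (dX P) i j)"
    using assms(1) H by (cases "Suc j \<le> D")
      (auto simp: coeffs_size_le_def size_le_zero simp del: of_nat_Suc intro!: size_le_of_nat_mult)
qed

lemma coeffs_size_le_monom_mult:
  assumes "coeffs_size_le V \<delta> H P" "k \<le> D"
  shows "coeffs_size_le V \<delta> (int D * H) (Polynomial.monom (Polynomial.monom (of_nat k) b) a * P)"
proof -
  have "0 \<le> H" using assms(1) size_le_nonneg unfolding coeffs_size_le_def by blast
  thus ?thesis using assms
    by (auto simp: coeffs_size_le_def coeff_monom_mult size_le_zero intro: size_le_of_nat_mult)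
qed

lemma coeffs_size_le_minus:
  "coeffs_size_le V \<delta> H P \<Longrightarrow> coeffs_size_le V \<delta> J Q \<Longrightarrow> coeffs_size_le V \<delta> (H + J) (P - Q)"
  by (simp add: coeffs_size_le_def size_le_minus)

lemma coeffs_size_le_mono:
  "coeffs_size_le V \<delta> H P \<Longrightarrow> H \<le> J \<Longrightarrow> coeffs_size_le V \<delta> J P"
  unfolding coeffs_size_le_def using size_le_mono by blast

lemma size_entry:
  assumes P: "coeffs_size_le V \<delta> H P" "pdeg P \<le> D" "\<And>i. pdeg (pcoeff P i) \<le> D"
    and c: "c \<in> unknowns d D" and d: "1 \<le> D" "d \<le> D"
  shows "size_le V \<delta> (2 * int D ^ 2 * H) (entry P r c)"
proof -
  obtain k u v \<kappa> a b where [simp]: "r = (k, u, v)" "c = (\<kappa>, a, b)" by (cases r; cases c)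
  have k: "\<kappa> < 4" and ab: "a \<le> D" "b \<le> D"
    using c d by (auto simp: unknowns_def slot_deg_def split: if_splits)
  have H: "0 \<le> H" using P(1) size_le_nonneg unfolding coeffs_size_le_def by blast
  let ?m = "Polynomial.monom (Polynomial.monom 1 b) a :: int mpoly poly poly"
  have dXm: "dX ?m = Polynomial.monom (Polynomial.monom (of_nat b) (b - 1)) a"
    by (rule poly_eqI) (simp add: coeff_dX pderiv_monom)
  have dYm: "pderiv ?m = Polynomial.monom (Polynomial.monom (of_nat a) b) (a - 1)"
    by (simp add: pderiv_monom of_nat_poly smult_monom)
  have 1: "coeffs_size_le V \<delta> (int D * H) (P * dX ?m)" 
    using coeffs_size_le_monom_mult[OF P(1) ab(2)] unfolding dXm by (simp add: mult.commute)
  have 2: "coeffs_size_le V \<delta> (int D * H) (P * pderiv ?m)" 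
    using coeffs_size_le_monom_mult[OF P(1) ab(1)] unfolding dYm by (simp add: mult.commute)
  have one: "coeffs_size_le V \<delta> (int D * J) (?m * Q)" if "coeffs_size_le V \<delta> J Q" for J Q
    using coeffs_size_le_monom_mult[OF that d(1), of b a] by simp
  note 3 = one[OF coeffs_size_le_pderiv[OF P(1,2)]]
  note 4 = one[OF coeffs_size_le_dX[OF P(1,3)]]
  note 5 = one[OF P(1)]
  have 0: "coeffs_size_le V \<delta> 0 0" by (simp add: coeffs_size_le_def size_le_zero)
  have D1: "int D * H \<le> int D ^ 2 * H"
    using d(1) H by (intro mult_right_mono) (auto simp: power2_eq_square)
  have D0: "0 \<le> int D ^ 2 * H" using H by simp
  have "coeffs_size_le V \<delta> (2 * int D ^ 2 * H) (contrib P k \<kappa> ?m)"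
    using k
  proof (cases k; elim slot_cases; simp only: contrib.simps)
    show "coeffs_size_le V \<delta> (2 * int D ^ 2 * H) (?m * P)"
      by (rule coeffs_size_le_mono[OF 5]) (use D1 D0 in simp)
    show "coeffs_size_le V \<delta> (2 * int D ^ 2 * H) (- ?m * pderiv P)"
      using coeffs_size_le_mono[OF coeffs_size_le_minus[OF 0 3], of "2 * int D ^ 2 * H"] D0
      by (simp add: power2_eq_square algebra_simps)
    show "coeffs_size_le V \<delta> (2 * int D ^ 2 * H) (P * dX ?m - ?m * dX P)"
      by (rule coeffs_size_le_mono[OF coeffs_size_le_minus[OF 1 4]])
        (use D1 in \<open>simp add: power2_eq_square algebra_simps\<close>)
    show "coeffs_size_le V \<delta> (2 * int D ^ 2 * H) (?m * pderiv P - P * pderiv ?m)"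
      by (rule coeffs_size_le_mono[OF coeffs_size_le_minus[OF 3 2]])
        (use D1 in \<open>simp add: power2_eq_square algebra_simps\<close>)
  qed (rule coeffs_size_le_mono[OF 0], use D0 in linarith)+
  thus ?thesis by (simp add: entry_def coeffs_size_le_def)
qed

section \<open>A factorisation produces a closed form\<close>

lemma dX_of_nat_eq_0: "dX (of_nat k) = 0"
  by (rule poly_eqI) (simp add: coeff_dX of_nat_poly coeff_pCons split: nat.split)

text \<open>
  A strict degree bound under which the zero polynomial needs no special treatment.
\<close>

definition below :: "nat \<Rightarrow> 'a::zero poly \<Rightarrow> bool" where
  "below m p \<longleftrightarrow> (\<forall>a\<ge>m. pcoeff p a = 0)"

lemma below_mult:
  assumes "below m p" "pdeg q \<le> j"
  shows "below (m + j) (p * q)"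
  unfolding below_def coeff_mult
proof (intro allI impI sum.neutral ballI)
  fix a i assume a: "m + j \<le> a" and i: "i \<in> {..a}"
  show "pcoeff p i * pcoeff q (a - i) = 0"
  proof (cases "m \<le> i")
    case True
    thus ?thesis using assms(1) by (simp add: below_def)
  next
    case False
    hence "pdeg q < a - i" using a assms(2) i by simp
    thus ?thesis by (simp add: coeff_eq_0)
  qed
qed

lemma below_diff: "below m p \<Longrightarrow> below m q \<Longrightarrow> below m (p - q)"
  for p :: "'a::ab_group_add poly"
  by (simp add: below_def)

lemma below_of_nat: "below m p \<Longrightarrow> below m (of_nat k * p)"
  for p :: "'a::comm_ring_1 poly"
  by (simp add: below_def of_nat_poly)

lemma below_pderiv: "pdeg p \<le> m \<Longrightarrow> below m (pderiv p)"
  by (auto simp: below_def coeff_pderiv coeff_eq_0)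

definition in_coeffs :: "'a::comm_ring_1 set \<Rightarrow> 'a poly poly \<Rightarrow> bool" where
  "in_coeffs Z p \<longleftrightarrow> (\<forall>i j. coeff2 p i j \<in> Z)"

context
  fixes Z :: "'a::idom set"
  assumes Z: "prime_ideal Z"
begin

lemma in_coeffs_mult: "in_coeffs Z p \<Longrightarrow> in_coeffs Z (p * q)"
  unfolding in_coeffs_def coeff_mult coeff_sum
  by (auto intro!: pi_sum[OF Z] pi_multr[OF Z])

lemma in_coeffs_diff: "in_coeffs Z p \<Longrightarrow> in_coeffs Z q \<Longrightarrow> in_coeffs Z (p - q)"
  by (auto simp: in_coeffs_def intro!: pi_minus[OF Z])

lemma in_coeffs_uminus: "in_coeffs Z p \<Longrightarrow> in_coeffs Z (- p)"
  by (auto simp: in_coeffs_def intro!: pi_uminus[OF Z])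

lemma in_coeffs_zero: "in_coeffs Z 0"
  by (simp add: in_coeffs_def pi_zero[OF Z])

lemma in_coeffs_sum: "(\<And>i. i \<in> I \<Longrightarrow> in_coeffs Z (f i)) \<Longrightarrow> in_coeffs Z (sum f I)"
  by (auto simp: in_coeffs_def coeff_sum intro!: pi_sum[OF Z])

lemma in_coeffs_pderiv: "in_coeffs Z p \<Longrightarrow> in_coeffs Z (pderiv p)"
  unfolding in_coeffs_def coeff_pderiv
  by (auto simp: of_nat_poly simp del: of_nat_Suc intro!: pi_multl[OF Z])

lemma in_coeffs_dX: "in_coeffs Z p \<Longrightarrow> in_coeffs Z (dX p)"
  unfolding in_coeffs_def coeff_dX coeff_pderiv
  by (auto simp del: of_nat_Suc intro!: pi_multl[OF Z])

lemma in_coeffs_contrib: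
  assumes "in_coeffs Z F" "\<kappa> < 4"
  shows "in_coeffs Z (contrib F k \<kappa> p)"
proof -
  have 1: "in_coeffs Z (p * F')" if "in_coeffs Z F'" for p F'
    using in_coeffs_mult[OF that, of p] by (simp add: mult.commute)
  note rules = 1[OF assms(1)] 1[OF in_coeffs_dX[OF assms(1)]] 1[OF in_coeffs_pderiv[OF assms(1)]]
    in_coeffs_mult[OF assms(1)] in_coeffs_diff in_coeffs_zero
  show ?thesis using assms(2)
    by (cases k; elim slot_cases) (auto simp only: contrib.simps intro!: rules)
qed

end

text \<open>
  For \<open>G\<close> congruent to \<open>\<phi> \<psi>\<close>, with degrees \<open>m\<close> and \<open>n\<close>, the closed form
  \<open>n d\<phi>/\<phi> - m d\<psi>/\<psi>\<close> is the solution sought, unless its numerators are congruent to zero. In that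
  case \<open>n \<partial>\<^sub>Y \<phi> \<psi> \<equiv> m \<phi> \<partial>\<^sub>Y \<psi>\<close> turns into \<open>s G \<equiv> t \<partial>\<^sub>Y G\<close> with \<open>s = d \<partial>\<^sub>Y \<psi>\<close> and \<open>t = n \<psi>\<close>, and \<open>t\<close>
  is not congruent to zero.
\<close>

lemma factorisation_gives_kernel_vector:
  fixes Z :: "int mpoly set" and G \<phi> \<psi> :: "int mpoly poly poly"
  assumes Z: "prime_ideal Z" and cong: "in_coeffs Z (G - \<phi> * \<psi>)"
    and lc: "lead_coeff \<phi> = [:u:]" "lead_coeff \<psi> = [:v:]" "v \<notin> Z"
    and d1: "pdeg \<phi> \<ge> 1" and d2: "pdeg \<psi> \<ge> 1" "of_nat (pdeg \<psi>) \<notin> Z"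
    and X: "\<And>i. pdeg (pcoeff \<phi> i) \<le> \<beta>"
      "\<And>i. pdeg (pcoeff \<psi> i) \<le> \<gamma>" "\<beta> + \<gamma> \<le> D"
    and d: "d = pdeg \<phi> + pdeg \<psi>"
  shows "\<exists>w. (\<forall>r. (\<Sum>c\<in>unknowns d D. entry G r c * w c) \<in> Z) \<and> (\<exists>c\<in>unknowns d D. w c \<notin> Z)"
proof -
  define m where "m = pdeg \<phi>"
  define n where "n = pdeg \<psi>"
  have mn: "m \<ge> 1" "n \<ge> 1" "d = m + n" using d1 d2 d by (auto simp: m_def n_def)
  define g where "g = of_nat n * (\<psi> * pderiv \<phi>) - of_nat m * (\<phi> * pderiv \<psi>)"
  define h where "h = of_nat n * (\<psi> * dX \<phi>) - of_nat m * (\<phi> * dX \<psi>)"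
  define s where "s = of_nat d * pderiv \<psi>"
  define t where "t = of_nat n * \<psi>"
  have dapp: "contrib (\<phi> * \<psi>) False 0 g + contrib (\<phi> * \<psi>) False (Suc 0) h = 0"
    unfolding g_def h_def
    by (simp add: dX_mult dX_diff dX_of_nat_eq_0 dX_add pderiv_mult pderiv_diff pderiv_add dX_pderiv)
      (simp add: algebra_simps)
  have st: "contrib (\<phi> * \<psi>) True (Suc (Suc 0)) s + contrib (\<phi> * \<psi>) True (Suc (Suc (Suc 0))) t = - (\<psi> * g)"
    unfolding g_def s_def t_def mn by (simp add: pderiv_mult algebra_simps)
  have degX_mult: "pdeg (pcoeff (p * q) i) \<le> D"
    if "\<And>i. pdeg (pcoeff p i) \<le> \<beta>'" "\<And>i. pdeg (pcoeff q i) \<le> \<gamma>'" "\<beta>' + \<gamma>' \<le> D"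
    for p q :: "int mpoly poly poly" and i \<beta>' \<gamma>'
    unfolding coeff_mult
    by (intro degree_sum_le) (use that in \<open>auto intro!: order_trans[OF degree_mult_le] order_trans[OF add_mono[OF that(1,2)]]\<close>)
  have degX_pderiv: "pdeg (pcoeff (pderiv p) i) \<le> \<beta>'"
    if "\<And>i. pdeg (pcoeff p i) \<le> \<beta>'" for p :: "int mpoly poly poly" and \<beta>' i
    unfolding coeff_pderiv by (rule order_trans[OF degree_mult_le]) (simp add: that of_nat_poly del: of_nat_Suc)
  have degX_dX: "pdeg (pcoeff (dX p) i) \<le> \<beta>'"
    if "\<And>i. pdeg (pcoeff p i) \<le> \<beta>'" for p :: "int mpoly poly poly" and \<beta>' i
    unfolding coeff_dX using that[of i] by (simp add: degree_pderiv)
  have degX_of_nat: "pdeg (pcoeff (of_nat k * p) i) \<le> \<beta>'"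
    if "\<And>i. pdeg (pcoeff p i) \<le> \<beta>'" for p :: "int mpoly poly poly" and \<beta>' i k
    using that[of i] by (simp add: of_nat_poly order_trans[OF degree_mult_le])
  have degX_diff: "pdeg (pcoeff (p - q) i) \<le> \<beta>'"
    if "\<And>i. pdeg (pcoeff p i) \<le> \<beta>'" "\<And>i. pdeg (pcoeff q i) \<le> \<beta>'"
    for p q :: "int mpoly poly poly" and \<beta>' i
    using that[of i] by (simp add: degree_diff_le)
  note degX = degX_diff degX_of_nat degX_dX degX_pderiv X
  have X': "\<gamma> + \<beta> \<le> D" using X by simp
  have gX: "pdeg (pcoeff g i) \<le> D" for i
    unfolding g_def
    by (intro degX_diff degX_of_nat degX_mult[OF X(2) degX_pderiv[OF X(1)] X'] degX_mult[OF X(1) degX_pderiv[OF X(2)] X(3)])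
  have hX: "pdeg (pcoeff h i) \<le> D" for i
    unfolding h_def
    by (intro degX_diff degX_of_nat degX_mult[OF X(2) degX_dX[OF X(1)] X'] degX_mult[OF X(1) degX_dX[OF X(2)] X(3)])
  have \<psi>X: "pdeg (pcoeff \<psi> i) \<le> D" for i
    using X(2)[of i] X(3) by simp
  have sX: "pdeg (pcoeff s i) \<le> D" and tX: "pdeg (pcoeff t i) \<le> D" for i
    unfolding s_def t_def by (intro degX_of_nat degX_pderiv \<psi>X)+
  \<comment> \<open>the weights make the leading terms in Y cancel\<close>
  have g_below: "below (d - 1) g"
    unfolding below_def
  proof (intro allI impI)
    fix a assume a: "d - 1 \<le> a"
    have "below (m + n) (pderiv \<phi> * \<psi>)" "below (n + m) (pderiv \<psi> * \<phi>)"
      by (auto intro!: below_mult below_pderiv simp: m_def n_def)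
    hence bel: "below d g" unfolding g_def mn
      by (intro below_diff below_of_nat) (simp_all add: mult.commute add.commute)
    show "pcoeff g a = 0"
    proof (cases "a = d - 1")
      case True
      have "pcoeff (\<psi> * pderiv \<phi>) (n + (m - 1)) = [:v:] * (of_nat m * [:u:])"
        using coeff_mult_degree_sum[of \<psi> "pderiv \<phi>"] lc mn
        by (simp add: degree_pderiv coeff_pderiv flip: m_def n_def)
      moreover have "pcoeff (\<phi> * pderiv \<psi>) (m + (n - 1)) = [:u:] * (of_nat n * [:v:])"
        using coeff_mult_degree_sum[of \<phi> "pderiv \<psi>"] lc mn
        by (simp add: degree_pderiv coeff_pderiv flip: m_def n_def)
      moreover have "n + (m - 1) = a" "m + (n - 1) = a" using True mn by auto
      ultimately have "pcoeff (\<psi> * pderiv \<phi>) a = [:v:] * (of_nat m * [:u:])"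
         "pcoeff (\<phi> * pderiv \<psi>) a = [:u:] * (of_nat n * [:v:])" by auto
      thus ?thesis by (simp add: g_def of_nat_poly mult_ac)
    qed (use bel a in \<open>auto simp: below_def\<close>)
  qed
  have "below m (dX \<phi>)" if "lead_coeff \<phi> = [:u:]" "m = pdeg \<phi>" for \<phi> :: "int mpoly poly poly" and u m
    unfolding below_def
  proof (intro allI impI)
    fix a assume "m \<le> a"
    thus "pcoeff (dX \<phi>) a = 0"
      using that by (cases "a = m") (auto simp: coeff_dX coeff_eq_0 pderiv_pCons)
  qed
  hence "below m (dX \<phi>)" "below n (dX \<psi>)" using lc m_def n_def by blast+
  hence "below (m + n) (dX \<phi> * \<psi>)" "below (n + m) (dX \<psi> * \<phi>)"
    by (auto intro!: below_mult simp: m_def n_def)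
  hence h_below: "below d h" unfolding h_def mn
    by (intro below_diff below_of_nat) (simp_all add: mult.commute add.commute)
  have s_below: "below (d - 1) s"
    unfolding s_def using mn n_def below_pderiv[of \<psi> n] by (intro below_of_nat) (auto simp: below_def)
  have t_below: "below d t"
    unfolding t_def using mn n_def by (intro below_of_nat) (auto simp: below_def coeff_eq_0)
  define w where "w = (\<lambda>P (\<kappa>::nat, a, b). coeff2 (P \<kappa> :: int mpoly poly poly) a b)"
  define pts where "pts = (\<lambda>P :: nat \<Rightarrow> int mpoly poly poly. \<forall>\<kappa><4. below (slot_deg d \<kappa>) (P \<kappa>) \<and> (\<forall>i. pdeg (pcoeff (P \<kappa>) i) \<le> D))"
  have slot: "slot_poly d D (w P) \<kappa> = P \<kappa>" if "pts P" "\<kappa> < 4" for P \<kappa>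
    unfolding w_def by (rule slot_poly_coeffs) (use that in \<open>auto simp: pts_def below_def\<close>)
  have solution: "(\<Sum>c\<in>unknowns d D. entry G r c * w P c) \<in> Z"
    if P: "pts P" and sol: "\<And>k. in_coeffs Z (\<Sum>\<kappa><4. contrib (\<phi> * \<psi>) k \<kappa> (P \<kappa>))" for P r
  proof -
    obtain k u v where r: "r = (k, u, v)" by (cases r)
    have "(\<Sum>\<kappa><4. contrib G k \<kappa> (slot_poly d D (w P) \<kappa>)) = (\<Sum>\<kappa><4. contrib G k \<kappa> (P \<kappa>))"
      using slot[OF P] by (intro sum.cong) auto
    also have "\<dots> = (\<Sum>\<kappa><4. contrib (\<phi> * \<psi>) k \<kappa> (P \<kappa>)) - (\<Sum>\<kappa><4. - contrib (G - \<phi> * \<psi>) k \<kappa> (P \<kappa>))"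
      by (simp add: contrib_diff_left sum_subtractf sum_negf flip: sum.distrib)
    finally have "in_coeffs Z (\<Sum>\<kappa><4. contrib G k \<kappa> (slot_poly d D (w P) \<kappa>))"
      by (simp only:) (intro in_coeffs_diff[OF Z] sol in_coeffs_sum[OF Z] in_coeffs_uminus[OF Z]
        in_coeffs_contrib[OF Z cong], simp)
    thus ?thesis unfolding r system_eq in_coeffs_def by blast
  qed
  have nonzero: "\<exists>c\<in>unknowns d D. w P c \<notin> Z" if P: "pts P" and k4: "\<kappa> < 4" and nz: "\<not> in_coeffs Z (P \<kappa>)" for P \<kappa>
  proof -
    obtain a b where ab: "coeff2 (P \<kappa>) a b \<notin> Z"
      using nz unfolding in_coeffs_def by blast
    hence "coeff2 (P \<kappa>) a b \<noteq> 0" using pi_zero[OF Z] by metis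
    hence "a < slot_deg d \<kappa>" "b \<le> D"
      using P k4 unfolding pts_def below_def
      by (metis coeff_0 not_le, meson le_degree order_trans)
    thus ?thesis using ab k4 by (intro bexI[of _ "(\<kappa>, a, b)"]) (auto simp: w_def unknowns_def)
  qed
  have lt4: "\<kappa> < 4 \<longleftrightarrow> \<kappa> = 0 \<or> \<kappa> = Suc 0 \<or> \<kappa> = Suc (Suc 0) \<or> \<kappa> = Suc (Suc (Suc 0))" for \<kappa> :: nat by auto
  show ?thesis
  proof (cases "in_coeffs Z g \<and> in_coeffs Z h")
    case True
    define P where "P = (\<lambda>\<kappa>::nat. if \<kappa> = 2 then s else if \<kappa> = 3 then t else 0)"
    have pts: "pts P"
      using s_below t_below sX tX by (auto simp: pts_def P_def slot_deg_def below_def)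
    have "in_coeffs Z (\<Sum>\<kappa><4. contrib (\<phi> * \<psi>) k \<kappa> (P \<kappa>))" for k
      using st True in_coeffs_uminus[OF Z in_coeffs_mult[OF Z, of g \<psi>]]
      by (cases k) (auto simp: sum_slots P_def numeral_eq_Suc in_coeffs_zero[OF Z] mult.commute
        dX_of_nat_eq_0[of 0, simplified])
    moreover have "\<not> in_coeffs Z (P 3)"
    proof
      assume "in_coeffs Z (P 3)"
      hence "coeff2 t n 0 \<in> Z" unfolding in_coeffs_def P_def by simp
      hence "of_nat n * v \<in> Z" using lc(2) by (simp add: t_def of_nat_poly n_def mult.commute)
      thus False using pi_prime[OF Z] d2 lc(3) n_def by blast
    qed
    ultimately show ?thesis using solution[OF pts] nonzero[OF pts, of 3] by (intro exI[of _ "w P"]) auto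
  next
    case False
    define P where "P = (\<lambda>\<kappa>::nat. if \<kappa> = 0 then g else if \<kappa> = 1 then h else 0)"
    have pts: "pts P"
      using g_below h_below gX hX by (auto simp: pts_def P_def slot_deg_def below_def)
    have "in_coeffs Z (\<Sum>\<kappa><4. contrib (\<phi> * \<psi>) k \<kappa> (P \<kappa>))" for k
      using dapp by (cases k) (auto simp: sum_slots P_def numeral_eq_Suc One_nat_def in_coeffs_zero[OF Z])
    moreover have "\<not> in_coeffs Z (P 0) \<or> \<not> in_coeffs Z (P 1)" using False by (auto simp: P_def)
    ultimately show ?thesis using solution[OF pts] nonzero[OF pts, of 0] nonzero[OF pts, of 1]
      by (intro exI[of _ "w P"]) auto
  qed
qed

section \<open>Polynomials over a subfield\<close>

text \<open>
  \<open>K(X\<^sub>1, \<dots>, X\<^sub>n)\<close> is a subset of the field of rational functions in infinitely many variables.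
  Polynomial division and divisibility are taken over the large field, and the results shown to stay
  in the small one.
\<close>

locale subfield_set =
  fixes k0 :: "'f::field set"
  assumes one_in: "1 \<in> k0"
    and add_in: "x \<in> k0 \<Longrightarrow> y \<in> k0 \<Longrightarrow> x + y \<in> k0"
    and uminus_in: "x \<in> k0 \<Longrightarrow> - x \<in> k0"
    and mult_in: "x \<in> k0 \<Longrightarrow> y \<in> k0 \<Longrightarrow> x * y \<in> k0"
    and inverse_in: "x \<in> k0 \<Longrightarrow> inverse x \<in> k0"
begin

lemma diff_in: "x \<in> k0 \<Longrightarrow> y \<in> k0 \<Longrightarrow> x - y \<in> k0"
  using add_in[OF _ uminus_in, of x y] by simp

lemma zero_in: "0 \<in> k0"
  using diff_in[OF one_in one_in] by simp

lemma sum_in: "(\<And>i. i \<in> A \<Longrightarrow> f i \<in> k0) \<Longrightarrow> sum f A \<in> k0"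
  by (induction A rule: infinite_finite_induct) (auto intro: add_in zero_in)

lemma of_nat_in: "of_nat j \<in> k0"
  by (induction j) (auto intro: add_in one_in zero_in)

definition P0 :: "'f poly set" where
  "P0 = {p. \<forall>j. pcoeff p j \<in> k0}"

lemma P0_zero: "0 \<in> P0"
  by (simp add: P0_def zero_in)

lemma P0_pCons: "c \<in> k0 \<Longrightarrow> p \<in> P0 \<Longrightarrow> pCons c p \<in> P0"
  by (auto simp: P0_def coeff_pCons split: nat.split)

lemma P0_const: "c \<in> k0 \<Longrightarrow> [:c:] \<in> P0"
  by (simp add: P0_pCons P0_zero)

lemma P0_one: "1 \<in> P0"
  using P0_const[OF one_in] by (simp add: one_pCons)

lemma P0_add: "p \<in> P0 \<Longrightarrow> q \<in> P0 \<Longrightarrow> p + q \<in> P0"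
  by (auto simp: P0_def intro: add_in)

lemma P0_uminus: "p \<in> P0 \<Longrightarrow> - p \<in> P0"
  by (auto simp: P0_def intro: uminus_in)

lemma P0_diff: "p \<in> P0 \<Longrightarrow> q \<in> P0 \<Longrightarrow> p - q \<in> P0"
  by (auto simp: P0_def intro: diff_in)

lemma P0_mult: "p \<in> P0 \<Longrightarrow> q \<in> P0 \<Longrightarrow> p * q \<in> P0"
  by (auto simp: P0_def coeff_mult intro!: sum_in mult_in)

lemma P0_monom: "c \<in> k0 \<Longrightarrow> Polynomial.monom c j \<in> P0"
  by (auto simp: P0_def zero_in)

lemma P0_pderiv: "p \<in> P0 \<Longrightarrow> pderiv p \<in> P0"
  by (auto simp: P0_def coeff_pderiv simp del: of_nat_Suc intro!: mult_in of_nat_in)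

lemma P0_induct [consumes 1, case_names zero pCons]:
  assumes "p \<in> P0" "Q 0" "\<And>c p. c \<in> k0 \<Longrightarrow> p \<in> P0 \<Longrightarrow> Q p \<Longrightarrow> Q (pCons c p)"
  shows "Q p"
  using assms(1)
proof (induction p)
  case (pCons c p)
  have "pcoeff (pCons c p) 0 \<in> k0" "pcoeff (pCons c p) (Suc j) \<in> k0" for j
    using pCons.prems unfolding P0_def by blast+
  hence "c \<in> k0" "p \<in> P0" by (auto simp: P0_def)
  thus ?case using pCons.IH assms(3) by blast
qed (rule assms(2))

lemma P0_pcompose: "p \<in> P0 \<Longrightarrow> q \<in> P0 \<Longrightarrow> pcompose p q \<in> P0"
  by (induction p rule: P0_induct) (auto simp: pcompose_pCons P0_zero intro!: P0_add P0_mult P0_const)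

lemma P0_division:
  assumes "F \<in> P0" "F \<noteq> 0" "p \<in> P0"
  shows "\<exists>q\<in>P0. \<exists>r\<in>P0. p = q * F + r \<and> (r = 0 \<or> pdeg r < pdeg F)"
  using assms(3)
proof (induction "pdeg p" arbitrary: p rule: less_induct)
  case less
  show ?case
  proof (cases "p = 0 \<or> pdeg p < pdeg F")
    case True
    thus ?thesis using less.prems P0_zero by (intro bexI[of _ 0] bexI[of _ p]) auto
  next
    case False
    define m where "m = Polynomial.monom (lead_coeff p * inverse (lead_coeff F)) (pdeg p - pdeg F)"
    have m: "m \<in> P0"
      unfolding m_def using less.prems assms(1) by (intro P0_monom mult_in inverse_in) (auto simp: P0_def)
    have dm1: "pdeg (m * F) = pdeg p"
      using False assms(2) by (auto simp: m_def degree_mult_eq degree_monom_eq)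
    have dm2: "lead_coeff (m * F) = lead_coeff p"
      using False assms(2) by (simp add: lead_coeff_mult m_def degree_monom_eq)
    note dm = dm1 dm2
    define p' where "p' = p - m * F"
    have p': "p' \<in> P0" unfolding p'_def by (intro P0_diff P0_mult less.prems m assms(1))
    show ?thesis
    proof (cases "p' = 0 \<or> pdeg p' < pdeg F")
      case True
      thus ?thesis using m p' by (intro bexI[of _ m] bexI[of _ p']) (auto simp: p'_def)
    next
      case False'': False
      have "pdeg p' < pdeg p"
      proof (rule ccontr)
        assume c: "\<not> ?thesis"
        have "pdeg p' \<le> pdeg p"
          unfolding p'_def using dm by (intro degree_diff_le) auto
        with c have "pdeg p' = pdeg p" by simp
        hence "lead_coeff p' = lead_coeff p - lead_coeff (m * F)"
          unfolding p'_def using dm(1) by simp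
        thus False using dm False'' by simp
      qed
      from less.hyps[OF this p'] obtain q r where "q \<in> P0" "r \<in> P0" "p' = q * F + r"
        "r = 0 \<or> pdeg r < pdeg F" by blast
      thus ?thesis using m by (intro bexI[of _ "m + q"] bexI[of _ r]) (auto simp: p'_def algebra_simps intro: P0_add)
    qed
  qed
qed

text \<open>Quotient and remainder are unique over the large field, hence equal to those over the subfield.\<close>

lemma P0_div_mod:
  assumes "F \<in> P0" "F \<noteq> 0" "p \<in> P0"
  shows "p div F \<in> P0" "p mod F \<in> P0"
proof -
  obtain q r where qr: "q \<in> P0" "r \<in> P0" "p = q * F + r" "r = 0 \<or> pdeg r < pdeg F"
    using P0_division[OF assms] by blast
  have "r div F = 0" using qr(4) by (auto intro: div_poly_less)
  hence "p div F = q" using assms(2) qr(3) by simp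
  moreover have "r mod F = r" using qr(4) by (auto intro: mod_poly_less)
  hence "p mod F = r" using qr(3) by simp
  ultimately show "p div F \<in> P0" "p mod F \<in> P0" using qr by auto
qed

end

section \<open>Derivations\<close>

locale derivation =
  fixes \<D> :: "'f::comm_ring_1 \<Rightarrow> 'f"
  assumes D_add: "\<D> (x + y) = \<D> x + \<D> y"
    and D_mult: "\<D> (x * y) = \<D> x * y + x * \<D> y"
begin

lemma D_zero: "\<D> 0 = 0"
  using D_add[of 0 0] by (metis add.right_neutral add_left_cancel)

lemma D_one: "\<D> 1 = 0"
  using D_mult[of 1 1] by (metis mult_1 mult_1_right add_cancel_right_right)

lemma D_uminus: "\<D> (- x) = - \<D> x"
  using D_add[of x "- x"] by (simp add: D_zero eq_neg_iff_add_eq_0 add.commute)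

lemma D_diff: "\<D> (x - y) = \<D> x - \<D> y"
  using D_add[of x "- y"] by (simp add: D_uminus)

lemma D_sum: "\<D> (sum f A) = (\<Sum>i\<in>A. \<D> (f i))"
  by (induction A rule: infinite_finite_induct) (auto simp: D_zero D_add)

lemma D_of_nat: "\<D> (of_nat j) = 0"
  by (induction j) (auto simp: D_zero D_one D_add)

lemma coeff_map_D: "pcoeff (map_poly \<D> p) i = \<D> (pcoeff p i)"
  by (simp add: coeff_map_poly D_zero)

lemma derivation_map_poly: "derivation (map_poly \<D>)"
proof
  show "map_poly \<D> (p + q) = map_poly \<D> p + map_poly \<D> q" for p q
    by (rule poly_eqI) (simp add: coeff_map_D D_add)
  show "map_poly \<D> (p * q) = map_poly \<D> p * q + p * map_poly \<D> q" for p q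
    by (rule poly_eqI) (simp add: coeff_map_D coeff_mult D_sum D_mult sum.distrib)
qed


end


context
  fixes \<D> :: "'f::idom \<Rightarrow> 'f"
  assumes D: "derivation \<D>"
begin

interpretation derivation \<D> by (rule D)

lemma D_poly:
  assumes "\<D> x = 1" "\<And>j. \<D> (pcoeff P j) = 0"
  shows "\<D> (poly P x) = poly (pderiv P) x"
  using assms(2)
proof (induction P)
  case (pCons c P)
  have "\<D> c = 0" using pCons.prems[of 0] by simp
  moreover have "\<D> (pcoeff P j) = 0" for j using pCons.prems[of "Suc j"] by simp
  ultimately show ?case
    using pCons.IH by (simp add: D_add D_mult assms(1) pderiv_pCons)
qed (simp add: D_zero)

lemma map_D_pderiv: "map_poly \<D> (pderiv p) = pderiv (map_poly \<D> p)"
  by (rule poly_eqI) (simp add: coeff_map_D coeff_pderiv D_mult D_of_nat D_add D_one)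

end

text \<open>\<open>d1\<close> and \<open>D1\<close> are the partial derivatives along \<open>X\<^sub>1\<close> of polynomials and of rational functions.\<close>

definition d1 :: "'k::idom mpoly \<Rightarrow> 'k mpoly" where
  "d1 a = poly (pderiv (isolate1 a)) X1"

lemma derivation_d1: "derivation d1"
proof -
  interpret rhom "isolate1 :: 'k::idom mpoly \<Rightarrow> 'k mpoly poly" by (rule rhom_isolate1)
  show "derivation (d1 :: 'k::idom mpoly \<Rightarrow> _)"
    by unfold_locales
      (simp_all add: d1_def hom_add hom_mult pderiv_add pderiv_mult poly_isolate1 algebra_simps)
qed

lemma d1_const: "vars_in V a \<Longrightarrow> 1 \<notin> V \<Longrightarrow> d1 a = 0"
  by (simp add: d1_def isolate1_const pderiv_pCons)

lemma d1_X1: "d1 X1 = 1"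
  by (simp add: d1_def isolate1_X1 pderiv_pCons)

lemma vars_in_poly:
  fixes P :: "'k::comm_ring_1 mpoly poly"
  assumes "\<And>j. vars_in V (pcoeff P j)" "vars_in V x"
  shows "vars_in V (poly P x)"
  unfolding poly_altdef by (intro vars_in_sum vars_in_mult vars_in_power assms)

lemma vars_in_X1: "1 \<in> V \<Longrightarrow> vars_in V X1"
  unfolding X1_def by (rule vars_in_single) simp

lemma vars_in_d1:
  assumes "vars_in V a" "1 \<in> V"
  shows "vars_in V (d1 a)"
  unfolding d1_def
proof (rule vars_in_poly[OF _ vars_in_X1[OF assms(2)]])
  fix j
  have "vars_in V (pcoeff (isolate1 a) (Suc j))"
    using vars_in_isolate1[OF assms(1)] vars_in_mono[of "V - {1}" V] by blast
  thus "vars_in V (pcoeff (pderiv (isolate1 a)) j)"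
    unfolding coeff_pderiv by (intro vars_in_mult vars_in_of_nat)
qed

definition D1 :: "'k::idom mpoly fract \<Rightarrow> 'k mpoly fract" where
  "D1 q = (SOME r. \<exists>a b. b \<noteq> 0 \<and> q = Fract a b \<and> r = Fract (d1 a * b - a * d1 b) (b * b))"

text \<open>The quotient rule; its right-hand side does not depend on the chosen representation.\<close>

lemma D1_Fract:
  assumes "b \<noteq> 0"
  shows "D1 (Fract a b) = Fract (d1 a * b - a * d1 b) (b * b)"
proof -
  interpret derivation d1 by (rule derivation_d1)
  have "\<exists>a' b'. b' \<noteq> 0 \<and> Fract a b = Fract a' b' \<and> D1 (Fract a b) = Fract (d1 a' * b' - a' * d1 b') (b' * b')"
    unfolding D1_def by (rule someI_ex) (use assms in blast)
  then obtain a' b' where b': "b' \<noteq> 0" "Fract a b = Fract a' b'"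
    and D: "D1 (Fract a b) = Fract (d1 a' * b' - a' * d1 b') (b' * b')" by blast
  have e: "a * b' = a' * b" using b' assms by (simp add: eq_fract)
  hence e': "d1 a * b' + a * d1 b' = d1 a' * b + a' * d1 b" by (metis D_mult)
  have "(d1 a' * b' - a' * d1 b') * (b * b) = (d1 a' * b) * (b * b') - (a' * b) * (d1 b' * b)"
    by (simp add: algebra_simps)
  also have "d1 a' * b = d1 a * b' + a * d1 b' - a' * d1 b" using e' by (simp add: algebra_simps)
  also have "(d1 a * b' + a * d1 b' - a' * d1 b) * (b * b') - a' * b * (d1 b' * b) =
      d1 a * b' * b * b' + a * b' * (d1 b' * b) - (a' * b) * (d1 b * b') - a' * b * (d1 b' * b)"
    by (simp add: algebra_simps)
  also have "\<dots> = (d1 a * b - a * d1 b) * (b' * b')"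
    unfolding e[symmetric] by (simp add: algebra_simps)
  finally show ?thesis unfolding D using assms b' by (simp add: eq_fract)
qed

lemma derivation_D1: "derivation D1"
proof -
  interpret derivation d1 by (rule derivation_d1)
  show ?thesis
  proof
    fix x y :: "'a mpoly fract"
    obtain a b where x: "x = Fract a b" "b \<noteq> 0" by (cases x)
    obtain c d where y: "y = Fract c d" "d \<noteq> 0" by (cases y)
    show "D1 (x + y) = D1 x + D1 y" using x y
      by (simp add: D1_Fract eq_fract D_add D_mult algebra_simps)
    show "D1 (x * y) = D1 x * y + x * D1 y" using x y
      by (simp add: D1_Fract eq_fract D_add D_mult algebra_simps)
  qed
qed

lemma subfield_set_KX: "subfield_set (carrier (KX n) :: 'k::field mpoly fract set)"
proof -
  have c: "carrier (KX n) = {Fract a b |a b. in_vars n a \<and> in_vars n b \<and> b \<noteq> (0 :: 'k mpoly)}"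
    by (simp add: KX_def)
  show ?thesis
  proof
    show "1 \<in> carrier (KX n :: 'k mpoly fract ring)"
      unfolding c in_vars_eq One_fract_def by (auto intro!: exI[of _ 1])
    fix x y :: "'k mpoly fract"
    assume x: "x \<in> carrier (KX n)"
    then obtain a b where x: "x = Fract a b" "vars_in {1..n} a" "vars_in {1..n} b" "b \<noteq> 0"
      unfolding c in_vars_eq by blast
    show "- x \<in> carrier (KX n)"
    proof -
      have "- x = Fract (- a) b" "vars_in {1..n} (- a)" using x by (auto intro: vars_in_uminus)
      thus ?thesis unfolding c in_vars_eq using x by blast
    qed
    show "inverse x \<in> carrier (KX n)"
    proof (cases "a = 0")
      case True
      hence "inverse x = Fract 0 1" using x by (simp add: fract_collapse)
      moreover have "vars_in {1..n} (0 :: 'k mpoly)" "vars_in {1..n} (1 :: 'k mpoly)" by simp_all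
      ultimately show ?thesis unfolding c in_vars_eq using one_neq_zero by blast
    next
      case False
      hence "inverse x = Fract b a" using x by simp
      thus ?thesis unfolding c in_vars_eq using x False by blast
    qed
    assume "y \<in> carrier (KX n)"
    then obtain a' b' where y: "y = Fract a' b'" "vars_in {1..n} a'" "vars_in {1..n} b'" "b' \<noteq> 0"
      unfolding c in_vars_eq by blast
    have "x + y = Fract (a * b' + a' * b) (b * b')" "x * y = Fract (a * a') (b * b')"
      using x y by simp_all
    moreover have "vars_in {1..n} (a * b' + a' * b)" "vars_in {1..n} (a * a')" "vars_in {1..n} (b * b')" "b * b' \<noteq> 0"
      using x y by (auto intro!: vars_in_add vars_in_mult)
    ultimately show "x + y \<in> carrier (KX n)" "x * y \<in> carrier (KX n)"
      unfolding c in_vars_eq by blast+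
  qed
qed

lemma D1_KX: "n \<ge> 1 \<Longrightarrow> x \<in> carrier (KX n) \<Longrightarrow> D1 x \<in> carrier (KX n)"
  for x :: "'k::field mpoly fract"
proof -
  assume n: "n \<ge> 1" and "x \<in> carrier (KX n)"
  then obtain a b where x: "x = Fract a b" "vars_in {1..n} a" "vars_in {1..n} b" "b \<noteq> 0"
    by (auto simp: KX_def in_vars_eq)
  have "D1 x = Fract (d1 a * b - a * d1 b) (b * b)" "vars_in {1..n} (d1 a * b - a * d1 b)"
    "vars_in {1..n} (b * b)" "b * b \<noteq> 0"
    using x n by (auto simp: D1_Fract intro!: vars_in_minus vars_in_mult vars_in_d1)
  moreover have "carrier (KX n) = {Fract a b |a b. in_vars n a \<and> in_vars n b \<and> b \<noteq> (0 :: 'k mpoly)}"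
    by (simp add: KX_def)
  ultimately show ?thesis unfolding in_vars_eq by blast
qed

text \<open>
  If \<open>A' B = A B'\<close> with both nonzero, comparing leading coefficients shows that \<open>A\<close> and \<open>B\<close> have the
  same degree. The combination that cancels the leading term satisfies the same equation with a
  smaller degree, so it is zero.
\<close>

lemma wronskian_zero_imp_proportional:
  fixes A B :: "'a::{idom, ring_char_0} poly"
  assumes "B \<noteq> 0" "pderiv A * B = A * pderiv B"
  shows "Polynomial.smult (lead_coeff B) A = Polynomial.smult (lead_coeff A) B"
proof -
  have deg: "pdeg A = pdeg B"
    if AB: "A \<noteq> 0" "B \<noteq> 0" "pderiv A * B = A * pderiv B" for A B :: "'a poly"
  proof -
    let ?m = "pdeg A" and ?n = "pdeg B"
    have *: "of_nat (pdeg P) * (lead_coeff P * lead_coeff Q) =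
        pcoeff (pderiv P * Q) (pdeg P + pdeg Q - 1)"
      if "pdeg P + pdeg Q \<noteq> 0" for P Q :: "'a poly"
    proof (cases "pdeg P = 0")
      case True
      hence "pderiv P = 0" by (simp add: pderiv_eq_0_iff)
      thus ?thesis using True by simp
    next
      case False
      have "pcoeff (pderiv P * Q) (pdeg (pderiv P) + pdeg Q)
          = lead_coeff (pderiv P) * lead_coeff Q" by (rule coeff_mult_degree_sum)
      moreover have "pdeg (pderiv P) + pdeg Q = pdeg P + pdeg Q - 1"
        using False by (simp add: degree_pderiv)
      moreover have "lead_coeff (pderiv P) = of_nat (pdeg P) * lead_coeff P"
        using False by (simp add: degree_pderiv coeff_pderiv)
      ultimately show ?thesis by (simp add: mult.assoc)
    qed
    show ?thesis
    proof (cases "?m + ?n = 0")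
      case False
      have "of_nat ?m * (lead_coeff A * lead_coeff B) = of_nat ?n * (lead_coeff B * lead_coeff A)"
        using *[of A B] *[of B A] False AB(3) by (simp add: add.commute mult.commute[of A])
      hence "of_nat ?m * (lead_coeff A * lead_coeff B) = of_nat ?n * (lead_coeff A * lead_coeff B)"
        by (simp add: mult_ac)
      thus ?thesis using AB by simp
    qed simp
  qed
  define W where "W = Polynomial.smult (lead_coeff B) A - Polynomial.smult (lead_coeff A) B"
  have W: "pderiv W * B = W * pderiv B"
    using assms(2) by (simp add: W_def pderiv_diff pderiv_smult algebra_simps)
  have "W = 0"
  proof (rule ccontr)
    assume nz: "W \<noteq> 0"
    hence "A \<noteq> 0" by (auto simp: W_def)
    hence d: "pdeg A = pdeg B" using deg assms by blast
    have dW: "pdeg W = pdeg B" using deg[OF nz assms(1) W] .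
    have "pcoeff W (pdeg B) = 0" by (simp add: W_def d mult.commute flip: d)
    thus False using nz dW by (metis leading_coeff_0_iff)
  qed
  thus ?thesis by (simp add: W_def)
qed

text \<open>
  The constants of \<open>\<partial>/\<partial>X\<^sub>1\<close> in \<open>\<rat>(X\<^sub>1, \<dots>, X\<^sub>n)\<close> are the rational functions in \<open>X\<^sub>2, \<dots>, X\<^sub>n\<close>: numerator
  and denominator are proportional as polynomials in \<open>X\<^sub>1\<close>, hence the fraction equals the quotient of
  their leading coefficients.
\<close>

lemma D1_eq_0_imp_free:
  fixes x :: "rat mpoly fract"
  assumes "x \<in> carrier (KX n)" "D1 x = 0"
  shows "\<exists>a b. b \<noteq> 0 \<and> vars_in {2..n} a \<and> vars_in {2..n} b \<and> x = Fract a b"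
proof -
  interpret rhom "isolate1 :: rat mpoly \<Rightarrow> rat mpoly poly" by (rule rhom_isolate1)
  obtain a b where x: "x = Fract a b" "vars_in {1..n} a" "vars_in {1..n} b" "b \<noteq> 0"
    using assms(1) by (auto simp: KX_def in_vars_eq)
  have "{1..n} - {1} = {2..n}" by auto
  hence v: "vars_in {2..n} (pcoeff (isolate1 a) j)" "vars_in {2..n} (pcoeff (isolate1 b) j)" for j
    using vars_in_isolate1[OF x(2)] vars_in_isolate1[OF x(3)] by auto
  have "d1 a * b = a * d1 b"
    using assms(2) x by (simp add: D1_Fract eq_fract Zero_fract_def)
  hence "poly (pderiv (isolate1 a) * isolate1 b) X1 = poly (isolate1 a * pderiv (isolate1 b)) X1"
    by (simp add: d1_def poly_isolate1)
  hence "isolate1 (poly (pderiv (isolate1 a) * isolate1 b) X1) = isolate1 (poly (isolate1 a * pderiv (isolate1 b)) X1)"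
    by simp
  moreover have "vars_in {2..n} (pcoeff (pderiv (isolate1 a) * isolate1 b) j)"
     "vars_in {2..n} (pcoeff (isolate1 a * pderiv (isolate1 b)) j)" for j
    unfolding coeff_mult coeff_pderiv
    by (intro vars_in_sum vars_in_mult vars_in_of_nat v)+
  hence "isolate1 (poly (pderiv (isolate1 a) * isolate1 b) X1) = pderiv (isolate1 a) * isolate1 b"
    "isolate1 (poly (isolate1 a * pderiv (isolate1 b)) X1) = isolate1 a * pderiv (isolate1 b)"
    by (intro isolate1_poly[of "{2..n}"]; simp)+
  ultimately have W: "pderiv (isolate1 a) * isolate1 b = isolate1 a * pderiv (isolate1 b)"
    by simp
  have nz: "isolate1 b \<noteq> 0" using poly_isolate1[of b] x(4) by auto
  from arg_cong[OF wronskian_zero_imp_proportional[OF nz W], of "\<lambda>p. poly p X1"]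
  have "lead_coeff (isolate1 b) * a = lead_coeff (isolate1 a) * b" by (simp add: poly_isolate1)
  hence "x = Fract (lead_coeff (isolate1 a)) (lead_coeff (isolate1 b))"
    using x nz by (simp add: eq_fract algebra_simps)
  thus ?thesis using v nz by (metis leading_coeff_0_iff)
qed

section \<open>The field defined by a strongly genuine polynomial\<close>

lemma carrier_KX_Y: "carrier (KX_Y n) = subfield_set.P0 (carrier (KX n) :: 'k::field mpoly fract set)"
  by (simp add: KX_Y_def subfield_set.P0_def[OF subfield_set_KX])

lemma KX_Y_simps [simp]:
  "x \<otimes>\<^bsub>KX_Y n\<^esub> y = x * y" "x \<oplus>\<^bsub>KX_Y n\<^esub> y = x + y" "\<zero>\<^bsub>KX_Y n\<^esub> = 0" "\<one>\<^bsub>KX_Y n\<^esub> = 1"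
  by (simp_all add: KX_Y_def ring_of_type_algebra_def)

lemma KX_simps [simp]:
  "x \<otimes>\<^bsub>KX n\<^esub> y = x * y" "x \<oplus>\<^bsub>KX n\<^esub> y = x + y" "\<zero>\<^bsub>KX n\<^esub> = 0" "\<one>\<^bsub>KX n\<^esub> = 1"
  by (simp_all add: KX_def ring_of_type_algebra_def)

lemma cring_KX_Y: "cring (KX_Y n :: 'k::field mpoly fract poly ring)"
proof -
  interpret subfield_set "carrier (KX n) :: 'k mpoly fract set" by (rule subfield_set_KX)
  show ?thesis
  proof (rule cringI)
    show "abelian_group (KX_Y n :: 'k mpoly fract poly ring)"
      by (rule abelian_groupI)
        (auto simp: carrier_KX_Y P0_add P0_zero add_ac intro!: bexI[OF _ P0_uminus])
    show "Group.comm_monoid (KX_Y n :: 'k mpoly fract poly ring)"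
      by (rule Group.comm_monoidI) (auto simp: carrier_KX_Y P0_mult P0_one mult_ac)
  qed (auto simp: algebra_simps)
qed

lemma cring_KX: "cring (KX n :: 'k::field mpoly fract ring)"
proof -
  interpret subfield_set "carrier (KX n) :: 'k mpoly fract set" by (rule subfield_set_KX)
  show ?thesis
  proof (rule cringI)
    show "abelian_group (KX n :: 'k mpoly fract ring)"
      by (rule abelian_groupI)
        (auto simp: add_in zero_in add_ac intro!: bexI[OF _ uminus_in])
    show "Group.comm_monoid (KX n :: 'k mpoly fract ring)"
      by (rule Group.comm_monoidI) (auto simp: mult_in one_in mult_ac)
  qed (auto simp: algebra_simps)
qed

lemma field_KX: "field (KX n :: 'k::field mpoly fract ring)"
proof -
  interpret subfield_set "carrier (KX n) :: 'k mpoly fract set" by (rule subfield_set_KX)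
  show ?thesis
  proof (rule cring.cring_fieldI2[OF cring_KX])
    show "\<exists>b\<in>carrier (KX n). a \<otimes>\<^bsub>KX n\<^esub> b = \<one>\<^bsub>KX n\<^esub>"
      if "a \<in> carrier (KX n)" "a \<noteq> \<zero>\<^bsub>KX n\<^esub>" for a :: "'k mpoly fract"
      using that by (intro bexI[of _ "inverse a"]) (auto intro: inverse_in)
  qed auto
qed

locale genuine_setting =
  fixes n :: nat and F :: "rat mpoly poly"
  assumes n: "n \<ge> 1" and sg: "strongly_genuine_poly n F"
begin

abbreviation k0 :: "rat mpoly fract set" where "k0 \<equiv> carrier (KX n)"
abbreviation Fh :: "rat mpoly fract poly" where "Fh \<equiv> to_KX_Y F"
abbreviation M where "M \<equiv> quot_alg n F"
abbreviation I where "I \<equiv> PIdl\<^bsub>KX_Y n\<^esub> Fh"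
definition cls :: "rat mpoly fract poly \<Rightarrow> rat mpoly fract poly set" where
  "cls p = I +>\<^bsub>KX_Y n\<^esub> p"

sublocale subfield_set k0 by (rule subfield_set_KX)
sublocale R: cring "KX_Y n :: rat mpoly fract poly ring" by (rule cring_KX_Y)

lemma carrier_R: "carrier (KX_Y n) = P0"
  by (rule carrier_KX_Y)

lemma coeff_Fh: "pcoeff Fh j = Fract (pcoeff F j) 1"
  by (simp add: to_KX_Y_def coeff_map_poly fract_collapse)

lemma Fh_P0: "Fh \<in> P0"
proof -
  have "vars_in {1..n} (pcoeff F j)" for j
    using sg by (simp add: strongly_genuine_poly_def polys_YX_def in_vars_eq)
  moreover have "k0 = {Fract a b |a b. in_vars n a \<and> in_vars n b \<and> b \<noteq> 0}" by (simp add: KX_def)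
  moreover have "vars_in {1..n} (1 :: rat mpoly)" "(1 :: rat mpoly) \<noteq> 0" by simp_all
  ultimately have "Fract (pcoeff F j) 1 \<in> k0" for j
    unfolding in_vars_eq by blast
  thus ?thesis by (simp add: P0_def coeff_Fh)
qed

lemma degree_Fh: "pdeg Fh = pdeg F"
  unfolding to_KX_Y_def by (rule degree_map_poly) (auto simp: Zero_fract_def eq_fract)

lemma lc_Fh: "lead_coeff Fh = 1"
proof -
  have "lead_coeff F = 1" using sg unfolding strongly_genuine_poly_def by blast
  thus ?thesis by (simp add: degree_Fh coeff_Fh One_fract_def)
qed

lemma Fh_nz: "Fh \<noteq> 0"
  using lc_Fh by auto

lemma mem_I: "p \<in> I \<longleftrightarrow> p \<in> P0 \<and> Fh dvd p"
proof
  assume "p \<in> I"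
  thus "p \<in> P0 \<and> Fh dvd p"
    using Fh_P0 by (auto simp: cgenideal_def carrier_R intro: P0_mult)
next
  assume p: "p \<in> P0 \<and> Fh dvd p"
  hence "(p div Fh) \<otimes>\<^bsub>KX_Y n\<^esub> Fh = p" by simp
  moreover have "p div Fh \<in> P0" using P0_div_mod[OF Fh_P0 Fh_nz] p by blast
  ultimately show "p \<in> I" unfolding cgenideal_def carrier_R
    by (intro CollectI exI[of _ "p div Fh"] conjI) (rule sym)
qed

lemma ideal_I: "ideal I (KX_Y n)"
  by (rule R.cgenideal_ideal) (simp add: carrier_R Fh_P0)

sublocale I: ideal I "KX_Y n" by (rule ideal_I)

lemma cls_hom: "ring_hom_ring (KX_Y n) M cls"
  using I.rcos_ring_hom_ring unfolding quot_alg_def cls_def[abs_def] .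

lemma cls_eq_iff:
  assumes p: "p \<in> P0" and q: "q \<in> P0"
  shows "cls p = cls q \<longleftrightarrow> Fh dvd p - q"
proof -
  interpret h: ring_hom_ring "KX_Y n" M cls by (rule cls_hom)
  have r: "p - q \<in> P0" using p q by (rule P0_diff)
  have "cls p = cls (q + (p - q))" by simp
  also have "\<dots> = cls q \<oplus>\<^bsub>M\<^esub> cls (p - q)"
    using h.hom_add[of q "p - q"] q r by (simp add: carrier_R)
  finally have "cls p = cls q \<longleftrightarrow> cls (p - q) = \<zero>\<^bsub>M\<^esub>"
    using h.hom_closed[of q] h.hom_closed[of "p - q"] q r
    by (simp add: carrier_R h.S.add.l_cancel_one)
  also have "\<zero>\<^bsub>M\<^esub> = I" by (simp add: quot_alg_def FactRing_def)
  also have "cls (p - q) = I \<longleftrightarrow> p - q \<in> I"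
    unfolding cls_def using I.a_rcos_const I.a_rcos_self[of "p - q"] r by (auto simp: carrier_R)
  finally show ?thesis using r by (simp add: mem_I)
qed

lemma carrier_M: "carrier M = cls ` P0"
  by (auto simp: quot_alg_def FactRing_def A_RCOSETS_def' cls_def carrier_R)

lemma ext: "finite_nontrivial_ext n M (quot_emb n F)"
  using sg by (simp add: strongly_genuine_poly_def strongly_genuine_ext_def)

sublocale M: field M
  using ext by (simp add: finite_nontrivial_ext_def)

lemma quot_emb_cls: "quot_emb n F c = cls [:c:]"
  by (simp add: quot_emb_def cls_def)

lemma cls_add: "p \<in> P0 \<Longrightarrow> q \<in> P0 \<Longrightarrow> cls (p + q) = cls p \<oplus>\<^bsub>M\<^esub> cls q"
  and cls_mult: "p \<in> P0 \<Longrightarrow> q \<in> P0 \<Longrightarrow> cls (p * q) = cls p \<otimes>\<^bsub>M\<^esub> cls q"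
  and cls_one: "cls 1 = \<one>\<^bsub>M\<^esub>" and cls_zero: "cls 0 = \<zero>\<^bsub>M\<^esub>"
proof -
  interpret ring_hom_ring "KX_Y n" M cls by (rule cls_hom)
  show "p \<in> P0 \<Longrightarrow> q \<in> P0 \<Longrightarrow> cls (p + q) = cls p \<oplus>\<^bsub>M\<^esub> cls q"
    "p \<in> P0 \<Longrightarrow> q \<in> P0 \<Longrightarrow> cls (p * q) = cls p \<otimes>\<^bsub>M\<^esub> cls q"
    using hom_add[of p q] hom_mult[of p q] by (simp_all add: carrier_R)
  show "cls 1 = \<one>\<^bsub>M\<^esub>" using hom_one by simp
  show "cls 0 = \<zero>\<^bsub>M\<^esub>" using hom_zero by simp
qed

lemma cls_eq_zero_iff: "p \<in> P0 \<Longrightarrow> cls p = \<zero>\<^bsub>M\<^esub> \<longleftrightarrow> Fh dvd p"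
  using cls_eq_iff[of p 0] by (simp add: cls_zero P0_zero)

lemma cls_carrier: "p \<in> P0 \<Longrightarrow> cls p \<in> carrier M"
  by (simp add: carrier_M)

text \<open>
  That the quotient is a field replaces Euclid's algorithm: it provides inverses modulo \<open>F\<close>, and
  thereby the primality of \<open>F\<close>.
\<close>

lemma inverse_mod:
  assumes "p \<in> P0" "\<not> Fh dvd p"
  shows "\<exists>u\<in>P0. Fh dvd u * p - 1"
proof -
  have "cls p \<in> Units M"
    using assms by (simp add: M.field_Units cls_carrier cls_eq_zero_iff)
  then obtain y where "y \<in> carrier M" "y \<otimes>\<^bsub>M\<^esub> cls p = \<one>\<^bsub>M\<^esub>"
    unfolding Units_def by blast
  then obtain u where u: "u \<in> P0" "cls u \<otimes>\<^bsub>M\<^esub> cls p = \<one>\<^bsub>M\<^esub>"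
    unfolding carrier_M by blast
  hence "cls (u * p) = cls 1" using assms by (simp add: cls_mult cls_one)
  thus ?thesis using u assms by (auto simp: cls_eq_iff P0_mult P0_one)
qed

lemma prime_Fh:
  assumes "p \<in> P0" "\<not> Fh dvd p" "Fh dvd p * q"
  shows "Fh dvd q"
proof -
  obtain u where u: "Fh dvd u * p - 1" using inverse_mod[OF assms(1,2)] by blast
  have "q = u * (p * q) - (u * p - 1) * q" by (simp add: algebra_simps)
  thus ?thesis using u assms(3) by (metis dvd_diff dvd_mult dvd_mult2)
qed

text \<open>
  The subextension \<open>\<rat>(X)(a)\<close> for the class of \<open>a\<close>, as the set of values of polynomials at \<open>a\<close>.
\<close>

definition subext :: "rat mpoly fract poly \<Rightarrow> rat mpoly fract poly set set" where
  "subext a = (\<lambda>p. cls (pcompose p a)) ` P0"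

lemma subfield_emb: "subfield (quot_emb n F ` k0) M"
proof -
  have "ring_hom_ring (KX n) M (quot_emb n F)"
    using ext by (intro ring_hom_ringI2) (auto simp: finite_nontrivial_ext_def field_KX cring.axioms(1)[OF cring_KX] M.ring_axioms)
  thus ?thesis
    by (rule ring_hom_ring.img_is_subfield(2)[OF _ field.carrier_is_subfield[OF field_KX] M.one_not_zero])
qed

lemma cls_pcompose_pCons:
  assumes "c \<in> k0" "p \<in> P0" "a \<in> P0"
  shows "cls (pcompose (pCons c p) a) = cls (pcompose p a) \<otimes>\<^bsub>M\<^esub> cls a \<oplus>\<^bsub>M\<^esub> quot_emb n F c"
proof -
  have "pcompose (pCons c p) a = pcompose p a * a + [:c:]"
    by (simp add: pcompose_pCons add.commute mult.commute)
  thus ?thesis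
    using assms cls_add[of "pcompose p a * a" "[:c:]"] cls_mult[of "pcompose p a" a]
    by (simp add: quot_emb_cls P0_mult P0_pcompose P0_const)
qed

lemma subext_eq_simple_extension:
  assumes a: "a \<in> P0"
  shows "subext a = M.simple_extension (quot_emb n F ` k0) (cls a)"
proof
  have "cls (pcompose p a) \<in> M.simple_extension (quot_emb n F ` k0) (cls a)" if "p \<in> P0" for p
    using that
  proof (induction p rule: P0_induct)
    case zero
    show ?case by (simp add: cls_zero)
  next
    case (pCons c p)
    show ?case
      unfolding cls_pcompose_pCons[OF pCons.hyps a]
      by (rule M.simple_extension.lin) (use pCons in auto)
  qed
  thus "subext a \<subseteq> M.simple_extension (quot_emb n F ` k0) (cls a)" by (auto simp: subext_def)
  show "M.simple_extension (quot_emb n F ` k0) (cls a) \<subseteq> subext a"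
  proof
    fix y assume "y \<in> M.simple_extension (quot_emb n F ` k0) (cls a)"
    thus "y \<in> subext a"
    proof (induction rule: M.simple_extension.induct)
      case zero
      show ?case unfolding subext_def using P0_zero cls_zero by (intro image_eqI[of _ _ 0]) auto
    next
      case (lin y k)
      then obtain p c where p: "p \<in> P0" "y = cls (pcompose p a)" and c: "c \<in> k0" "k = quot_emb n F c"
        unfolding subext_def by blast
      have "y \<otimes>\<^bsub>M\<^esub> cls a \<oplus>\<^bsub>M\<^esub> k = cls (pcompose (pCons c p) a)"
        using p c a by (simp add: cls_pcompose_pCons)
      thus ?case using P0_pCons[OF c(1) p(1)] unfolding subext_def by blast
    qed
  qed
qed

lemma algebraic_cls:
  assumes a: "a \<in> P0"
  shows "(M.algebraic over (quot_emb n F ` k0)) (cls a)"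
  using ext M.finite_dimension_imp_algebraic[OF subfield_emb M.carrier_is_subring _ cls_carrier[OF a]]
  by (simp add: finite_nontrivial_ext_def)

lemma subfield_subext: "a \<in> P0 \<Longrightarrow> subfield (subext a) M"
  using M.simple_extension_is_subfield[OF subfield_emb cls_carrier[of a]] algebraic_cls[of a]
  by (simp add: subext_eq_simple_extension)

text \<open>
  Algebraicity over the image of \<open>\<rat>(X)\<close> is a statement about coefficient lists in the quotient; lifting
  the entries of such a list gives a nonzero polynomial over \<open>\<rat>(X)\<close>.
\<close>

lemma exists_relation:
  assumes a: "a \<in> P0"
  shows "\<exists>p\<in>P0. p \<noteq> 0 \<and> Fh dvd pcompose p a"
proof -
  let ?K = "quot_emb n F ` k0"
  have K: "?K \<subseteq> carrier M" by (auto simp: quot_emb_cls cls_carrier P0_const)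
  obtain l where l: "l \<in> carrier (univ_poly M ?K)" "l \<noteq> []" "M.eval l (cls a) = \<zero>\<^bsub>M\<^esub>"
    by (rule M.algebraicE[OF subfieldE(1)[OF subfield_emb] cls_carrier[OF a] algebraic_cls[OF a]])
  hence l': "set l \<subseteq> ?K" "hd l \<noteq> \<zero>\<^bsub>M\<^esub>"
    using l(2) unfolding univ_poly_carrier[symmetric] polynomial_def by simp_all
  have "set l \<subseteq> ?K \<Longrightarrow> \<exists>p\<in>P0. M.eval l (cls a) = cls (pcompose p a) \<and> (l \<noteq> [] \<longrightarrow> hd l \<noteq> \<zero>\<^bsub>M\<^esub> \<longrightarrow> p \<noteq> 0)" for l
  proof (induction l rule: rev_induct)
    case Nil
    show ?case using cls_zero by (intro bexI[OF _ P0_zero]) simp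
  next
    case (snoc b l)
    have sl: "set l \<subseteq> ?K" "b \<in> ?K" using snoc.prems by simp_all
    obtain p c where p: "p \<in> P0" "M.eval l (cls a) = cls (pcompose p a)" "l \<noteq> [] \<longrightarrow> hd l \<noteq> \<zero>\<^bsub>M\<^esub> \<longrightarrow> p \<noteq> 0"
      and c: "c \<in> k0" "b = quot_emb n F c"
    proof -
      obtain c where c: "c \<in> k0" "b = quot_emb n F c" using sl(2) by blast
      obtain p where "p \<in> P0" "M.eval l (cls a) = cls (pcompose p a)" "l \<noteq> [] \<longrightarrow> hd l \<noteq> \<zero>\<^bsub>M\<^esub> \<longrightarrow> p \<noteq> 0"
        using snoc.IH[OF sl(1)] by blast
      from that[OF this c] show ?thesis .
    qed
    have "M.eval (l @ [b]) (cls a) = M.eval l (cls a) \<otimes>\<^bsub>M\<^esub> cls a \<oplus>\<^bsub>M\<^esub> b"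
      by (rule M.eval_append_aux) (use sl K cls_carrier[OF a] in blast)+
    also have "\<dots> = cls (pcompose (pCons c p) a)"
      using p c a by (simp add: cls_pcompose_pCons)
    finally have 1: "M.eval (l @ [b]) (cls a) = cls (pcompose (pCons c p) a)" .
    have "pCons c p \<noteq> 0" if "hd (l @ [b]) \<noteq> \<zero>\<^bsub>M\<^esub>"
    proof (cases "l = []")
      case True
      have "c \<noteq> 0"
      proof
        assume "c = 0"
        hence "b = \<zero>\<^bsub>M\<^esub>" unfolding c(2) quot_emb_cls by (simp only: pCons_0_0 cls_zero)
        thus False using that True by simp
      qed
      thus ?thesis by simp
    next
      case False
      hence "p \<noteq> 0" using that p(3) by simp
      thus ?thesis by simp
    qed
    thus ?case by (intro bexI[OF _ P0_pCons[OF c(1) p(1)]] conjI 1 impI)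
  qed
  from this[OF l'(1)] obtain p where "p \<in> P0" "cls (pcompose p a) = \<zero>\<^bsub>M\<^esub>" "p \<noteq> 0"
    using l(2,3) l'(2) by metis
  thus ?thesis using a by (auto simp: cls_eq_zero_iff P0_pcompose)
qed

lemma minimal_relation:
  assumes a: "a \<in> P0"
  obtains P where "P \<in> P0" "lead_coeff P = 1" "Fh dvd pcompose P a"
    "\<And>p. p \<in> P0 \<Longrightarrow> Fh dvd pcompose p a \<Longrightarrow> P dvd p"
    "\<And>p. p \<in> P0 \<Longrightarrow> Fh dvd pcompose p a \<Longrightarrow> pdeg p < pdeg P \<Longrightarrow> p = 0"
proof -
  define rel where "rel = (\<lambda>p. p \<in> P0 \<and> p \<noteq> 0 \<and> Fh dvd pcompose p a)"
  have "\<exists>p. rel p" using exists_relation[OF a] unfolding rel_def by blast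
  then obtain Q where Q: "rel Q" "\<And>p. rel p \<Longrightarrow> pdeg Q \<le> pdeg p"
    using ex_has_least_nat[of rel _ pdeg] by blast
  define P where "P = Polynomial.smult (inverse (lead_coeff Q)) Q"
  have Qnz: "Q \<noteq> 0" and QP0: "Q \<in> P0" using Q(1) by (auto simp: rel_def)
  have P: "P \<in> P0" "lead_coeff P = 1" "Fh dvd pcompose P a" "pdeg P = pdeg Q" "P \<noteq> 0"
    using Q(1) P0_mult[OF P0_const[OF inverse_in] QP0, of "lead_coeff Q"] Qnz
    by (auto simp: P_def rel_def pcompose_smult dvd_smult P0_def)
  have small: "p = 0" if "p \<in> P0" "Fh dvd pcompose p a" "pdeg p < pdeg P" for p
    using Q(2)[of p] that P(4) unfolding rel_def by (metis not_le)
  have dvd: "P dvd p" if p: "p \<in> P0" "Fh dvd pcompose p a" for p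
  proof -
    have "pcompose p a = pcompose (p div P) a * pcompose P a + pcompose (p mod P) a"
      by (metis div_mult_mod_eq pcompose_add pcompose_mult)
    hence "Fh dvd pcompose (p mod P) a"
      using p(2) P(3) by (metis dvd_add_right_iff dvd_mult)
    hence "p mod P = 0"
      using small[OF P0_div_mod(2)[OF P(1,5) p(1)]] degree_mod_less'[OF P(5), of p] by blast
    thus ?thesis by (simp add: mod_eq_0_iff_dvd)
  qed
  show ?thesis by (rule that[OF P(1,2,3) dvd small])
qed

end

lemma common_denominator:
  assumes "finite J" "\<And>j. j \<in> J \<Longrightarrow> \<exists>a b. b \<noteq> 0 \<and> vars_in V a \<and> vars_in V b \<and> f j = Fract a b"
  shows "\<exists>v. v \<noteq> 0 \<and> vars_in V v \<and> (\<forall>j\<in>J. \<exists>u. vars_in V u \<and> f j = Fract u (v :: 'k::idom mpoly))"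
  using assms
proof (induction J rule: finite_induct)
  case empty
  show ?case by (intro exI[of _ 1]) simp
next
  case (insert i J)
  then obtain v where v: "v \<noteq> 0" "vars_in V v" "\<forall>j\<in>J. \<exists>u. vars_in V u \<and> f j = Fract u v" by blast
  obtain a b where ab: "b \<noteq> 0" "vars_in V a" "vars_in V b" "f i = Fract a b" using insert.prems by blast
  have "\<exists>u. vars_in V u \<and> f j = Fract u (v * b)" if j: "j \<in> insert i J" for j
  proof (cases "j = i")
    case True
    have "f j = Fract (a * v) (v * b)" using True ab v by (simp add: eq_fract)
    thus ?thesis using ab v vars_in_mult by blast
  next
    case False
    then obtain u where u: "vars_in V u" "f j = Fract u v" using v j by blast
    have "f j = Fract (u * b) (v * b)" using u ab v by (simp add: eq_fract)
    thus ?thesis using ab u vars_in_mult by blast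
  qed
  moreover have "v * b \<noteq> 0" "vars_in V (v * b)" using v ab by (auto intro: vars_in_mult)
  ultimately show ?case by blast
qed

section \<open>Constants of the derivation and closed forms\<close>

lemma degree_pderiv_le: "pdeg (pderiv p) \<le> pdeg p - 1"
  by (rule degree_le) (auto simp: coeff_pderiv coeff_eq_0)

context genuine_setting
begin

lemma subext_ring: "a \<in> P0 \<Longrightarrow> ring (M\<lparr>carrier := subext a\<rparr>)"
  using M.subring_is_ring[OF subfieldE(1)[OF subfield_subext]] .

lemma subext_hom:
  assumes a: "a \<in> P0"
  shows "ring_hom_ring (KX_Y n) (M\<lparr>carrier := subext a\<rparr>) (\<lambda>p. cls (pcompose p a))"
proof (rule ring_hom_ringI2[OF R.ring_axioms subext_ring[OF a]])
  show "(\<lambda>p. cls (pcompose p a)) \<in> ring_hom (KX_Y n) (M\<lparr>carrier := subext a\<rparr>)"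
    using a by (intro ring_hom_memI)
      (auto simp: carrier_R subext_def pcompose_mult pcompose_add cls_mult cls_add P0_pcompose cls_one pcompose_1)
qed

text \<open>
  Evaluation at \<open>a\<close> maps \<open>\<rat>(X)[Y]\<close> onto \<open>\<rat>(X)(a)\<close>, and its kernel is generated by the minimal
  polynomial \<open>P\<close>, or by any nonzero multiple \<open>c P\<close>. The factor \<open>c\<close> leaves room for clearing denominators.
\<close>

lemma subext_presented_by:
  assumes a: "a \<in> P0" and P: "P \<in> P0" "Fh dvd pcompose P a"
      "\<And>p. p \<in> P0 \<Longrightarrow> Fh dvd pcompose p a \<Longrightarrow> P dvd p" "P \<noteq> 0"
    and G: "to_KX_Y G = Polynomial.smult c P" "c \<in> k0" "c \<noteq> 0"
  shows "presented_by n (M\<lparr>carrier := subext a\<rparr>) (quot_emb n F) G"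
proof -
  let ?h = "\<lambda>p. cls (pcompose p a)"
  interpret h: ring_hom_ring "KX_Y n" "M\<lparr>carrier := subext a\<rparr>" ?h by (rule subext_hom[OF a])
  have ker: "a_kernel (KX_Y n) (M\<lparr>carrier := subext a\<rparr>) ?h = PIdl\<^bsub>KX_Y n\<^esub> (to_KX_Y G)"
  proof -
    have "a_kernel (KX_Y n) (M\<lparr>carrier := subext a\<rparr>) ?h = {p \<in> P0. Fh dvd pcompose p a}"
      unfolding a_kernel_def' carrier_R
    proof (intro Collect_cong conj_cong refl)
      fix p assume "p \<in> P0"
      from cls_eq_zero_iff[OF P0_pcompose[OF this a]]
      show "?h p = \<zero>\<^bsub>M\<lparr>carrier := subext a\<rparr>\<^esub> \<longleftrightarrow> Fh dvd pcompose p a" by simp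
    qed
    also have "\<dots> = {x \<otimes>\<^bsub>KX_Y n\<^esub> Polynomial.smult c P |x. x \<in> P0}"
    proof (intro equalityI subsetI)
      fix p assume "p \<in> {p \<in> P0. Fh dvd pcompose p a}"
      hence p: "p \<in> P0" "P dvd p" using P(3) by auto
      define x where "x = [:inverse c:] * (p div P)"
      have "x \<in> P0" unfolding x_def
        using P0_div_mod(1)[OF P(1,4) p(1)] G by (intro P0_mult P0_const inverse_in)
      moreover have "p = x \<otimes>\<^bsub>KX_Y n\<^esub> Polynomial.smult c P"
      proof -
        have "x \<otimes>\<^bsub>KX_Y n\<^esub> Polynomial.smult c P = Polynomial.smult (inverse c * c) (p div P * P)"
          by (simp add: x_def mult.commute)
        also have "\<dots> = p" using p(2) G(3) by simp
        finally show ?thesis ..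
      qed
      ultimately show "p \<in> {x \<otimes>\<^bsub>KX_Y n\<^esub> Polynomial.smult c P |x. x \<in> P0}" by blast
    next
      fix p assume "p \<in> {x \<otimes>\<^bsub>KX_Y n\<^esub> Polynomial.smult c P |x. x \<in> P0}"
      then obtain x where x: "x \<in> P0" "p = [:c:] * (x * P)" by auto
      have "p \<in> P0" unfolding x(2) by (intro P0_mult P0_const G x P)
      moreover have "Fh dvd pcompose p a"
        unfolding x(2) pcompose_mult using P(2) by (intro dvd_mult)
      ultimately show "p \<in> {p \<in> P0. Fh dvd pcompose p a}" by simp
    qed
    also have "\<dots> = PIdl\<^bsub>KX_Y n\<^esub> (to_KX_Y G)"
      unfolding cgenideal_def carrier_R G(1) by simp
    finally show ?thesis .
  qed
  have iso: "(\<lambda>S. the_elem (?h ` S)) \<in> ring_iso (quot_alg n G) (M\<lparr>carrier := subext a\<rparr>)"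
    unfolding quot_alg_def[of n G] ker[symmetric]
    by (rule h.FactRing_iso_set) (simp add: subext_def carrier_R)
  have "the_elem (?h ` (quot_emb n G c)) = quot_emb n F c" if "c \<in> k0" for c
  proof -
    have "the_elem (?h ` (quot_emb n G c)) = cls (pcompose [:c:] a)"
      unfolding quot_emb_def[of n G] ker[symmetric]
      by (rule h.the_elem_simp) (simp add: carrier_R P0_const that)
    thus ?thesis by (simp add: quot_emb_cls)
  qed
  thus ?thesis unfolding presented_by_def by (intro bexI[OF _ iso] ballI)
qed

text \<open>
  The derivation \<open>\<partial>\<^sub>Y F \<partial>\<^sub>X - \<partial>\<^sub>X F \<partial>\<^sub>Y\<close> annihilates \<open>F\<close>. It therefore descends to the quotient, where it
  is \<open>\<partial>\<^sub>Y F\<close> times the unique extension of \<open>\<partial>/\<partial>X\<^sub>1\<close>, so no derivation of the quotient has to be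
  constructed.
\<close>

definition \<delta> :: "rat mpoly fract poly \<Rightarrow> rat mpoly fract poly" where
  "\<delta> p = pderiv Fh * map_poly D1 p - map_poly D1 Fh * pderiv p"

lemma derivation_\<delta>: "derivation \<delta>"
proof -
  interpret derivation "map_poly D1 :: rat mpoly fract poly \<Rightarrow> _"
    by (rule derivation.derivation_map_poly[OF derivation_D1])
  show ?thesis by unfold_locales (simp_all add: \<delta>_def D_add D_mult pderiv_add pderiv_mult algebra_simps)
qed

lemma \<delta>_dvd: "Fh dvd p \<Longrightarrow> Fh dvd \<delta> p"
proof (elim dvdE)
  fix k assume "p = Fh * k"
  hence "\<delta> p = \<delta> Fh * k + Fh * \<delta> k" by (simp only: derivation.D_mult[OF derivation_\<delta>])
  also have "\<delta> Fh = 0" by (simp add: \<delta>_def)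
  finally show "Fh dvd \<delta> p" by simp
qed

lemma map_D1_const: "map_poly D1 [:c:] = [:D1 c:]"
  by (rule poly_eqI) (simp add: derivation.coeff_map_D[OF derivation_D1] coeff_pCons derivation.D_zero[OF derivation_D1] split: nat.split)

lemma map_D1_pCons: "map_poly D1 (pCons c p) = pCons (D1 c) (map_poly D1 p)"
  by (rule poly_eqI) (simp add: derivation.coeff_map_D[OF derivation_D1] coeff_pCons split: nat.split)

lemma \<delta>_pcompose: "\<delta> (pcompose P a) = pderiv Fh * pcompose (map_poly D1 P) a + pcompose (pderiv P) a * \<delta> a"
proof (induction P)
  case 0
  show ?case using derivation.D_zero[OF derivation_\<delta>] by simp
next
  case (pCons c P)
  have "\<delta> (pcompose (pCons c P) a) = \<delta> [:c:] + (\<delta> a * pcompose P a + a * \<delta> (pcompose P a))"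
    by (simp add: pcompose_pCons derivation.D_add[OF derivation_\<delta>] derivation.D_mult[OF derivation_\<delta>])
  also have "\<delta> [:c:] = pderiv Fh * [:D1 c:]"
    by (simp add: \<delta>_def map_D1_const pderiv_pCons)
  also have "\<delta> (pcompose P a) = pderiv Fh * pcompose (map_poly D1 P) a + pcompose (pderiv P) a * \<delta> a"
    by (rule pCons.IH)
  finally show ?case
    by (simp add: map_D1_pCons pcompose_pCons pderiv_pCons pcompose_add algebra_simps)
qed

lemma map_D1_P0: "p \<in> P0 \<Longrightarrow> map_poly D1 p \<in> P0"
  by (simp add: P0_def derivation.coeff_map_D[OF derivation_D1] D1_KX[OF n])

lemma degree_Fh_pos: "pdeg Fh \<ge> 1"
proof (rule ccontr)
  assume "\<not> ?thesis"
  hence "pdeg Fh = 0" by simp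
  then obtain c where "Fh = [:c:]" by (rule degree_eq_zeroE)
  moreover from this have "c = 1" using lc_Fh by simp
  ultimately have "Fh = 1" by (simp add: one_pCons)
  hence "cls 1 = \<zero>\<^bsub>M\<^esub>" by (simp add: cls_eq_zero_iff P0_one)
  thus False by (simp add: cls_one)
qed

lemma of_nat_fract_nz: "j \<noteq> 0 \<Longrightarrow> (of_nat j :: rat mpoly fract) \<noteq> 0"
  by (simp add: of_nat_fract Zero_fract_def eq_fract)

lemma not_dvd_small: "p \<noteq> 0 \<Longrightarrow> pdeg p < pdeg Fh \<Longrightarrow> \<not> Fh dvd p"
  by (auto dest: dvd_imp_degree_le)

lemma not_dvd_pderiv: "\<not> Fh dvd pderiv Fh"
proof (rule not_dvd_small)
  have "pcoeff (pderiv Fh) (pdeg Fh - 1) = of_nat (pdeg Fh) * lead_coeff Fh"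
    using degree_Fh_pos by (simp add: coeff_pderiv)
  thus "pderiv Fh \<noteq> 0"
    using of_nat_fract_nz[of "pdeg Fh"] degree_Fh_pos lc_Fh by auto
  show "pdeg (pderiv Fh) < pdeg Fh"
    using degree_Fh_pos degree_pderiv_le[of Fh] by linarith
qed

text \<open>
  Strong genuineness enters here. Applying \<open>\<delta>\<close> to the minimal relation \<open>P(a) \<equiv> 0\<close> of an element with
  \<open>\<delta> a \<equiv> 0\<close> gives the relation whose coefficients are the derivatives of those of \<open>P\<close>. Its degree is
  smaller since \<open>P\<close> is monic, so it is zero, and \<open>P\<close> has coefficients free of \<open>X\<^sub>1\<close>. Without
  denominators, \<open>P\<close> presents \<open>\<rat>(X)(a)\<close> by a polynomial of degree zero in \<open>X\<^sub>1\<close>; a subextension larger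
  than \<open>\<rat>(X)\<close> has no such presentation.
\<close>

lemma constant_imp_base:
  assumes a: "a \<in> P0" and const: "Fh dvd \<delta> a"
  shows "\<exists>c\<in>k0. Fh dvd a - [:c:]"
proof (rule ccontr)
  assume no: "\<not> ?thesis"
  obtain P where P: "P \<in> P0" "lead_coeff P = 1" "Fh dvd pcompose P a"
    "\<And>p. p \<in> P0 \<Longrightarrow> Fh dvd pcompose p a \<Longrightarrow> P dvd p"
    "\<And>p. p \<in> P0 \<Longrightarrow> Fh dvd pcompose p a \<Longrightarrow> pdeg p < pdeg P \<Longrightarrow> p = 0"
    using minimal_relation[OF a] by metis
  interpret D: derivation "D1 :: rat mpoly fract \<Rightarrow> _" by (rule derivation_D1)
  have "pderiv Fh * pcompose (map_poly D1 P) a = \<delta> (pcompose P a) - pcompose (pderiv P) a * \<delta> a"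
    by (simp add: \<delta>_pcompose)
  hence "Fh dvd pderiv Fh * pcompose (map_poly D1 P) a"
    using \<delta>_dvd[OF P(3)] const by simp
  hence DP: "Fh dvd pcompose (map_poly D1 P) a"
    by (rule prime_Fh[OF P0_pderiv[OF Fh_P0] not_dvd_pderiv])
  have "map_poly D1 P = 0"
  proof (rule ccontr)
    assume nz: "map_poly D1 P \<noteq> 0"
    have "pcoeff (map_poly D1 P) (pdeg P) = 0"
      by (simp add: D.coeff_map_D P(2) D.D_one)
    moreover have "pdeg (map_poly D1 P) \<le> pdeg P"
      by (rule degree_le) (simp add: D.coeff_map_D coeff_eq_0 D.D_zero)
    ultimately have "pdeg (map_poly D1 P) < pdeg P"
      using nz by (metis leading_coeff_0_iff le_neq_implies_less)
    thus False using P(5)[OF map_D1_P0[OF P(1)] DP] nz by blast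
  qed
  hence D0: "D1 (pcoeff P j) = 0" for j
    by (metis D.coeff_map_D coeff_0)
  have "\<exists>v. v \<noteq> 0 \<and> vars_in {2..n} v \<and> (\<forall>j\<in>{..pdeg P}. \<exists>u. vars_in {2..n} u \<and> pcoeff P j = Fract u v)"
    by (rule common_denominator) (use D0 P(1) in \<open>auto simp: P0_def intro!: D1_eq_0_imp_free\<close>)
  then obtain v u where v: "v \<noteq> 0" "vars_in {2..n} v"
    and u: "\<And>j. j \<le> pdeg P \<Longrightarrow> vars_in {2..n} (u j) \<and> pcoeff P j = Fract (u j) v"
    by (metis atMost_iff)
  define G where "G = (\<Sum>j\<le>pdeg P. Polynomial.monom (u j) j)"
  have coeff_G: "pcoeff G j = (if j \<le> pdeg P then u j else 0)" for j
    by (simp add: G_def coeff_sum)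
  have G: "to_KX_Y G = Polynomial.smult (Fract v 1) P"
  proof (rule poly_eqI)
    fix j
    show "pcoeff (to_KX_Y G) j = pcoeff (Polynomial.smult (Fract v 1) P) j"
      using u[of j] v(1) by (simp add: to_KX_Y_def coeff_map_poly fract_collapse coeff_G coeff_eq_0 eq_fract)
  qed
  have vG: "vars_in {2..n} (pcoeff G j)" for j using u by (simp add: coeff_G)
  have k0: "k0 = {Fract a b |a b. vars_in {1..n} a \<and> vars_in {1..n} b \<and> b \<noteq> 0}"
    by (simp add: KX_def in_vars_eq)
  have "vars_in {1..n} v" using vars_in_mono[OF _ v(2)] by auto
  moreover have "vars_in {1..n} (1 :: rat mpoly)" "(1 :: rat mpoly) \<noteq> 0" by auto
  ultimately have c: "Fract v 1 \<in> k0" unfolding k0 by blast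
  have "presented_by n (M\<lparr>carrier := subext a\<rparr>) (quot_emb n F) G"
  proof (rule subext_presented_by[OF a P(1,3,4) _ G c])
    show "P \<noteq> 0" using P(2) by auto
    show "Fract v 1 \<noteq> 0" using v by (simp add: Zero_fract_def eq_fract)
  qed
  moreover have "G \<in> polys_YX n"
    using vG vars_in_mono[of "{2..n}" "{1..n}"] by (auto simp: polys_YX_def in_vars_eq)
  moreover have "deg_X 1 G = 0"
  proof -
    have "(\<lambda>(j, m). lookup m 1) ` monomials G \<subseteq> {0}"
      using vG unfolding monomials_def vars_in_def by (fastforce simp: in_keys_iff)
    hence eq: "insert 0 ((\<lambda>(j, m). lookup m 1) ` monomials G) = {0}" by blast
    show ?thesis unfolding deg_X_def eq by simp
  qed
  moreover have "genuine_ext n (M\<lparr>carrier := subext a\<rparr>) (quot_emb n F)"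
  proof -
    have "quot_emb n F ` k0 \<subseteq> subext a"
    proof
      fix y assume "y \<in> quot_emb n F ` k0"
      then obtain c where c: "c \<in> k0" "y = cls (pcompose [:c:] a)" by (auto simp: quot_emb_cls)
      show "y \<in> subext a" unfolding subext_def c(2) by (rule imageI) (rule P0_const[OF c(1)])
    qed
    moreover have "cls a \<in> subext a"
    proof -
      have "cls (pcompose [:0, 1:] a) \<in> subext a"
        unfolding subext_def by (intro imageI P0_pCons P0_zero one_in zero_in)
      thus ?thesis by (simp add: pcompose_pCons)
    qed
    moreover have "cls a \<notin> quot_emb n F ` k0"
      using no a by (auto simp: quot_emb_cls cls_eq_iff P0_const)
    ultimately have "quot_emb n F ` k0 \<subset> subext a" by blast
    thus ?thesis using sg subfield_subext[OF a]
      unfolding strongly_genuine_poly_def strongly_genuine_ext_def by blast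
  qed
  ultimately show False using n unfolding genuine_ext_def by force
qed

text \<open>
  In the quotient put \<open>a = g / \<partial>\<^sub>Y F\<close>; closedness modulo \<open>F\<close> gives \<open>h = a \<partial>\<^sub>X F\<close>, and its derivative
  along \<open>Y\<close> gives \<open>\<delta> a = 0\<close>. Thus \<open>a\<close> is the class of a constant \<open>c\<close> and \<open>g - c \<partial>\<^sub>Y F\<close> is divisible by
  \<open>F\<close>, so it vanishes by its degree. The coefficient of \<open>g\<close> at \<open>Y^(d - 1)\<close> is both zero and \<open>c d\<close>.
\<close>

lemma closed_form_trivial:
  assumes gh: "g \<in> P0" "h \<in> P0"
    and closed: "Fh * (map_poly D1 g - pderiv h) = g * map_poly D1 Fh - h * pderiv Fh"
    and deg: "\<And>j. j \<ge> pdeg Fh - 1 \<Longrightarrow> pcoeff g j = 0"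
      "\<And>j. j \<ge> pdeg Fh \<Longrightarrow> pcoeff h j = 0"
  shows "g = 0" "h = 0"
proof -
  let ?Y = "pderiv Fh" and ?X = "map_poly D1 Fh"
  interpret DM: derivation "map_poly D1 :: rat mpoly fract poly \<Rightarrow> _"
    by (rule derivation.derivation_map_poly[OF derivation_D1])
  interpret d: derivation \<delta> by (rule derivation_\<delta>)
  obtain u where u: "u \<in> P0" "Fh dvd u * ?Y - 1"
    using inverse_mod[OF P0_pderiv[OF Fh_P0] not_dvd_pderiv] by blast
  define a where "a = g * u"
  have aP: "a \<in> P0" unfolding a_def by (intro P0_mult gh u)
  have 1: "Fh dvd a * ?Y - g"
  proof -
    have "a * ?Y - g = g * (u * ?Y - 1)" by (simp add: a_def algebra_simps)
    thus ?thesis using u(2) by simp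
  qed
  have 2: "Fh dvd h - a * ?X"
  proof (rule prime_Fh[OF P0_pderiv[OF Fh_P0] not_dvd_pderiv])
    have "?Y * (h - a * ?X) = - (g * ?X - h * ?Y) - (a * ?Y - g) * ?X" by (simp add: algebra_simps)
    also have "Fh dvd \<dots>" unfolding closed[symmetric] by (rule dvd_diff[OF _ dvd_mult2[OF 1]]) simp
    finally show "Fh dvd ?Y * (h - a * ?X)" .
  qed
  let ?XY = "pderiv ?X" and ?YY = "pderiv ?Y"
  have XY: "map_poly D1 ?Y = ?XY" by (rule map_D_pderiv[OF derivation_D1])
  define W where "W = map_poly D1 g - pderiv h"
  have dg: "\<delta> g = g * ?XY - h * ?YY - Fh * pderiv W"
  proof -
    have "pderiv (Fh * W) = pderiv (g * ?X - h * ?Y)" using closed by (simp only: W_def)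
    hence "Fh * pderiv W + W * ?Y = g * ?XY + ?X * pderiv g - (h * ?YY + ?Y * pderiv h)"
      by (simp only: pderiv_mult pderiv_diff)
    hence WY: "W * ?Y = g * ?XY + ?X * pderiv g - (h * ?YY + ?Y * pderiv h) - Fh * pderiv W"
      by (simp only: eq_diff_eq add.commute)
    have "\<delta> g = (W + pderiv h) * ?Y - ?X * pderiv g" by (simp add: \<delta>_def W_def mult.commute)
    also have "\<dots> = W * ?Y + pderiv h * ?Y - ?X * pderiv g" by (simp only: distrib_right)
    also have "\<dots> = g * ?XY - h * ?YY - Fh * pderiv W" unfolding WY by (simp add: mult.commute)
    finally show ?thesis .
  qed
  have "\<delta> a * ?Y = \<delta> (a * ?Y - g) + \<delta> g - a * \<delta> ?Y"
    by (simp add: d.D_diff d.D_mult)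
  also have "\<delta> ?Y = ?Y * ?XY - ?X * ?YY" by (simp add: \<delta>_def XY)
  also have "\<delta> (a * ?Y - g) + \<delta> g - a * (?Y * ?XY - ?X * ?YY) =
      \<delta> (a * ?Y - g) - (a * ?Y - g) * ?XY - (h - a * ?X) * ?YY - Fh * pderiv W"
    unfolding dg by (simp add: algebra_simps)
  also have "Fh dvd \<dots>" by (intro dvd_diff \<delta>_dvd[OF 1] dvd_mult2[OF 1] dvd_mult2[OF 2]) simp
  finally have "Fh dvd ?Y * \<delta> a" by (simp add: mult.commute)
  hence "Fh dvd \<delta> a" by (rule prime_Fh[OF P0_pderiv[OF Fh_P0] not_dvd_pderiv])
  then obtain c where c: "c \<in> k0" "Fh dvd a - [:c:]" using constant_imp_base[OF aP] by blast
  have "Fh dvd g - [:c:] * ?Y"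
  proof -
    have eq: "g - [:c:] * ?Y = (a - [:c:]) * ?Y - (a * ?Y - g)" by (simp only: left_diff_distrib) simp
    show ?thesis unfolding eq by (rule dvd_diff[OF dvd_mult2[OF c(2)] 1])
  qed
  moreover have "pdeg (g - [:c:] * ?Y) < pdeg Fh"
  proof -
    have "pdeg g \<le> pdeg Fh - 1"
      by (rule degree_le) (use deg(1) in auto)
    moreover have "pdeg ([:c:] * ?Y) \<le> pdeg Fh - 1"
      using degree_mult_le[of "[:c:]" ?Y] degree_pderiv_le[of Fh] by simp
    ultimately show ?thesis using degree_diff_le[of g "pdeg Fh - 1" "[:c:] * ?Y"] degree_Fh_pos by simp
  qed
  ultimately have "g - [:c:] * ?Y = 0" using not_dvd_small by blast
  hence gc: "g = [:c:] * ?Y" by (simp only: right_minus_eq)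
  have "0 = pcoeff g (pdeg Fh - 1)" using deg(1) by simp
  also have "\<dots> = c * of_nat (pdeg Fh)"
    unfolding gc using degree_Fh_pos lc_Fh by (simp add: coeff_pderiv)
  finally have "c = 0" using of_nat_fract_nz[of "pdeg Fh"] degree_Fh_pos by auto
  thus g0: "g = 0" using gc by simp
  have "Fh * (- pderiv h) = - (h * ?Y)" using closed unfolding g0 by (simp add: DM.D_zero)
  hence "?Y * h = Fh * pderiv h" by (simp add: mult.commute)
  hence "Fh dvd ?Y * h" by simp
  hence "Fh dvd h" by (rule prime_Fh[OF P0_pderiv[OF Fh_P0] not_dvd_pderiv])
  moreover have "pdeg h < pdeg Fh" if "h \<noteq> 0"
    using deg(2)[of "pdeg h"] that by (meson leading_coeff_0_iff not_le)
  ultimately show "h = 0" using not_dvd_small by blast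
qed

lemma squarefree_trivial:
  assumes "t \<in> P0" "s * Fh = t * pderiv Fh"
    and "\<And>j. j \<ge> pdeg Fh \<Longrightarrow> pcoeff t j = 0"
  shows "t = 0" "s = 0"
proof -
  have "pderiv Fh * t = Fh * s" using assms(2) by (simp add: mult.commute)
  hence "Fh dvd pderiv Fh * t" by simp
  hence "Fh dvd t" by (rule prime_Fh[OF P0_pderiv[OF Fh_P0] not_dvd_pderiv])
  moreover have "pdeg t < pdeg Fh" if "t \<noteq> 0"
    using assms(3)[of "pdeg t"] that by (meson leading_coeff_0_iff not_le)
  ultimately show "t = 0" using not_dvd_small by blast
  thus "s = 0" using assms(2) Fh_nz by simp
qed

end

section \<open>Evaluating integer polynomials in a ring\<close>

locale int_hom = cring R for R (structure) +
  fixes \<phi> :: "int \<Rightarrow> 'a"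
  assumes phi_closed: "\<phi> c \<in> carrier R"
    and phi_add: "\<phi> (b + c) = \<phi> b \<oplus> \<phi> c"
    and phi_mult: "\<phi> (b * c) = \<phi> b \<otimes> \<phi> c"
    and phi_one: "\<phi> 1 = \<one>"
begin

lemma phi_zero: "\<phi> 0 = \<zero>"
proof -
  have "\<phi> 0 \<oplus> \<phi> 0 = \<phi> 0" using phi_add[of 0 0] by simp
  thus ?thesis using phi_closed by (simp add: add.l_cancel_one)
qed

lemma phi_sum: "\<phi> (sum f A) = (\<Oplus>i\<in>A. \<phi> (f i))"
  by (induction A rule: infinite_finite_induct) (auto simp: phi_zero phi_add phi_closed)

lemma phi_prod: "\<phi> (prod f A) = (\<Otimes>i\<in>A. \<phi> (f i))"
  by (induction A rule: infinite_finite_induct) (auto simp: phi_one phi_mult phi_closed)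

lemma phi_power: "\<phi> (c ^ j) = \<phi> c [^] j"
  by (induction j) (auto simp: phi_one phi_mult phi_closed m_comm)

end

locale mpoly_eval = int_hom +
  fixes \<chi> :: "nat \<Rightarrow> 'a"
  assumes chi_closed: "\<chi> k \<in> carrier R"
begin

definition mon :: "(nat \<Rightarrow>\<^sub>0 nat) \<Rightarrow> 'a" where
  "mon m = (\<Otimes>k\<in>keys m. \<chi> k [^] lookup m k)"

definition ev :: "int mpoly \<Rightarrow> 'a" where
  "ev a = (\<Oplus>m\<in>keys a. \<phi> (lookup a m) \<otimes> mon m)"

lemma mon_closed: "mon m \<in> carrier R"
  unfolding mon_def by (intro finprod_closed) (auto intro: chi_closed)

lemma mon_superset:
  assumes "finite K" "keys m \<subseteq> K"
  shows "mon m = (\<Otimes>k\<in>K. \<chi> k [^] lookup m k)"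
  unfolding mon_def
  by (rule finprod_mono_neutral_cong_left) (use assms in \<open>auto simp: in_keys_iff chi_closed\<close>)

lemma mon_add: "mon (m + m') = mon m \<otimes> mon m'"
proof -
  let ?K = "keys m \<union> keys m'"
  have "mon (m + m') = (\<Otimes>k\<in>?K. \<chi> k [^] lookup (m + m') k)"
    by (rule mon_superset) (use keys_add[of m m'] in auto)
  also have "\<dots> = (\<Otimes>k\<in>?K. \<chi> k [^] lookup m k \<otimes> \<chi> k [^] lookup m' k)"
    by (intro finprod_cong') (auto simp: lookup_add nat_pow_mult chi_closed)
  also have "\<dots> = mon m \<otimes> mon m'"
    by (subst finprod_multf) (auto simp: mon_superset[of ?K] chi_closed)
  finally show ?thesis .
qed

lemma ev_closed: "ev a \<in> carrier R"
  unfolding ev_def by (intro finsum_closed) (auto intro: phi_closed mon_closed)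

lemma ev_superset:
  assumes "finite K" "keys a \<subseteq> K"
  shows "ev a = (\<Oplus>m\<in>K. \<phi> (lookup a m) \<otimes> mon m)"
  unfolding ev_def
  by (rule add.finprod_mono_neutral_cong_left)
    (use assms in \<open>auto simp: in_keys_iff phi_closed phi_zero mon_closed\<close>)

lemma ev_zero: "ev 0 = \<zero>"
  by (simp add: ev_def)

lemma ev_add: "ev (a + b) = ev a \<oplus> ev b"
proof -
  let ?K = "keys a \<union> keys b"
  have "ev (a + b) = (\<Oplus>m\<in>?K. \<phi> (lookup (a + b) m) \<otimes> mon m)"
    by (rule ev_superset) (use keys_add[of a b] in auto)
  also have "\<dots> = (\<Oplus>m\<in>?K. \<phi> (lookup a m) \<otimes> mon m \<oplus> \<phi> (lookup b m) \<otimes> mon m)"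
    by (intro finsum_cong') (auto simp: lookup_add phi_add phi_closed mon_closed l_distr)
  also have "\<dots> = ev a \<oplus> ev b"
    by (subst finsum_addf) (auto simp: ev_superset[of ?K] phi_closed mon_closed)
  finally show ?thesis .
qed

lemma ev_sum: "ev (sum f A) = (\<Oplus>i\<in>A. ev (f i))"
  by (induction A rule: infinite_finite_induct) (auto simp: ev_zero ev_add ev_closed)

lemma ev_single: "ev (single m c) = \<phi> c \<otimes> mon m"
  by (cases "c = 0") (auto simp: ev_def phi_zero phi_closed mon_closed)

lemma ev_mult: "ev (a * b) = ev a \<otimes> ev b"
proof -
  have "ev (a * b) = (\<Oplus>m\<in>keys a. \<Oplus>m'\<in>keys b.
     (\<phi> (lookup a m) \<otimes> mon m) \<otimes> (\<phi> (lookup b m') \<otimes> mon m'))"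
    unfolding mult_eq_sum_single ev_sum ev_single
    by (intro finsum_cong' refl) (auto simp: phi_mult mon_add phi_closed mon_closed m_ac)
  also have "\<dots> = (\<Oplus>m\<in>keys a. (\<phi> (lookup a m) \<otimes> mon m) \<otimes> ev b)"
    unfolding ev_def by (intro finsum_cong' refl) (auto simp: finsum_rdistr phi_closed mon_closed)
  also have "\<dots> = ev a \<otimes> ev b"
    unfolding ev_def[of a] by (subst finsum_ldistr) (auto simp: phi_closed mon_closed ev_closed)
  finally show ?thesis .
qed

lemma ev_of_int: "ev (of_int c) = \<phi> c"
proof -
  have "(of_int c :: int mpoly) = single 0 c"
    by (rule poly_mapping_eqI) (simp add: lookup_of_int lookup_single)
  thus ?thesis by (simp add: ev_single mon_def phi_closed)
qed

lemma ev_var: "ev (single (single k 1) 1) = \<chi> k"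
  by (simp add: ev_single mon_def phi_one chi_closed)

lemma ev_minus: "ev a = ev b \<Longrightarrow> ev (a - b) = \<zero>"
proof -
  assume *: "ev a = ev b"
  have "ev a = ev (a - b) \<oplus> ev b" using ev_add[of "a - b" b] by simp
  thus ?thesis using * ev_closed by (metis add.l_cancel_one' add.m_comm)
qed

end

lemma (in mpoly_eval) prime_ideal_ev:
  assumes "domain R"
  shows "prime_ideal {a. ev a = \<zero>}"
proof -
  interpret domain R by fact
  have "ev a \<in> carrier R" for a by (rule ev_closed)
  thus ?thesis unfolding prime_ideal_def
    using ev_zero by (auto simp: ev_add ev_mult integral_iff)
qed

section \<open>Factorisations over a field\<close>

lemma UP_coeff_closed: "f \<in> carrier (UP R) \<Longrightarrow> f i \<in> carrier R"
  by (auto simp: UP_def up_def)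

lemma UP_zero_apply: "\<zero>\<^bsub>UP R\<^esub> j = \<zero>\<^bsub>R\<^esub>"
  by (simp add: UP_def)

lemma UP_add_apply:
  "p \<in> carrier (UP R) \<Longrightarrow> q \<in> carrier (UP R) \<Longrightarrow> (p \<oplus>\<^bsub>UP R\<^esub> q) j = p j \<oplus>\<^bsub>R\<^esub> q j"
  by (simp add: UP_def)

lemma UP_mult_apply:
  "p \<in> carrier (UP R) \<Longrightarrow> q \<in> carrier (UP R) \<Longrightarrow>
    (p \<otimes>\<^bsub>UP R\<^esub> q) j = (\<Oplus>\<^bsub>R\<^esub>i\<in>{..j}. p i \<otimes>\<^bsub>R\<^esub> q (j - i))"
  by (simp add: UP_def)

lemma UP_eventually_zero: "f \<in> carrier (UP R) \<Longrightarrow> \<exists>N. \<forall>i>N. f i = \<zero>\<^bsub>R\<^esub>"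
  by (auto simp: UP_def up_def bound_def)

lemma UP_UP_support:
  assumes "f \<in> carrier (UP (UP R))"
  shows "\<exists>N. \<forall>i j. f i j \<noteq> \<zero>\<^bsub>R\<^esub> \<longrightarrow> i \<le> N \<and> j \<le> (N :: nat)"
proof -
  obtain M where M: "\<And>i. i > M \<Longrightarrow> f i = \<zero>\<^bsub>UP R\<^esub>"
    using UP_eventually_zero[OF assms] by blast
  have "\<exists>K. \<forall>j>K. f i j = \<zero>\<^bsub>R\<^esub>" for i
    by (rule UP_eventually_zero) (rule UP_coeff_closed[OF assms])
  then obtain K where K: "\<And>i j. j > K i \<Longrightarrow> f i j = \<zero>\<^bsub>R\<^esub>" by metis
  define N where "N = Max (insert M (K ` {..M}))"
  have "i \<le> N \<and> j \<le> N" if nz: "f i j \<noteq> \<zero>\<^bsub>R\<^esub>" for i j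
  proof -
    have i: "i \<le> M"
    proof (rule ccontr)
      assume "\<not> i \<le> M"
      hence "f i = \<zero>\<^bsub>UP R\<^esub>" using M by simp
      thus False using nz UP_zero_apply by metis
    qed
    have "j \<le> K i" using nz K[of i j] by (meson not_le)
    also have "K i \<le> N" unfolding N_def using i by (intro Max_ge) auto
    finally have "j \<le> N" .
    moreover have "M \<le> N" unfolding N_def by (intro Max_ge) auto
    ultimately show ?thesis using i by simp
  qed
  thus ?thesis by blast
qed

lemma cring_UP: "cring R \<Longrightarrow> cring (UP R)"
proof -
  assume "cring R"
  then interpret UP_cring R "UP R" by (intro UP_cring.intro) simp
  show ?thesis by (rule UP_cring)
qed

lemma UP_finsum_apply:
  assumes R: "cring R" and A: "finite A" "\<And>a. a \<in> A \<Longrightarrow> f a \<in> carrier (UP R)"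
  shows "(\<Oplus>\<^bsub>UP R\<^esub>a\<in>A. f a) j = (\<Oplus>\<^bsub>R\<^esub>a\<in>A. f a j)"
proof -
  interpret R: cring R by (rule R)
  interpret U: cring "UP R" by (rule cring_UP[OF R])
  show ?thesis using A
  proof (induction A rule: finite_induct)
    case empty
    show ?case by (simp add: UP_zero_apply)
  next
    case (insert a A)
    have f: "f \<in> A \<rightarrow> carrier (UP R)" "f a \<in> carrier (UP R)" using insert.prems by auto
    have "(\<Oplus>\<^bsub>UP R\<^esub>a\<in>insert a A. f a) j = (f a \<oplus>\<^bsub>UP R\<^esub> (\<Oplus>\<^bsub>UP R\<^esub>a\<in>A. f a)) j"
      using U.finsum_insert[OF insert.hyps f] by (rule fun_cong)
    also have "\<dots> = f a j \<oplus>\<^bsub>R\<^esub> (\<Oplus>\<^bsub>UP R\<^esub>a\<in>A. f a) j"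
      by (rule UP_add_apply[OF f(2) U.finsum_closed[OF f(1)]])
    also have "\<dots> = f a j \<oplus>\<^bsub>R\<^esub> (\<Oplus>\<^bsub>R\<^esub>a\<in>A. f a j)"
      using insert.IH insert.prems by simp
    also have "\<dots> = (\<Oplus>\<^bsub>R\<^esub>a\<in>insert a A. f a j)"
      using insert.prems by (intro R.finsum_insert[OF insert.hyps, symmetric]) (auto intro: UP_coeff_closed)
    finally show ?case .
  qed
qed

lemma UP_UP_mult_apply:
  assumes R: "cring R" and fg: "f \<in> carrier (UP (UP R))" "g \<in> carrier (UP (UP R))"
  shows "(f \<otimes>\<^bsub>UP (UP R)\<^esub> g) i j =
     (\<Oplus>\<^bsub>R\<^esub>a\<in>{..i}. \<Oplus>\<^bsub>R\<^esub>b\<in>{..j}. f a b \<otimes>\<^bsub>R\<^esub> g (i - a) (j - b))"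
proof -
  interpret U: cring "UP R" by (rule cring_UP[OF R])
  have f: "f a \<in> carrier (UP R)" and g: "g a \<in> carrier (UP R)" for a
    using fg UP_coeff_closed by blast+
  have "(f \<otimes>\<^bsub>UP (UP R)\<^esub> g) i j = (\<Oplus>\<^bsub>UP R\<^esub>a\<in>{..i}. f a \<otimes>\<^bsub>UP R\<^esub> g (i - a)) j"
    using UP_mult_apply[OF fg] by (rule fun_cong)
  also have "\<dots> = (\<Oplus>\<^bsub>R\<^esub>a\<in>{..i}. (f a \<otimes>\<^bsub>UP R\<^esub> g (i - a)) j)"
    by (rule UP_finsum_apply[OF R]) (simp_all add: f g)
  also have "(\<lambda>a. (f a \<otimes>\<^bsub>UP R\<^esub> g (i - a)) j) = (\<lambda>a. \<Oplus>\<^bsub>R\<^esub>b\<in>{..j}. f a b \<otimes>\<^bsub>R\<^esub> g (i - a) (j - b))"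
    by (rule ext) (rule UP_mult_apply[OF f g])
  finally show ?thesis .
qed

definition bipoly :: "nat \<Rightarrow> (nat \<Rightarrow> nat \<Rightarrow> 'a::comm_ring_1) \<Rightarrow> 'a poly poly" where
  "bipoly N c = (\<Sum>i\<le>N. Polynomial.monom (\<Sum>j\<le>N. Polynomial.monom (c i j) j) i)"

lemma coeff_bipoly:
  "coeff2 (bipoly N c) i j = (if i \<le> N \<and> j \<le> N then c i j else 0)"
  by (simp add: bipoly_def coeff_sum)

text \<open>
  Degrees in the inner variable add up: choose in both factors, among the coefficients of maximal inner
  degree, the one with the largest outer degree. The product of these two terms meets no other
  contribution. The exact coefficient of the product is recorded because it has to be
  mapped to \<open>L\<close> afterwards.
\<close>

lemma X_degree_mult_witness:
  fixes p q :: "'a::idom poly poly"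
  assumes "p \<noteq> 0" "q \<noteq> 0"
  obtains \<beta> \<gamma> a b where "\<And>i. pdeg (pcoeff p i) \<le> \<beta>"
    "\<And>i. pdeg (pcoeff q i) \<le> \<gamma>"
    "coeff2 p a \<beta> \<noteq> 0" "coeff2 q b \<gamma> \<noteq> 0"
    "coeff2 (p * q) (a + b) (\<beta> + \<gamma>) =
       coeff2 p a \<beta> * coeff2 q b \<gamma>"
proof -
  have ex: "\<exists>\<beta> a. (\<forall>i. pdeg (pcoeff p i) \<le> \<beta>) \<and> coeff2 p a \<beta> \<noteq> 0 \<and>
      (\<forall>i>a. coeff2 p i \<beta> = 0)" if "p \<noteq> 0" for p :: "'a poly poly"
  proof -
    let ?deg = "\<lambda>i. pdeg (pcoeff p i)"
    define \<beta> where "\<beta> = Max (?deg ` {..pdeg p})"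
    have le: "?deg i \<le> \<beta>" for i
    proof (cases "i \<le> pdeg p")
      case True
      thus ?thesis unfolding \<beta>_def by (intro Max_ge) auto
    qed (simp add: coeff_eq_0)
    define S where "S = {i. coeff2 p i \<beta> \<noteq> 0}"
    have "S \<subseteq> {..pdeg p}"
    proof
      fix i assume "i \<in> S"
      hence "pcoeff p i \<noteq> 0" by (auto simp: S_def)
      thus "i \<in> {..pdeg p}" by (simp add: le_degree)
    qed
    hence fin: "finite S" by (rule finite_subset) simp
    have "\<beta> \<in> ?deg ` {..pdeg p}" unfolding \<beta>_def by (intro Max_in) auto
    then obtain i0 where i0: "?deg i0 = \<beta>" by auto
    have "S \<noteq> {}"
    proof (cases "pcoeff p i0 = 0")
      case True
      hence "\<beta> = 0" using i0 by simp
      hence "?deg (pdeg p) = 0" using le[of "pdeg p"] by simp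
      hence "pcoeff (lead_coeff p) \<beta> \<noteq> 0"
        using that \<open>\<beta> = 0\<close> leading_coeff_0_iff[of "lead_coeff p"] by simp
      hence "pdeg p \<in> S" by (simp only: S_def mem_Collect_eq not_False_eq_True)
      thus ?thesis by blast
    next
      case False
      hence "coeff2 p i0 \<beta> \<noteq> 0"
        using leading_coeff_0_iff[of "pcoeff p i0"] by (simp only: i0 not_False_eq_True)
      hence "i0 \<in> S" by (simp only: S_def mem_Collect_eq not_False_eq_True)
      thus ?thesis by blast
    qed
    hence "Max S \<in> S" using fin by (intro Max_in)
    hence 1: "coeff2 p (Max S) \<beta> \<noteq> 0" by (simp only: S_def mem_Collect_eq not_False_eq_True)
    have 2: "coeff2 p i \<beta> = 0" if "i > Max S" for i
    proof (rule ccontr)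
      assume "coeff2 p i \<beta> \<noteq> 0"
      hence "i \<in> S" by (simp only: S_def mem_Collect_eq not_False_eq_True)
      thus False using Max_ge[OF fin] that by (meson not_le)
    qed
    show ?thesis by (rule exI[of _ \<beta>], rule exI[of _ "Max S"]) (use le 1 2 in blast)
  qed
  obtain \<beta> a where p: "\<And>i. pdeg (pcoeff p i) \<le> \<beta>" "coeff2 p a \<beta> \<noteq> 0"
      "\<And>i. i > a \<Longrightarrow> coeff2 p i \<beta> = 0" using ex[OF assms(1)] by blast
  obtain \<gamma> b where q: "\<And>i. pdeg (pcoeff q i) \<le> \<gamma>" "coeff2 q b \<gamma> \<noteq> 0"
      "\<And>i. i > b \<Longrightarrow> coeff2 q i \<gamma> = 0" using ex[OF assms(2)] by blast
  have top: "pcoeff (r * s) (\<beta> + \<gamma>) = pcoeff r \<beta> * pcoeff s \<gamma>"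
    if "pdeg r \<le> \<beta>" "pdeg s \<le> \<gamma>" for r s :: "'a poly"
  proof -
    have "pcoeff (r * s) (\<beta> + \<gamma>) = (\<Sum>i\<le>\<beta> + \<gamma>. pcoeff r i * pcoeff s (\<beta> + \<gamma> - i))"
      by (rule coeff_mult)
    also have "\<dots> = (\<Sum>i\<in>{\<beta>}. pcoeff r i * pcoeff s (\<beta> + \<gamma> - i))"
    proof (rule sum.mono_neutral_right)
      show "\<forall>i\<in>{..\<beta> + \<gamma>} - {\<beta>}. pcoeff r i * pcoeff s (\<beta> + \<gamma> - i) = 0"
      proof
        fix i assume i: "i \<in> {..\<beta> + \<gamma>} - {\<beta>}"
        show "pcoeff r i * pcoeff s (\<beta> + \<gamma> - i) = 0"
          using that i by (cases "i < \<beta>") (auto simp: coeff_eq_0)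
      qed
    qed auto
    finally show ?thesis by simp
  qed
  have "coeff2 (p * q) (a + b) (\<beta> + \<gamma>) =
     (\<Sum>i\<le>a + b. coeff2 p i \<beta> * coeff2 q (a + b - i) \<gamma>)"
    by (simp add: coeff_mult[of p q] coeff_sum top[OF p(1) q(1)])
  also have "\<dots> = (\<Sum>i\<in>{a}. coeff2 p i \<beta> * coeff2 q (a + b - i) \<gamma>)"
  proof (rule sum.mono_neutral_right)
    show "\<forall>i\<in>{..a + b} - {a}. coeff2 p i \<beta> * coeff2 q (a + b - i) \<gamma> = 0"
    proof
      fix i assume i: "i \<in> {..a + b} - {a}"
      show "coeff2 p i \<beta> * coeff2 q (a + b - i) \<gamma> = 0"
        using p(3)[of i] q(3)[of "a + b - i"] i by (cases "i < a") auto
    qed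
  qed auto
  also have "\<dots> = coeff2 p a \<beta> * coeff2 q b \<gamma>"
    by simp
  finally show ?thesis by (rule that[OF p(1) q(1) p(2) q(2)])
qed

definition bivariate :: "'k::idom mpoly poly \<Rightarrow> 'k mpoly poly poly" where
  "bivariate F = map_poly isolate1 F"

lemma coeff_bivariate: "pcoeff (bivariate F) i = isolate1 (pcoeff F i)"
  unfolding bivariate_def by (rule rhom.coeff_map[OF rhom_isolate1])

lemma eval_at_sum: "eval_at x (sum f A) = (\<Sum>i\<in>A. eval_at x (f i))"
  by (rule rhom.hom_sum[OF rhom_eval_at])

lemma eval_at_single: "eval_at x (single m c) = c * monom_val x m"
  unfolding eval_at_def by (rule lin_ext_single) simp

lemma specialize_eq:
  fixes R :: "'a ring" (structure)
  assumes hom: "int_hom R \<phi>" and F: "F \<in> polys_YX n"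
  shows "specialize R \<phi> n F (\<lambda>k. \<phi> (x k)) i j =
    \<phi> (eval_at x (coeff2 (bivariate F) i j))"
proof -
  interpret int_hom R \<phi> by (rule hom)
  let ?S = "{m \<in> keys (pcoeff F i). lookup m 1 = j}"
  have mv: "monom_val x (drop1 m) = (\<Prod>k\<in>{2..n}. x k ^ lookup m k)" if "m \<in> ?S" for m
  proof -
    have "keys m \<subseteq> {1..n}"
      using F that by (auto simp: polys_YX_def in_vars_def)
    hence "keys (drop1 m) \<subseteq> {2..n}" by (auto simp: keys_drop1 subset_iff)
    hence "monom_val x (drop1 m) = (\<Prod>k\<in>{2..n}. x k ^ lookup (drop1 m) k)"
      by (intro monom_val_superset) auto
    also have "\<dots> = (\<Prod>k\<in>{2..n}. x k ^ lookup m k)"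
      by (intro prod.cong) (auto simp: lookup_drop1)
    finally show ?thesis .
  qed
  have "\<phi> (eval_at x (coeff2 (bivariate F) i j)) =
      \<phi> (\<Sum>m\<in>?S. lookup (pcoeff F i) m * monom_val x (drop1 m))"
    by (simp add: coeff_bivariate coeff_isolate1 eval_at_sum eval_at_single)
  also have "\<dots> = (\<Oplus>m\<in>?S. \<phi> (lookup (pcoeff F i) m * monom_val x (drop1 m)))"
    by (rule phi_sum)
  also have "\<dots> = (\<Oplus>m\<in>?S. \<phi> (lookup (pcoeff F i) m) \<otimes>
      (\<Otimes>k\<in>{2..n}. \<phi> (x k) [^] lookup m k))"
  proof (intro finsum_cong' refl)
    fix m assume "m \<in> ?S"
    show "\<phi> (lookup (pcoeff F i) m * monom_val x (drop1 m)) =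
      \<phi> (lookup (pcoeff F i) m) \<otimes> (\<Otimes>k\<in>{2..n}. \<phi> (x k) [^] lookup m k)"
      unfolding mv[OF \<open>m \<in> ?S\<close>] phi_mult phi_prod by (simp add: phi_power)
  qed (auto intro!: m_closed finprod_closed phi_closed)
  finally show ?thesis unfolding specialize_def by simp
qed

text \<open>
  The coefficients of the two factors become values of independent variables under an evaluation map
  onto a subring of \<open>L\<close>. The lifted factors have the same supports as the given ones, so their degrees
  may be computed in \<^typ>\<open>int mpoly poly poly\<close>. As the product is monic in \<open>Y\<close>, both leading
  coefficients are constants, and the condition on total degrees says that both factors have positive
  degree in \<open>Y\<close>.
\<close>

lemma factorisation_over_field_gives_kernel_vector:
  fixes L :: "'b ring" and \<psi> :: "int \<Rightarrow> 'b" and G :: "int poly poly"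
  assumes L: "field L" and hom: "int_hom L \<psi>"
    and P: "P \<in> carrier (UP (UP L))" and Q: "Q \<in> carrier (UP (UP L))"
    and PQ: "(\<lambda>i j. \<psi> (coeff2 G i j)) = P \<otimes>\<^bsub>UP (UP L)\<^esub> Q"
    and degP: "1 \<le> total_deg2 L P" "total_deg2 L P < total_deg2 L (P \<otimes>\<^bsub>UP (UP L)\<^esub> Q)"
    and monic: "lead_coeff G = 1" and d: "d = pdeg G" "d \<le> D"
    and degX: "\<And>i. pdeg (pcoeff G i) \<le> D"
    and char: "\<And>j. 1 \<le> j \<Longrightarrow> j \<le> D \<Longrightarrow> \<psi> (int j) \<noteq> \<zero>\<^bsub>L\<^esub>"
  obtains Z w where "prime_ideal Z" "\<And>c. of_int c \<in> Z \<Longrightarrow> \<psi> c = \<zero>\<^bsub>L\<^esub>"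
    "\<And>r. (\<Sum>c\<in>unknowns d D. entry (map_poly (map_poly of_int) G) r c * w c) \<in> Z"
    "\<exists>c\<in>unknowns d D. w c \<notin> (Z :: int mpoly set)"
proof -
  interpret L: field L by (rule L)
  interpret int_hom L \<psi> by (rule hom)
  define f where "f = P \<otimes>\<^bsub>UP (UP L)\<^esub> Q"
  have f: "f i j = \<psi> (coeff2 G i j)" for i j
    using fun_cong[OF fun_cong[OF PQ, of i], of j] by (simp add: f_def)
  have Pc: "P i j \<in> carrier L" and Qc: "Q i j \<in> carrier L" for i j
    using P Q by (auto intro!: UP_coeff_closed)
  obtain N1 where N1: "\<And>i j. P i j \<noteq> \<zero>\<^bsub>L\<^esub> \<Longrightarrow> i \<le> N1 \<and> j \<le> N1" using UP_UP_support[OF P] by blast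
  obtain N2 where N2: "\<And>i j. Q i j \<noteq> \<zero>\<^bsub>L\<^esub> \<Longrightarrow> i \<le> N2 \<and> j \<le> N2" using UP_UP_support[OF Q] by blast
  define v where "v = (\<lambda>k. single (single (k::nat) (1::nat)) (1::int))"
  have v_nz: "v k \<noteq> 0" for k
    unfolding v_def by (metis lookup_single_eq lookup_zero zero_neq_one)
  \<comment> \<open>one variable for each coefficient of the two factors: even indices for the first, odd ones for the second\<close>
  define \<chi> where "\<chi> = (\<lambda>k::nat. if even k then P (fst (prod_decode (k div 2))) (snd (prod_decode (k div 2)))
     else Q (fst (prod_decode (k div 2))) (snd (prod_decode (k div 2))))"
  define p where "p = bipoly N1 (\<lambda>i j. if P i j = \<zero>\<^bsub>L\<^esub> then 0 else v (2 * prod_encode (i, j)))"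
  define q where "q = bipoly N2 (\<lambda>i j. if Q i j = \<zero>\<^bsub>L\<^esub> then 0 else v (2 * prod_encode (i, j) + 1))"
  interpret mpoly_eval L \<psi> \<chi>
    by unfold_locales (simp add: \<chi>_def Pc Qc)
  have \<chi>_val: "\<chi> (2 * prod_encode (i, j)) = P i j" "\<chi> (2 * prod_encode (i, j) + 1) = Q i j" for i j
    by (simp_all add: \<chi>_def prod_encode_inverse)
  have ev_v: "ev (v k) = \<chi> k" for k by (simp only: v_def ev_var)
  have p_zero: "coeff2 p i j = 0 \<longleftrightarrow> P i j = \<zero>\<^bsub>L\<^esub>" for i j
    using N1[of i j] v_nz by (auto simp: p_def coeff_bipoly)
  have q_zero: "coeff2 q i j = 0 \<longleftrightarrow> Q i j = \<zero>\<^bsub>L\<^esub>" for i j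
    using N2[of i j] v_nz by (auto simp: q_def coeff_bipoly)
  have ev_p: "ev (coeff2 p i j) = P i j" for i j
    using N1[of i j] by (auto simp: p_def coeff_bipoly ev_zero ev_v \<chi>_val)
  have ev_q: "ev (coeff2 q i j) = Q i j" for i j
    using N2[of i j] by (auto simp: q_def coeff_bipoly ev_zero ev_v \<chi>_val(2) simp del: One_nat_def)
  have ev_pq: "ev (coeff2 (p * q) i j) = f i j" for i j
    unfolding f_def UP_UP_mult_apply[OF L.is_cring P Q]
    by (simp add: coeff_mult coeff_sum ev_sum ev_mult ev_p ev_q)
  have nz: "coeff2 (p * q) i j \<noteq> 0" if "f i j \<noteq> \<zero>\<^bsub>L\<^esub>" for i j
    using that ev_pq[of i j] ev_zero by auto
  have f_supp: "i \<le> d \<and> j \<le> D" if "f i j \<noteq> \<zero>\<^bsub>L\<^esub>" for i j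
  proof -
    have "coeff2 G i j \<noteq> 0" using that phi_zero unfolding f by metis
    moreover from this have "pcoeff G i \<noteq> 0" by auto
    ultimately show ?thesis using le_degree[of G i] le_degree[of "pcoeff G i" j] degX[of i] d by auto
  qed
  have f_top: "f d j = (if j = 0 then \<one>\<^bsub>L\<^esub> else \<zero>\<^bsub>L\<^esub>)" for j
    unfolding f using monic d by (auto simp: phi_one phi_zero)
  have pq_nz: "p * q \<noteq> 0" using nz[of d 0] f_top[of 0] by auto
  hence p_nz: "p \<noteq> 0" and q_nz: "q \<noteq> 0" by auto
  let ?a = "pdeg p" and ?c = "pdeg q"
  let ?b = "pdeg (lead_coeff p)" and ?e = "pdeg (lead_coeff q)"
  have f_prod: "f i j \<noteq> \<zero>\<^bsub>L\<^esub>" if "coeff2 (p * q) i j =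
     coeff2 p i1 j1 * coeff2 q i2 j2"
     "coeff2 p i1 j1 \<noteq> 0" "coeff2 q i2 j2 \<noteq> 0" for i j i1 j1 i2 j2
    using that ev_pq[of i j] by (simp add: ev_mult ev_p ev_q p_zero q_zero L.integral_iff Pc Qc flip: ev_pq)
  have "coeff2 (p * q) (?a + ?c) (?b + ?e) =
     pcoeff (lead_coeff p) ?b * pcoeff (lead_coeff q) ?e"
    by (simp only: coeff_mult_degree_sum)
  hence top: "f (?a + ?c) (?b + ?e) \<noteq> \<zero>\<^bsub>L\<^esub>"
    by (rule f_prod) (use p_nz q_nz in auto)
  have "pcoeff (p * q) d \<noteq> 0" using nz[of d 0] f_top[of 0] by auto
  hence "d \<le> ?a + ?c" using le_degree[of "p * q" d] degree_mult_eq[OF p_nz q_nz] by simp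
  with f_supp[OF top] have ac: "?a + ?c = d" by simp
  have be: "?b = 0 \<and> ?e = 0" using top f_top[of "?b + ?e"] unfolding ac by (cases "?b + ?e = 0") auto
  obtain u where u: "lead_coeff p = [:u:]" using be degree_eq_zeroE by blast
  obtain v' where v': "lead_coeff q = [:v':]" using be degree_eq_zeroE by blast
  have v'_nz: "v' \<noteq> 0" using v' q_nz by auto
  have ev_v': "ev v' = Q ?c 0" "Q ?c 0 \<noteq> \<zero>\<^bsub>L\<^esub>"
    using ev_q[of ?c 0] q_zero[of ?c 0] v' v'_nz by auto
  define Z where "Z = {a. ev a = \<zero>\<^bsub>L\<^esub>}"
  have Z: "prime_ideal Z" unfolding Z_def by (rule prime_ideal_ev[OF L.domain_axioms])
  have a1: "?a \<ge> 1"
  proof (rule ccontr)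
    assume "\<not> ?a \<ge> 1"
    hence a0: "?a = 0" by simp
    have "i + j = 0" if "P i j \<noteq> \<zero>\<^bsub>L\<^esub>" for i j
    proof -
      have n0: "coeff2 p i j \<noteq> 0" using that p_zero by blast
      hence "i \<le> ?a" by (intro le_degree) auto
      hence i: "i = 0" using a0 by simp
      have "j \<le> pdeg (pcoeff p i)" using n0 by (rule le_degree)
      also have "\<dots> = 0" using be a0 i by simp
      finally show ?thesis using i by simp
    qed
    hence eq: "insert 0 {i + j |i j. P i j \<noteq> \<zero>\<^bsub>L\<^esub>} = {0}" by blast
    have "total_deg2 L P = 0" unfolding total_deg2_def eq by simp
    thus False using degP by simp
  qed
  have c1: "?c \<ge> 1"
  proof (rule ccontr)
    assume "\<not> ?c \<ge> 1"
    hence c0: "?c = 0" by simp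
    have q: "q = [:[:v':]:]" using v' c0 by (metis degree_eq_zeroE coeff_pCons_0)
    have "f i j \<noteq> \<zero>\<^bsub>L\<^esub> \<longleftrightarrow> P i j \<noteq> \<zero>\<^bsub>L\<^esub>" for i j
    proof -
      have "f i j = ev (coeff2 p i j * v')"
        unfolding ev_pq[symmetric] q by (simp add: mult.commute)
      thus ?thesis using ev_v' Pc Qc by (simp add: ev_mult ev_p L.integral_iff)
    qed
    hence "total_deg2 L f = total_deg2 L P" unfolding total_deg2_def by simp
    thus False using degP(2) by (simp add: f_def)
  qed
  have cong: "in_coeffs Z (map_poly (map_poly of_int) G - p * q)"
    unfolding in_coeffs_def
  proof (intro allI)
    fix i j
    have "ev (of_int (coeff2 G i j)) = ev (coeff2 (p * q) i j)"
      unfolding ev_pq f by (rule ev_of_int)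
    thus "coeff2 (map_poly (map_poly of_int) G - p * q) i j \<in> Z"
      using ev_minus by (simp add: Z_def coeff_map_poly)
  qed
  have nat_notin: "of_nat ?c \<notin> Z"
  proof
    assume "of_nat ?c \<in> Z"
    hence "\<psi> (int ?c) = \<zero>\<^bsub>L\<^esub>" using ev_of_int[of "int ?c"] by (simp add: Z_def)
    thus False using char[of ?c] c1 ac d by simp
  qed
  obtain a' b' \<beta> \<gamma> where X: "\<And>i. pdeg (pcoeff p i) \<le> \<beta>"
    "\<And>i. pdeg (pcoeff q i) \<le> \<gamma>"
    "coeff2 p a' \<beta> \<noteq> 0" "coeff2 q b' \<gamma> \<noteq> 0"
    "coeff2 (p * q) (a' + b') (\<beta> + \<gamma>) =
       coeff2 p a' \<beta> * coeff2 q b' \<gamma>"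
    by (rule X_degree_mult_witness[OF p_nz q_nz]) metis
  have "\<beta> + \<gamma> \<le> D" using f_supp[OF f_prod[OF X(5,3,4)]] by simp
  moreover have "v' \<notin> Z" using ev_v' by (simp add: Z_def)
  ultimately obtain w where w: "\<forall>r. (\<Sum>c\<in>unknowns d D. entry (map_poly (map_poly of_int) G) r c * w c) \<in> Z"
    "\<exists>c\<in>unknowns d D. w c \<notin> Z"
    using factorisation_gives_kernel_vector[OF Z cong u v' _ a1 c1 nat_notin X(1,2) _ ac[symmetric]] by blast
  have "\<psi> c = \<zero>\<^bsub>L\<^esub>" if "of_int c \<in> Z" for c
    using that ev_of_int[of c] by (simp add: Z_def)
  thus thesis using that[OF Z _ _ w(2)] w(1) by blast
qed

text \<open>
  One statement for \<open>R = \<rat>\<close> and \<open>R = \<int>/p\<close>. The specialised system has integer entries, so its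
  solvability over the closure of \<open>R\<close> forces the integer \<open>\<Delta>(x)\<close> to vanish in \<open>R\<close>.
\<close>

lemma reducible_imp_eval_zero:
  fixes R :: "'a ring" and F :: "int mpoly poly"
  assumes R: "field R" and hom: "int_hom R \<phi>" and F: "F \<in> polys_YX n" "lead_coeff F = 1"
    and d: "d = pdeg F" "d \<le> D"
    and degX: "\<And>i. pdeg (pcoeff (bivariate F) i) \<le> D"
    and char: "\<And>j. 1 \<le> j \<Longrightarrow> j \<le> D \<Longrightarrow> \<phi> (int j) \<noteq> \<zero>\<^bsub>R\<^esub>"
    and \<Delta>: "detects_kernel (unknowns d D) UNIV (entry (bivariate F)) \<Delta>"
    and red: "reducible_over_closure R (specialize R \<phi> n F (\<lambda>k. \<phi> (x k)))"
  shows "\<phi> (eval_at x \<Delta>) = \<zero>\<^bsub>R\<^esub>"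
proof -
  interpret R: field R by (rule R)
  interpret ih: int_hom R \<phi> by (rule hom)
  define L where "L = R.alg_closure"
  define \<iota> where "\<iota> = (R.indexed_const :: 'a \<Rightarrow> (('a list \<times> nat) multiset \<Rightarrow> 'a))"
  interpret algebraic_closure L "\<iota> ` carrier R"
    unfolding L_def \<iota>_def by (rule R.alg_closureE)
  have L: "field L" by (rule field_axioms)
  have \<iota>: "\<iota> \<in> ring_hom R L" unfolding L_def \<iota>_def by (rule R.alg_closureE)
  define \<psi> where "\<psi> = (\<lambda>c. \<iota> (\<phi> c))"
  have hom\<psi>: "int_hom L \<psi>"
    using ring_hom_closed[OF \<iota>] ring_hom_mult[OF \<iota>] ring_hom_add[OF \<iota>] ring_hom_one[OF \<iota>]
    by unfold_locales (simp_all add: \<psi>_def ih.phi_closed ih.phi_add ih.phi_mult ih.phi_one)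
  have \<iota>0: "\<iota> \<zero>\<^bsub>R\<^esub> = \<zero>\<^bsub>L\<^esub>" using ring_hom_zero[OF \<iota> R.ring_axioms ring_axioms] .
  have \<psi>0: "\<psi> c = \<zero>\<^bsub>L\<^esub> \<longleftrightarrow> \<phi> c = \<zero>\<^bsub>R\<^esub>" for c
    unfolding \<psi>_def \<iota>0[symmetric]
    using R.indexed_const_inj_on ih.phi_closed by (auto simp: \<iota>_def inj_on_def)
  define G where "G = map_poly (map_poly (eval_at x)) (bivariate F)"
  interpret e: rhom "eval_at x" by (rule rhom_eval_at)
  interpret e1: rhom "map_poly (eval_at x)" by (rule e.hom_map_poly)
  interpret is1: rhom "isolate1 :: int mpoly \<Rightarrow> int mpoly poly" by (rule rhom_isolate1)
  have coeff_G: "coeff2 G i j = eval_at x (coeff2 (bivariate F) i j)" for i j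
    by (simp add: G_def e.coeff_map e1.coeff_map)
  have cd: "pcoeff G d = 1"
    using F d by (simp add: G_def e1.coeff_map coeff_bivariate is1.hom_one e1.hom_one)
  have "pdeg G \<le> d"
    by (rule degree_le) (simp add: G_def e1.coeff_map coeff_bivariate coeff_eq_0 d is1.hom_zero e1.hom_zero)
  moreover have "d \<le> pdeg G" by (rule le_degree) (simp add: cd)
  ultimately have dG: "d = pdeg G" by simp
  have lG: "lead_coeff G = 1" using cd dG by simp
  have GX: "pdeg (pcoeff G i) \<le> D" for i
    using degX[of i] by (intro degree_le) (auto simp: coeff_G coeff_eq_0 e.hom_zero)
  obtain P Q where PQ: "P \<in> carrier (UP (UP L))" "Q \<in> carrier (UP (UP L))"
    "(\<lambda>i j. \<psi> (coeff2 G i j)) = P \<otimes>\<^bsub>UP (UP L)\<^esub> Q"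
    "1 \<le> total_deg2 L P" "total_deg2 L P < total_deg2 L (P \<otimes>\<^bsub>UP (UP L)\<^esub> Q)"
    using red unfolding reducible_over_closure_def Let_def specialize_eq[OF hom F(1)] coeff_G \<psi>_def
      L_def[symmetric] \<iota>_def[symmetric] by metis
  have char': "\<psi> (int j) \<noteq> \<zero>\<^bsub>L\<^esub>" if "1 \<le> j" "j \<le> D" for j
    using char[OF that] by (simp add: \<psi>0)
  obtain Z w where Z: "prime_ideal Z" "\<And>c. of_int c \<in> Z \<Longrightarrow> \<psi> c = \<zero>\<^bsub>L\<^esub>"
    "\<And>r. (\<Sum>c\<in>unknowns d D. entry (map_poly (map_poly of_int) G) r c * w c) \<in> Z"
    "\<exists>c\<in>unknowns d D. w c \<notin> (Z :: int mpoly set)"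
    by (rule factorisation_over_field_gives_kernel_vector[OF L hom\<psi> PQ lG dG d(2) GX char']) blast+
  define \<theta> where "\<theta> = (\<lambda>a. of_int (eval_at x a) :: int mpoly)"
  have \<theta>: "rhom \<theta>" unfolding \<theta>_def by (rule rhom_comp[OF rhom_eval_at rhom_of_int])
  have "map_poly (map_poly of_int) G = map_poly (map_poly \<theta>) (bivariate F)"
    by (intro poly_eqI) (simp add: coeff_map_poly G_def \<theta>_def e.hom_zero e1.hom_zero)
  hence "(\<Sum>c\<in>unknowns d D. \<theta> (entry (bivariate F) r c) * w c) \<in> Z" for r
    using Z(3)[of r] hom_entry[OF \<theta>, of _ d D "bivariate F" r] by (simp cong: sum.cong)
  hence "\<theta> \<Delta> \<in> Z" using \<Delta> \<theta> Z(1,4) unfolding detects_kernel_def by blast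
  hence "\<psi> (eval_at x \<Delta>) = \<zero>\<^bsub>L\<^esub>" unfolding \<theta>_def by (rule Z(2))
  thus ?thesis by (simp add: \<psi>0)
qed

section \<open>The linear system of a strongly genuine polynomial\<close>

lemma lookup_map: "f 0 = 0 \<Longrightarrow> lookup (Poly_Mapping.map f a) m = f (lookup a m)"
  by transfer (simp add: when_def)

lemma rhom_map_of_int: "rhom (Poly_Mapping.map rat_of_int :: int mpoly \<Rightarrow> rat mpoly)"
proof -
  have eq: "Poly_Mapping.map rat_of_int a = lin_ext (\<lambda>m c. single m (rat_of_int c)) a" for a :: "int mpoly"
    by (rule poly_mapping_eqI)
      (simp add: lookup_map lin_ext_def lookup_sum lookup_single when_def in_keys_iff)
  have "rhom (lin_ext (\<lambda>m c. single m (rat_of_int c)) :: int mpoly \<Rightarrow> rat mpoly)"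
    by (rule rhom_lin_ext) (simp_all add: single_add mult_single)
  thus ?thesis unfolding eq[abs_def] .
qed

lemma keys_map_of_int: "keys (Poly_Mapping.map rat_of_int a) = keys a"
  by (auto simp: in_keys_iff lookup_map)

definition emb :: "int mpoly \<Rightarrow> rat mpoly fract" where
  "emb a = Fract (Poly_Mapping.map rat_of_int a) 1"

lemma rhom_emb: "rhom emb"
proof -
  interpret rhom "Poly_Mapping.map rat_of_int :: int mpoly \<Rightarrow> rat mpoly" by (rule rhom_map_of_int)
  show ?thesis by unfold_locales (simp_all add: emb_def hom_add hom_mult hom_one One_fract_def)
qed

lemma emb_eq_0_iff: "emb a = 0 \<longleftrightarrow> a = 0"
proof -
  have "Poly_Mapping.map rat_of_int a = 0 \<longleftrightarrow> a = 0"
    by (metis keys_map_of_int keys_eq_empty)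
  thus ?thesis by (simp add: emb_def Zero_fract_def eq_fract)
qed

lemma vars_in_map_of_int: "vars_in V (Poly_Mapping.map rat_of_int a) \<longleftrightarrow> vars_in V a"
  by (simp add: vars_in_def keys_map_of_int)

lemma emb_KX: "vars_in {1..n} a \<Longrightarrow> emb a \<in> carrier (KX n)"
proof -
  assume "vars_in {1..n} a"
  hence "vars_in {1..n} (Poly_Mapping.map rat_of_int a)" by (simp add: vars_in_map_of_int)
  moreover have "vars_in {1..n} (1 :: rat mpoly)" "(1 :: rat mpoly) \<noteq> 0" by simp_all
  moreover have "carrier (KX n) = {Fract a b |a b. vars_in {1..n} a \<and> vars_in {1..n} b \<and> b \<noteq> (0 :: rat mpoly)}"
    by (simp add: KX_def in_vars_eq)
  ultimately show ?thesis unfolding emb_def by blast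
qed

lemma D1_emb: "vars_in V a \<Longrightarrow> 1 \<notin> V \<Longrightarrow> D1 (emb a) = 0"
proof -
  assume a: "vars_in V a" "1 \<notin> V"
  have "d1 (Poly_Mapping.map rat_of_int a) = 0" "d1 (1 :: rat mpoly) = 0"
    using d1_const[of V "Poly_Mapping.map rat_of_int a"] a derivation.D_one[OF derivation_d1]
    by (simp_all add: vars_in_map_of_int)
  thus ?thesis by (simp add: emb_def D1_Fract Zero_fract_def eq_fract)
qed

lemma D1_emb_X1: "D1 (emb X1) = 1"
proof -
  have "Poly_Mapping.map rat_of_int X1 = X1"
    by (rule poly_mapping_eqI) (simp add: lookup_map X1_def lookup_single when_def)
  moreover have "d1 (1 :: rat mpoly) = 0" by (rule derivation.D_one[OF derivation_d1])
  ultimately show ?thesis by (simp add: emb_def D1_Fract d1_X1 One_fract_def)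
qed

text \<open>
  The map from \<open>\<int>[X\<^sub>2, \<dots>, X\<^sub>n][X]\<close> to \<open>\<rat>(X\<^sub>1, \<dots>, X\<^sub>n)\<close> that sends the outer variable to \<open>X\<^sub>1\<close>.
  It is injective on polynomials with coefficients free of \<open>X\<^sub>1\<close>, and there it commutes with the
  derivatives.
\<close>

definition emb1 :: "int mpoly poly \<Rightarrow> rat mpoly fract" where
  "emb1 P = emb (poly P X1)"

lemma rhom_emb1: "rhom emb1"
  unfolding emb1_def[abs_def] by (rule rhom_comp[OF rhom_poly rhom_emb])

lemma emb1_isolate1: "emb1 (isolate1 a) = emb a"
  by (simp add: emb1_def poly_isolate1)

lemma emb1_eq_0:
  assumes "emb1 P = 0" "\<And>j. vars_in V (pcoeff P j)" "1 \<notin> V"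
  shows "P = 0"
proof -
  have "poly P X1 = 0" using assms(1) by (simp add: emb1_def emb_eq_0_iff)
  hence "isolate1 (poly P X1) = 0" by (simp add: isolate1_def lin_ext_zero)
  thus ?thesis using isolate1_poly[OF assms(2,3)] by simp
qed

lemma D1_emb1:
  assumes "\<And>j. vars_in V (pcoeff P j)" "1 \<notin> V"
  shows "D1 (emb1 P) = emb1 (pderiv P)"
proof -
  interpret rhom emb by (rule rhom_emb)
  have "emb1 Q = poly (map_poly emb Q) (emb X1)" for Q by (simp add: emb1_def hom_poly)
  moreover have "D1 (poly (map_poly emb P) (emb X1)) = poly (pderiv (map_poly emb P)) (emb X1)"
    by (rule D_poly[OF derivation_D1 D1_emb_X1]) (simp add: coeff_map D1_emb[OF assms])
  ultimately show ?thesis by (simp add: map_poly_pderiv[OF rhom_emb])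
qed

lemma emb1_KX:
  assumes "\<And>j. vars_in {1..n} (pcoeff P j)" "n \<ge> 1"
  shows "emb1 P \<in> carrier (KX n)"
  unfolding emb1_def by (intro emb_KX vars_in_poly assms vars_in_X1) (use assms in auto)

lemma coeff_to_KX_Y_bivariate:
  "to_KX_Y (to_rat_poly F) = map_poly emb1 (bivariate F)"
proof (rule poly_eqI)
  fix j
  interpret rhom "Poly_Mapping.map rat_of_int :: int mpoly \<Rightarrow> rat mpoly" by (rule rhom_map_of_int)
  have "pcoeff (to_KX_Y (to_rat_poly F)) j = emb (pcoeff F j)"
    by (simp add: to_KX_Y_def to_rat_poly_def coeff_map_poly fract_collapse coeff_map emb_def)
  also have "\<dots> = pcoeff (map_poly emb1 (bivariate F)) j"
    by (simp add: rhom.coeff_map[OF rhom_emb1] coeff_bivariate emb1_isolate1)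
  finally show "pcoeff (to_KX_Y (to_rat_poly F)) j = pcoeff (map_poly emb1 (bivariate F)) j" .
qed

lemma degree_to_rat_poly: "pdeg (to_rat_poly F) = pdeg F"
  unfolding to_rat_poly_def
  by (rule degree_map_poly) (metis keys_map_of_int keys_eq_empty)

text \<open>
  A kernel vector assembles into polynomials \<open>g, h, s, t\<close> over \<open>\<rat>(X\<^sub>1, \<dots>, X\<^sub>n)\<close>. The equation for
  \<open>g, h\<close> is a closed form, hence trivial, and \<open>s F = t \<partial>\<^sub>Y F\<close> is trivial because \<open>F\<close> is prime and
  divides neither \<open>\<partial>\<^sub>Y F\<close> nor a nonzero \<open>t\<close> of smaller degree.
\<close>

lemma strongly_genuine_imp_no_kernel:
  assumes n: "n \<ge> 1" and sg: "strongly_genuine_poly n (to_rat_poly F)"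
    and d: "d = pdeg F"
  shows "\<not> kernel_vector {2..n} (unknowns d D) UNIV (entry (bivariate F)) w"
proof
  assume w: "kernel_vector {2..n} (unknowns d D) UNIV (entry (bivariate F)) w"
  interpret genuine_setting n "to_rat_poly F" by unfold_locales (rule n, rule sg)
  interpret e: rhom emb1 by (rule rhom_emb1)
  define T where "T = map_poly emb1"
  interpret T: rhom T unfolding T_def by (rule e.hom_map_poly)
  have coeff_T: "pcoeff (T p) a = emb1 (pcoeff p a)" for p a
    by (simp add: T_def e.coeff_map)
  have Fh: "T (bivariate F) = Fh" unfolding T_def by (rule coeff_to_KX_Y_bivariate[symmetric])
  have dF: "pdeg Fh = d" using d by (simp add: degree_Fh degree_to_rat_poly)
  define S where "S = slot_poly d D w"
  have vS: "vars_in {2..n} (coeff2 (S \<kappa>) a j)" for \<kappa> a j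
    using w by (simp add: S_def coeff_slot_poly kernel_vector_def)
  have TY: "T (pderiv p) = pderiv (T p)" for p
    unfolding T_def by (rule map_poly_pderiv[OF rhom_emb1])
  have TX: "T (dX p) = map_poly D1 (T p)" if "\<And>a j. vars_in {2..n} (coeff2 p a j)" for p
    by (rule poly_eqI)
      (simp add: coeff_T coeff_dX derivation.coeff_map_D[OF derivation_D1] D1_emb1[OF that])
  have vF: "vars_in {2..n} (coeff2 (bivariate F) a j)" for a j
  proof -
    have "vars_in {1..n} (pcoeff F a)"
    proof -
      have "vars_in {1..n} (pcoeff (to_rat_poly F) a)"
        using sg by (simp add: strongly_genuine_poly_def polys_YX_def in_vars_eq)
      thus ?thesis
        by (simp add: to_rat_poly_def rhom.coeff_map[OF rhom_map_of_int] vars_in_map_of_int)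
    qed
    from vars_in_isolate1[OF this, of j] show ?thesis
      unfolding coeff_bivariate by (rule vars_in_mono[rotated]) auto
  qed
  have TP0: "T (S \<kappa>) \<in> P0" for \<kappa>
  proof -
    have "emb1 (pcoeff (S \<kappa>) a) \<in> k0" for a
      by (rule emb1_KX[OF vars_in_mono[OF _ vS] n]) auto
    thus ?thesis by (simp add: P0_def coeff_T)
  qed
  have T_zero: "S \<kappa> = 0" if "T (S \<kappa>) = 0" for \<kappa>
  proof (rule poly_eqI)
    fix a
    have "emb1 (pcoeff (S \<kappa>) a) = 0" using that by (metis coeff_T coeff_0)
    thus "pcoeff (S \<kappa>) a = pcoeff 0 a"
      using emb1_eq_0[OF _ vS] by simp
  qed
  have sys: "(\<Sum>\<kappa><4. contrib (bivariate F) k \<kappa> (S \<kappa>)) = 0" for k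
  proof (intro poly_eqI)
    fix u v
    have "(\<Sum>c\<in>unknowns d D. entry (bivariate F) (k, u, v) c * w c) = 0"
      using w unfolding kernel_vector_def by blast
    thus "coeff2 (\<Sum>\<kappa><4. contrib (bivariate F) k \<kappa> (S \<kappa>)) u v = coeff2 0 u v"
      unfolding system_eq S_def by simp
  qed
  let ?g = "T (S 0)" and ?h = "T (S (Suc 0))" and ?s = "T (S (Suc (Suc 0)))" and ?t = "T (S (Suc (Suc (Suc 0))))"
  have deg: "pcoeff (T (S \<kappa>)) a = 0" if "a \<ge> slot_deg d \<kappa>" for \<kappa> a
  proof -
    have "pcoeff (S \<kappa>) a = 0"
      by (rule poly_eqI) (use that in \<open>simp add: S_def coeff_slot_poly\<close>)
    thus ?thesis by (simp add: coeff_T e.hom_zero)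
  qed
  have "bivariate F * dX (S 0) - S 0 * dX (bivariate F) + (S (Suc 0) * pderiv (bivariate F) - bivariate F * pderiv (S (Suc 0))) = 0"
    using sys[of False] by (simp add: sum_slots)
  from arg_cong[OF this, of T]
  have "Fh * map_poly D1 ?g - ?g * map_poly D1 Fh + (?h * pderiv Fh - Fh * pderiv ?h) = 0"
    by (simp add: T.hom_add T.hom_minus T.hom_mult T.hom_zero TY TX vS vF Fh)
  hence closed: "Fh * (map_poly D1 ?g - pderiv ?h) = ?g * map_poly D1 Fh - ?h * pderiv Fh"
    by (simp add: algebra_simps)
  have gh: "?g = 0" "?h = 0"
    using closed_form_trivial[OF TP0 TP0 closed] deg[of 0] deg[of "Suc 0"] by (simp_all add: dF slot_deg_def)
  have "S (Suc (Suc 0)) * bivariate F + (- S (Suc (Suc (Suc 0))) * pderiv (bivariate F)) = 0"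
    using sys[of True] by (simp add: sum_slots)
  from arg_cong[OF this, of T]
  have "?s * Fh + (- ?t * pderiv Fh) = 0"
    by (simp add: T.hom_add T.hom_minus T.hom_uminus T.hom_mult T.hom_zero TY Fh)
  hence eq: "?s * Fh = ?t * pderiv Fh" by simp
  have st: "?t = 0" "?s = 0"
    using squarefree_trivial[OF TP0 eq] deg[of "Suc (Suc (Suc 0))"] by (simp_all add: dF slot_deg_def)
  have S0: "S \<kappa> = 0" if "\<kappa> < 4" for \<kappa>
    using that by (cases rule: slot_cases) (use gh st T_zero in auto)
  obtain \<kappa> a b where "(\<kappa>, a, b) \<in> unknowns d D" "w (\<kappa>, a, b) \<noteq> 0"
    using w unfolding kernel_vector_def by auto
  thus False using S0[of \<kappa>] coeff_slot_poly[of d D w \<kappa> a b] by (auto simp: unknowns_def S_def)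
qed

section \<open>Counting the exceptional specialisations\<close>

lemma finite_monomials: "finite (monomials F)"
proof (rule finite_subset)
  show "monomials F \<subseteq> (SIGMA j:{..pdeg F}. keys (pcoeff F j))"
    by (auto simp: monomials_def intro: le_degree)
qed auto

lemma exponents_le_total_deg:
  assumes "m \<in> keys (pcoeff F i)"
  shows "i \<le> total_deg F" "lookup m k \<le> total_deg F"
proof -
  have "(i, m) \<in> monomials F" using assms by (simp add: monomials_def)
  hence "i + (\<Sum>k\<in>keys m. lookup m k) \<le> total_deg F"
    unfolding total_deg_def using finite_monomials by (intro Max_ge) (auto intro!: image_eqI[of _ _ "(i, m)"])
  moreover have "lookup m k \<le> (\<Sum>k\<in>keys m. lookup m k)"
    by (cases "k \<in> keys m") (auto simp: in_keys_iff intro: member_le_sum)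
  ultimately show "i \<le> total_deg F" "lookup m k \<le> total_deg F" by auto
qed

lemma abs_coeff_le_coeff_norm: "\<bar>lookup (pcoeff F i) m\<bar> \<le> max 1 (coeff_norm F)"
proof (cases "m \<in> keys (pcoeff F i)")
  case True
  hence "(i, m) \<in> monomials F" by (simp add: monomials_def)
  hence "\<bar>lookup (pcoeff F i) m\<bar> \<le> coeff_norm F"
    unfolding coeff_norm_def using finite_monomials by (intro Max_ge) (auto intro!: image_eqI[of _ _ "(i, m)"])
  thus ?thesis by simp
qed (simp add: in_keys_iff)

lemma card_exponents_le:
  assumes "\<And>m. m \<in> A \<Longrightarrow> keys m \<subseteq> V \<and> (\<forall>k. lookup m k \<le> D)" "finite V"
  shows "card A \<le> (D + 1) ^ card V"
proof -
  have "inj_on (\<lambda>m. restrict (lookup m) V) A"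
  proof (rule inj_onI, rule poly_mapping_eqI)
    fix m m' :: "'a \<Rightarrow>\<^sub>0 nat" and k
    assume *: "m \<in> A" "m' \<in> A" "restrict (lookup m) V = restrict (lookup m') V"
    show "lookup m k = lookup m' k"
    proof (cases "k \<in> V")
      case True
      thus ?thesis using fun_cong[OF *(3), of k] by simp
    next
      case False
      hence "k \<notin> keys m" "k \<notin> keys m'" using assms(1) * by blast+
      thus ?thesis by (simp add: in_keys_iff)
    qed
  qed
  hence "card A = card ((\<lambda>m. restrict (lookup m) V) ` A)" by (simp add: card_image)
  also have "\<dots> \<le> card (V \<rightarrow>\<^sub>E {..D})"
    by (rule card_mono) (use assms in \<open>auto intro!: finite_PiE\<close>)
  also have "\<dots> = (D + 1) ^ card V" using assms(2) by (simp add: card_PiE flip: Suc_eq_plus1)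
  finally show ?thesis .
qed

lemma bivariate_bounds:
  assumes F: "F \<in> polys_YX n" and D: "total_deg F = D"
  shows "coeffs_size_le {2..n} D (int ((D + 1) ^ n) * max 1 (coeff_norm F)) (bivariate F)"
    and "pdeg (pcoeff (bivariate F) i) \<le> D"
    and "pdeg (bivariate F) \<le> D" and "pdeg F \<le> D"
proof -
  have ks: "keys m \<subseteq> {1..n}" if "m \<in> keys (pcoeff F i)" for m i
    using F that by (auto simp: polys_YX_def in_vars_def)
  show "coeffs_size_le {2..n} D (int ((D + 1) ^ n) * max 1 (coeff_norm F)) (bivariate F)"
    unfolding coeffs_size_le_def size_le_def
  proof (intro allI conjI)
    fix i j
    let ?S = "{m \<in> keys (pcoeff F i). lookup m 1 = j}"
    have "vars_in ({1..n} - {1}) (pcoeff (isolate1 (pcoeff F i)) j)"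
      by (rule vars_in_isolate1) (use ks in \<open>auto simp: vars_in_def\<close>)
    thus "vars_in {2..n} (coeff2 (bivariate F) i j)"
      unfolding coeff_bivariate by (rule vars_in_mono[rotated]) auto
    have "deg_le D (single (drop1 m) c)" if "m \<in> ?S" for m and c :: int
      using exponents_le_total_deg(2)[of m F i] that D
      by (cases "c = 0") (auto simp: deg_le_def lookup_drop1)
    thus "deg_le D (coeff2 (bivariate F) i j)"
      unfolding coeff_bivariate coeff_isolate1 by (intro deg_le_sum) blast
    have "norm1 (coeff2 (bivariate F) i j) \<le>
        (\<Sum>m\<in>?S. \<bar>lookup (pcoeff F i) m\<bar>)"
      unfolding coeff_bivariate coeff_isolate1 by (rule order_trans[OF norm1_sum]) simp
    also have "\<dots> \<le> (\<Sum>m\<in>?S. max 1 (coeff_norm F))"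
      by (intro sum_mono abs_coeff_le_coeff_norm)
    also have "\<dots> = int (card ?S) * max 1 (coeff_norm F)" by simp
    also have "\<dots> \<le> int ((D + 1) ^ n) * max 1 (coeff_norm F)"
    proof (intro mult_right_mono)
      have "card ?S \<le> (D + 1) ^ card {1..n}"
        by (rule card_exponents_le) (use ks exponents_le_total_deg(2) D in auto)
      thus "int (card ?S) \<le> int ((D + 1) ^ n)" by (simp del: of_nat_power of_nat_add)
    qed auto
    finally show "norm1 (coeff2 (bivariate F) i j) \<le> int ((D + 1) ^ n) * max 1 (coeff_norm F)" .
  qed
  show "pdeg (pcoeff (bivariate F) i) \<le> D"
  proof (rule degree_le, intro allI impI)
    fix j assume "D < j"
    hence "{m \<in> keys (pcoeff F i). lookup m 1 = j} = {}"
      using exponents_le_total_deg(2)[of _ F i 1] D by fastforce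
    thus "coeff2 (bivariate F) i j = 0"
      unfolding coeff_bivariate coeff_isolate1 by (simp only: sum.empty)
  qed
  have "pcoeff F i = 0" if "D < i" for i
  proof -
    have "keys (pcoeff F i) = {}" using exponents_le_total_deg(1)[of _ F i] that D by force
    thus ?thesis by simp
  qed
  thus "pdeg F \<le> D" "pdeg (bivariate F) \<le> D"
    by (auto intro!: degree_le simp: coeff_bivariate isolate1_def lin_ext_zero)
qed

lemma specialize_cong:
  fixes R :: "'a ring" (structure)
  assumes R: "cring R" and xy: "\<And>k. k \<in> {2..n} \<Longrightarrow> x k = y k" "\<And>k. k \<in> {2..n} \<Longrightarrow> y k \<in> carrier R"
  shows "specialize R \<phi> n F x = specialize R \<phi> n F y"
proof -
  interpret cring R by (rule R)
  have "(\<Otimes>k\<in>{2..n}. x k [^] lookup m k) = (\<Otimes>k\<in>{2..n}. y k [^] lookup m k)" for m :: "nat \<Rightarrow>\<^sub>0 nat"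
    by (intro finprod_cong') (use xy in auto)
  thus ?thesis by (simp add: specialize_def fun_eq_iff)
qed

lemma int_hom_rat: "int_hom (ring_of_type_algebra :: rat ring) rat_of_int"
proof -
  interpret cring "ring_of_type_algebra :: rat ring" by (rule cring_from_type_algebra)
  show ?thesis by unfold_locales (simp_all add: ring_of_type_algebra_def)
qed

lemma int_hom_mod:
  assumes "Factorial_Ring.prime p"
  shows "int_hom (residue_ring (int p)) (\<lambda>c. c mod int p)"
proof -
  interpret residues_prime p "residue_ring (int p)"
    by (rule residues_prime.intro[OF assms]) 
  have p: "int p > 1" using assms prime_gt_1_nat by simp
  show ?thesis
    by unfold_locales (use p in \<open>simp_all add: residue_ring_def mod_add_eq mod_mult_eq\<close>)
qed

text \<open>
  The bounds depend only on \<open>n\<close>, \<open>D\<close> and \<open>\<parallel>F\<parallel>\<close>, because \<open>D\<close> bounds the number of columns of the system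
  and the number and degrees of the monomials of \<open>F\<close>.
\<close>

lemma certificate_exists:
  assumes n: "n \<ge> 1"
  shows "\<exists>(k::int) e. k \<ge> 1 \<and> (\<forall>F d. F \<in> polys_YX n \<longrightarrow> strongly_genuine_poly n (to_rat_poly F) \<longrightarrow>
     total_deg F = D \<longrightarrow> d = pdeg F \<longrightarrow>
     (\<exists>\<Delta>. \<Delta> \<noteq> 0 \<and> size_le {2..n} e (k * max 1 (coeff_norm F) ^ e) \<Delta> \<and>
        detects_kernel (unknowns d D) UNIV (entry (bivariate F)) \<Delta>))"
proof -
  obtain k e where k: "k \<ge> (1::int)" and elim:
    "\<And>(C::(nat \<times> nat \<times> nat) set) (R::(bool \<times> nat \<times> nat) set) N \<delta> H. finite C \<Longrightarrow> card C \<le> 4 * (D * (D + 1)) \<Longrightarrow> 1 \<le> H \<Longrightarrow>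
       (\<forall>i\<in>R. \<forall>j\<in>C. size_le {2..n} \<delta> H (N i j)) \<Longrightarrow>
       (\<exists>w. kernel_vector {2..n} C R N w) \<or>
       (\<exists>\<Delta>. \<Delta> \<noteq> 0 \<and> size_le {2..n} (e * \<delta>) (k * H ^ e) \<Delta> \<and> detects_kernel C R N \<Delta>)"
    using elimination[where V = "{2..n}" and r = "4 * (D * (D + 1))"
      and 'c = "nat \<times> nat \<times> nat" and 'r = "bool \<times> nat \<times> nat"] by blast
  \<comment> \<open>\<open>2 D\<^sup>2\<close> from the entries, \<open>(D + 1)^n\<close> for the number of monomials\<close>
  define h :: int where "h = 2 * int D ^ 2 * int ((D + 1) ^ n) + 1"
  have h: "h \<ge> 1" by (simp add: h_def)
  define e' where "e' = e * (D + 1)"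
  show ?thesis
  proof (intro exI[of _ "k * h ^ e"] exI[of _ e'] conjI allI impI)
    show "1 \<le> k * h ^ e" using mult_mono[of 1 k 1 "h ^ e"] k h by simp
    fix F d
    assume F: "F \<in> polys_YX n" and sg: "strongly_genuine_poly n (to_rat_poly F)"
      and D: "total_deg F = D" and d: "d = pdeg F"
    interpret genuine_setting n "to_rat_poly F" by unfold_locales (rule n, rule sg)
    note b = bivariate_bounds[OF F D]
    have dD: "d \<le> D" using b(4) d by simp
    have D1: "1 \<le> D" using degree_Fh_pos dD d by (simp add: degree_Fh degree_to_rat_poly)
    define M where "M = max 1 (coeff_norm F)"
    have M: "M \<ge> 1" by (simp add: M_def)
    define H where "H = h * M"
    have H: "1 \<le> H" unfolding H_def using mult_mono[of 1 h 1 M] h M by simp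
    have "size_le {2..n} D H (entry (bivariate F) r c)" if "c \<in> unknowns d D" for r c
    proof (rule size_le_mono[OF size_entry[OF b(1,3,2) that D1 dD]])
      show "2 * (int D)\<^sup>2 * (int ((D + 1) ^ n) * max 1 (coeff_norm F)) \<le> H"
        using M by (simp add: H_def h_def algebra_simps flip: M_def)
    qed simp
    with elim[OF finite_unknowns card_unknowns[OF dD] H, of UNIV D "entry (bivariate F)"]
      strongly_genuine_imp_no_kernel[OF n sg d]
    obtain \<Delta> where \<Delta>: "\<Delta> \<noteq> 0" "size_le {2..n} (e * D) (k * H ^ e) \<Delta>" "detects_kernel (unknowns d D) UNIV (entry (bivariate F)) \<Delta>"
      by blast
    have "k * H ^ e \<le> k * h ^ e * M ^ e'"
    proof -
      have "M ^ e \<le> M ^ e'" using M by (intro power_increasing) (auto simp: e'_def)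
      hence "(k * h ^ e) * M ^ e \<le> (k * h ^ e) * M ^ e'" using k h by (intro mult_left_mono) auto
      thus ?thesis by (simp add: H_def power_mult_distrib mult.assoc)
    qed
    moreover have "e * D \<le> e'" by (simp add: e'_def)
    ultimately have "size_le {2..n} e' (k * h ^ e * M ^ e') \<Delta>" using size_le_mono[OF \<Delta>(2)] by blast
    thus "\<exists>\<Delta>. \<Delta> \<noteq> 0 \<and> size_le {2..n} e' (k * h ^ e * max 1 (coeff_norm F) ^ e') \<Delta> \<and>
        detects_kernel (unknowns d D) UNIV (entry (bivariate F)) \<Delta>"
      using \<Delta> unfolding M_def by blast
  qed
qed

lemma card_prime_divisors:
  fixes c :: int
  assumes "c \<noteq> 0"
  defines "E \<equiv> {p::nat. Factorial_Ring.prime p \<and> int p dvd c}"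
  shows "finite E" "fact (card E) \<le> \<bar>c\<bar>"
proof -
  have E: "p dvd nat \<bar>c\<bar>" if "p \<in> E" for p
  proof -
    have "int p dvd int (nat \<bar>c\<bar>)" using that by (simp add: E_def)
    thus ?thesis by (simp only: of_nat_dvd_iff)
  qed
  have "E \<subseteq> {..nat \<bar>c\<bar>}" using E dvd_imp_le assms(1) by auto
  thus fin: "finite E" by (rule finite_subset) simp
  have "fact (card E) \<le> \<Prod>E"
    by (rule fact_card_le_prod[OF fin]) (auto simp: E_def)
  also have "\<dots> \<le> nat \<bar>c\<bar>"
    by (rule dvd_imp_le[OF prod_primes_dvd[OF fin]]) (use E assms in \<open>auto simp: E_def\<close>)
  finally have "int (fact (card E)) \<le> int (nat \<bar>c\<bar>)" by (simp only: of_nat_le_iff)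
  thus "fact (card E) \<le> \<bar>c\<bar>" by simp
qed

lemma card_reducible_at_int:
  assumes n: "n \<ge> 2" and F: "F \<in> polys_YX n" "strongly_genuine_poly n (to_rat_poly F)" "total_deg F = D"
    and d: "d = pdeg F"
    and \<Delta>: "\<Delta> \<noteq> 0" "size_le {2..n} \<delta> H \<Delta>" "detects_kernel (unknowns d D) UNIV (entry (bivariate F)) \<Delta>"
    and lc: "lead_coeff F = 1" and B: "B \<ge> (1::real)"
  shows "real (card {x \<in> {2..n} \<rightarrow>\<^sub>E (UNIV :: int set).
      (\<forall>k\<in>{2..n}. \<bar>real_of_int (x k)\<bar> \<le> B) \<and> reducible_at_int n F x}) \<le> (real n * real \<delta> * 3 ^ (n - 2)) * B ^ (n - 2)"
proof -
  note b = bivariate_bounds[OF F(1,3)]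
  define T where "T = {- \<lfloor>B\<rfloor>..\<lfloor>B\<rfloor>}"
  have Tmem: "t \<in> T \<longleftrightarrow> \<bar>real_of_int t\<bar> \<le> B" for t
    unfolding T_def by (auto simp: le_floor_iff abs_le_iff) linarith+
  obtain m0 where m0: "lookup \<Delta> m0 \<noteq> 0" using \<Delta>(1) by (metis poly_mapping_eqI lookup_zero)
  let ?A = "{x \<in> {2..n} \<rightarrow>\<^sub>E (UNIV :: int set). (\<forall>k\<in>{2..n}. \<bar>real_of_int (x k)\<bar> \<le> B) \<and> reducible_at_int n F x}"
  let ?Z = "{x \<in> {2..n} \<rightarrow>\<^sub>E T. 0 dvd eval_at x \<Delta>}"
  have "?A \<subseteq> ?Z"
  proof
    fix x assume x: "x \<in> ?A"
    have "rat_of_int (eval_at x \<Delta>) = \<zero>\<^bsub>ring_of_type_algebra\<^esub>"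
      by (rule reducible_imp_eval_zero[OF field_from_type_algebra int_hom_rat F(1) lc d _ b(2) _ \<Delta>(3)])
        (use x d b(4) in \<open>auto simp: reducible_at_int_def ring_of_type_algebra_def\<close>)
    thus "x \<in> ?Z" using x by (auto simp: ring_of_type_algebra_def PiE_iff Tmem)
  qed
  moreover have "finite ?Z" by (rule finite_subset[of _ "{2..n} \<rightarrow>\<^sub>E T"]) (auto simp: T_def intro!: finite_PiE)
  ultimately have "card ?A \<le> card ?Z" by (rule card_mono[rotated])
  also have "card ?Z \<le> card {2..n} * \<delta> * card T ^ (card {2..n} - 1)"
    by (rule card_zeros_eval_at[where ?m0.0 = m0]) (use \<Delta>(2) m0 in \<open>auto simp: size_le_def T_def\<close>)
  also have "card {2..n} = n - 1" by simp
  finally have "card ?A \<le> (n - 1) * \<delta> * card T ^ (n - 2)" by (simp add: numeral_2_eq_2)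
  hence "real (card ?A) \<le> real ((n - 1) * \<delta> * card T ^ (n - 2))" by (simp only: of_nat_le_iff)
  also have "\<dots> = real (n - 1) * real \<delta> * real (card T) ^ (n - 2)" by simp
  also have "\<dots> \<le> real n * real \<delta> * (3 * B) ^ (n - 2)"
  proof (intro mult_mono power_mono)
    have "real (card T) = 2 * real_of_int \<lfloor>B\<rfloor> + 1" using B by (simp add: T_def)
    also have "\<dots> \<le> 3 * B" using B by linarith
    finally show "real (card T) \<le> 3 * B" .
  qed (use B in auto)
  finally show ?thesis by (simp add: power_mult_distrib mult_ac)
qed

text \<open>
  For \<open>p > D\<close> the degrees in \<open>Y\<close> of proper factors are invertible modulo \<open>p\<close>, as the linear criterion
  requires. For \<open>p \<le> D\<close> the number of all points is \<open>p p^(n - 2)\<close>, which is at most \<open>D p^(n - 2)\<close>.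
\<close>

lemma card_reducible_at_mod:
  assumes n: "n \<ge> 2" and F: "F \<in> polys_YX n" "strongly_genuine_poly n (to_rat_poly F)" "total_deg F = D"
    and d: "d = pdeg F"
    and \<Delta>: "size_le {2..n} \<delta> H \<Delta>" "detects_kernel (unknowns d D) UNIV (entry (bivariate F)) \<Delta>"
    and lc: "lead_coeff F = 1"
    and p: "Factorial_Ring.prime p" "\<not> int p dvd lookup \<Delta> m0"
  shows "real (card {x \<in> {2..n} \<rightarrow>\<^sub>E carrier (residue_ring (int p)). reducible_at_mod p n F x})
      \<le> (real n * real \<delta> + real D) * real p ^ (n - 2)"
proof -
  note b = bivariate_bounds[OF F(1,3)]
  define T where "T = carrier (residue_ring (int p))"
  have T: "T = {0..int p - 1}" by (simp add: T_def residue_ring_def)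
  have cT: "card T = p" by (simp add: T)
  let ?A = "{x \<in> {2..n} \<rightarrow>\<^sub>E T. reducible_at_mod p n F x}"
  have fin: "finite ({2..n} \<rightarrow>\<^sub>E T)" by (auto simp: T intro!: finite_PiE)
  have "real (card ?A) \<le> (real n * real \<delta> + real D) * real p ^ (n - 2)"
  proof (cases "p \<le> D")
    case True
    have "card ?A \<le> card ({2..n} \<rightarrow>\<^sub>E T)" by (rule card_mono[OF fin]) auto
    also have "\<dots> = p ^ (n - 1)" by (simp add: card_PiE cT)
    also have "n - 1 = Suc (n - 2)" using n by simp
    finally have "card ?A \<le> p * p ^ (n - 2)" by simp
    also have "\<dots> \<le> D * p ^ (n - 2)" using True by simp
    finally have "real (card ?A) \<le> real (D * p ^ (n - 2))" by (simp only: of_nat_le_iff)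
    also have "\<dots> = real D * real p ^ (n - 2)" by simp
    also have "\<dots> \<le> (real n * real \<delta> + real D) * real p ^ (n - 2)" by (intro mult_right_mono) auto
    finally show ?thesis .
  next
    case False
    interpret residues_prime p "residue_ring (int p)" by (rule residues_prime.intro[OF p(1)])
    have fld: "field (residue_ring (int p))" by (rule is_field)
    have cr: "cring (residue_ring (int p))" by (rule is_cring)
    let ?Z = "{x \<in> {2..n} \<rightarrow>\<^sub>E T. int p dvd eval_at x \<Delta>}"
    have "?A \<subseteq> ?Z"
    proof
      fix x assume x: "x \<in> ?A"
      hence xT: "x k \<in> T" if "k \<in> {2..n}" for k using that by (auto simp: PiE_iff)
      have "specialize (residue_ring (int p)) (\<lambda>c. c mod int p) n F x =
        specialize (residue_ring (int p)) (\<lambda>c. c mod int p) n F (\<lambda>k. x k mod int p)"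
        by (rule specialize_cong[OF cr]) (use xT in \<open>auto simp: T residue_ring_def\<close>)
      hence red: "reducible_over_closure (residue_ring (int p))
          (specialize (residue_ring (int p)) (\<lambda>c. c mod int p) n F (\<lambda>k. x k mod int p))"
        using x by (simp add: reducible_at_mod_def)
      have "int j mod int p \<noteq> 0" if "1 \<le> j" "j \<le> D" for j
        using that False by simp
      hence "eval_at x \<Delta> mod int p = \<zero>\<^bsub>residue_ring (int p)\<^esub>"
        by (intro reducible_imp_eval_zero[OF fld int_hom_mod[OF p(1)] F(1) lc d _ b(2) _ \<Delta>(2) red])
          (use d b(4) in \<open>auto simp: residue_ring_def\<close>)
      thus "x \<in> ?Z" using x by (simp add: residue_ring_def mod_eq_0_iff_dvd)
    qed
    moreover have "finite ?Z" by (rule finite_subset[OF _ fin]) auto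
    ultimately have "card ?A \<le> card ?Z" by (rule card_mono[rotated])
    also have "card ?Z \<le> card {2..n} * \<delta> * card T ^ (card {2..n} - 1)"
    proof (rule card_zeros_eval_at[where ?m0.0 = m0])
      show "int p dvd a \<or> int p dvd b" if "int p dvd a * b" for a b
        using that p(1) by (simp add: prime_dvd_mult_iff)
      show "s = t" if "s \<in> T" "t \<in> T" "int p dvd s - t" for s t
      proof -
        have "s mod int p = t mod int p" using that(3) by (simp add: mod_eq_dvd_iff)
        thus ?thesis using that by (simp add: T)
      qed
    qed (use \<Delta>(1) p(2) in \<open>auto simp: size_le_def T\<close>)
    also have "card {2..n} = n - 1" by simp
    finally have "card ?A \<le> (n - 1) * \<delta> * p ^ (n - 2)" by (simp add: numeral_2_eq_2 cT)
    hence "real (card ?A) \<le> real ((n - 1) * \<delta> * p ^ (n - 2))" by (simp only: of_nat_le_iff)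
    also have "\<dots> = (real (n - 1) * real \<delta>) * real p ^ (n - 2)" by simp
    also have "\<dots> \<le> (real n * real \<delta> + real D) * real p ^ (n - 2)"
      using mult_right_mono[of "real (n - 1)" "real n" "real \<delta>"] by (intro mult_right_mono) auto
    finally show ?thesis .
  qed
  thus ?thesis by (simp only: T_def)
qed

theorem theorem1p6:
  fixes n D :: nat
  assumes "n \<ge> 2"
  shows "\<exists>C::real. \<forall>F :: int mpoly poly.
    F \<in> polys_YX n \<and> strongly_genuine_poly n (to_rat_poly F) \<and> total_deg F = D \<longrightarrow>
      (\<forall>B::real. B \<ge> 1 \<longrightarrow>
         real (card {x \<in> {2..n} \<rightarrow>\<^sub>E (UNIV :: int set).
                       (\<forall>k\<in>{2..n}. \<bar>real_of_int (x k)\<bar> \<le> B) \<and> reducible_at_int n F x})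
           \<le> C * B ^ (n - 2)) \<and>
      (\<exists>E :: nat set. finite E \<and> (\<forall>p\<in>E. Factorial_Ring.prime p) \<and>
         (let N = max (real_of_int (coeff_norm F)) 3
          in real (card E) \<le> C * (ln N / ln (ln N))) \<and>
         (\<forall>p::nat. Factorial_Ring.prime p \<and> p \<notin> E \<longrightarrow>
            real (card {x \<in> {2..n} \<rightarrow>\<^sub>E carrier (residue_ring (int p)). reducible_at_mod p n F x})
              \<le> C * real p ^ (n - 2)))"
proof -
  have n1: "n \<ge> 1" using assms by simp
  obtain k :: int and e where k: "k \<ge> 1" and cert: "\<And>F d. F \<in> polys_YX n \<Longrightarrow> strongly_genuine_poly n (to_rat_poly F) \<Longrightarrow>
     total_deg F = D \<Longrightarrow> d = pdeg F \<Longrightarrow>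
     \<exists>\<Delta>. \<Delta> \<noteq> 0 \<and> size_le {2..n} e (k * max 1 (coeff_norm F) ^ e) \<Delta> \<and>
        detects_kernel (unknowns d D) UNIV (entry (bivariate F)) \<Delta>"
    using certificate_exists[OF n1, of D] by blast
  define C1 where "C1 = real n * real e * 3 ^ (n - 2)"
  define C2 where "C2 = 16 + 4 * (ln (real_of_int k) + real e)"
  define C3 where "C3 = real n * real e + real D"
  have lnk: "ln (real_of_int k) \<ge> 0" using k by simp
  have nonneg: "C1 \<ge> 0" "C2 \<ge> 0" "C3 \<ge> 0" using lnk by (simp_all add: C1_def C2_def C3_def)
  have ln3: "ln (3::real) > 1"
    using ln_less_cancel_iff[of "exp 1" 3] exp_1_less_3 by simp
  show ?thesis
  proof (intro exI[of _ "C1 + C2 + C3"] allI impI, elim conjE, intro conjI allI impI)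
    fix F assume F: "F \<in> polys_YX n" "strongly_genuine_poly n (to_rat_poly F)" "total_deg F = D"
    have lc: "lead_coeff F = 1"
    proof -
      have "lead_coeff (to_rat_poly F) = 1" using F(2) by (simp add: strongly_genuine_poly_def)
      hence "Poly_Mapping.map rat_of_int (lead_coeff F) = 1"
        by (simp add: degree_to_rat_poly) (simp add: to_rat_poly_def rhom.coeff_map[OF rhom_map_of_int])
      also have "1 = Poly_Mapping.map rat_of_int (1 :: int mpoly)"
        by (rule rhom.hom_one[OF rhom_map_of_int, symmetric])
      finally have "Poly_Mapping.map rat_of_int (lead_coeff F - 1) = 0"
        by (simp add: rhom.hom_minus[OF rhom_map_of_int])
      hence "lead_coeff F - 1 = 0" by (metis keys_map_of_int keys_eq_empty)
      thus ?thesis by simp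
    qed
    obtain \<Delta> where \<Delta>: "\<Delta> \<noteq> 0" "size_le {2..n} e (k * max 1 (coeff_norm F) ^ e) \<Delta>"
      "detects_kernel (unknowns (pdeg F) D) UNIV (entry (bivariate F)) \<Delta>"
      using cert[OF F refl] by blast
    {
      fix B :: real assume B: "1 \<le> B"
      have "C1 * B ^ (n - 2) \<le> (C1 + C2 + C3) * B ^ (n - 2)"
        using nonneg B by (intro mult_right_mono) auto
      thus "real (card {x \<in> {2..n} \<rightarrow>\<^sub>E (UNIV :: int set).
                       (\<forall>k\<in>{2..n}. \<bar>real_of_int (x k)\<bar> \<le> B) \<and> reducible_at_int n F x})
           \<le> (C1 + C2 + C3) * B ^ (n - 2)"
        using card_reducible_at_int[OF assms F refl \<Delta> lc B] unfolding C1_def by linarith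
    }
    obtain m0 where m0: "lookup \<Delta> m0 \<noteq> 0" using \<Delta>(1) by (metis poly_mapping_eqI lookup_zero)
    define c where "c = lookup \<Delta> m0"
    define E where "E = {p::nat. Factorial_Ring.prime p \<and> int p dvd c}"
    have E: "finite E" "fact (card E) \<le> \<bar>c\<bar>" using card_prime_divisors[of c] m0 by (auto simp: E_def c_def)
    define N where "N = max (real_of_int (coeff_norm F)) 3"
    have N3: "N \<ge> 3" by (simp add: N_def)
    have "\<bar>c\<bar> \<le> k * max 1 (coeff_norm F) ^ e"
      using abs_lookup_le_norm1[of \<Delta> m0] \<Delta>(2) by (simp add: c_def size_le_def)
    with E(2) have "fact (card E) \<le> k * max 1 (coeff_norm F) ^ e" by linarith
    hence "real_of_int (fact (card E)) \<le> real_of_int (k * max 1 (coeff_norm F) ^ e)" by (simp only: of_int_le_iff)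
    also have "\<dots> = real_of_int k * real_of_int (max 1 (coeff_norm F)) ^ e" by simp
    also have "\<dots> \<le> real_of_int k * N ^ e"
      using k by (intro mult_left_mono power_mono) (auto simp: N_def)
    finally have "fact (card E) \<le> real_of_int k * N ^ e" by simp
    from fact_le_imp_le_log_ratio[OF this _ N3] k
    have cE: "real (card E) \<le> C2 * (ln N / ln (ln N))" by (simp add: C2_def)
    have "0 \<le> ln N / ln (ln N)"
    proof -
      have "ln N \<ge> ln 3" using N3 by simp
      thus ?thesis using ln3 by simp
    qed
    hence "C2 * (ln N / ln (ln N)) \<le> (C1 + C2 + C3) * (ln N / ln (ln N))"
      using nonneg by (intro mult_right_mono) auto
    with cE have card_E: "real (card E) \<le> (C1 + C2 + C3) * (ln N / ln (ln N))" by linarith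
    have mod: "real (card {x \<in> {2..n} \<rightarrow>\<^sub>E carrier (residue_ring (int p)). reducible_at_mod p n F x})
              \<le> (C1 + C2 + C3) * real p ^ (n - 2)" if p: "Factorial_Ring.prime p" "p \<notin> E" for p
    proof -
      have "\<not> int p dvd lookup \<Delta> m0" using p by (simp add: E_def c_def)
      from card_reducible_at_mod[OF assms F refl \<Delta>(2,3) lc p(1) this]
      have "real (card {x \<in> {2..n} \<rightarrow>\<^sub>E carrier (residue_ring (int p)). reducible_at_mod p n F x}) \<le> C3 * real p ^ (n - 2)"
        by (simp add: C3_def)
      also have "\<dots> \<le> (C1 + C2 + C3) * real p ^ (n - 2)"
        using nonneg by (intro mult_right_mono) auto
      finally show ?thesis .
    qed
    show "\<exists>E :: nat set. finite E \<and> (\<forall>p\<in>E. Factorial_Ring.prime p) \<and>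
         (let N = max (real_of_int (coeff_norm F)) 3
          in real (card E) \<le> (C1 + C2 + C3) * (ln N / ln (ln N))) \<and>
         (\<forall>p::nat. Factorial_Ring.prime p \<and> p \<notin> E \<longrightarrow>
            real (card {x \<in> {2..n} \<rightarrow>\<^sub>E carrier (residue_ring (int p)). reducible_at_mod p n F x})
              \<le> (C1 + C2 + C3) * real p ^ (n - 2))"
      using E(1) card_E mod unfolding Let_def N_def by (intro exI[of _ E]) (auto simp: E_def)
  qed
qed

end
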